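(* Let $f$ satisfy $(f_0)$, $(f_1)$ and $(f_2)'$. Then for every $\lambda>0$ there exist a weak subsolution $u_0$ and a weak supersolution $u^0$ of $(P_\lambda)$ which are strict in the sense that there are constants $\chi_\#,\chi^\#>0$ with $-\mathcal{L}_{p,q}u_0\le\lambda f(u_0)u_0^{-\gamma}-\chi_\#$ and $-\mathcal{L}_{p,q}u^0\ge\lambda f(u^0)(u^0)^{-\gamma}+\chi^\#$ weakly in $\Omega$. Moreover $u_0,u^0\in C^{1,l}(\overline\Omega)\cap C_\delta(\overline\Omega)^+$ for some $l\in(0,1)$.
   Context: $\Omega\subset\mathbb{R}^N$ bounded with $C^2$ boundary, $1<p<q<\infty$, $\gamma\in(0,1)$. $\mathcal{L}_{p,q}u=\operatorname{div}(|\nabla u|^{p-2}\nabla u+|\nabla u|^{q-2}\nabla u)$; $(P_\lambda)$: $-\mathcal{L}_{p,q}u=\lambda f(u)/u^\gamma$, $u>0$ in $\Omega$, $u=0$ on $\partial\Omega$. Weak sub/supersolution: $u\in W_0^{1,q}(\Omega)$, $\inf_K u>0$ for every $K\Subset\Omega$, $f(u)\in L^{q'}_{loc}$, and $\int_\Omega(|\nabla u|^{p-2}+|\nabla u|^{q-2})\nabla u\cdot\nabla\xi\le$ (resp. $\ge$) $\lambda\int_\Omega f(u)u^{-\gamma}\xi$ for all $\xi\ge0$ in $\bigcup_{\Omega'\Subset\Omega}W_0^{1,q}(\Omega')$; inequalities "weakly in $\Omega$" are meant in this tested sense. $\delta=\operatorname{dist}(\cdot,\partial\Omega)$; $C_\delta(\overline\Omega)^+=\{u\in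 C_0(\overline\Omega):\exists\,0<c_1\le c_2,\ c_1\delta\le u\le c_2\delta\}$. $(f_0)$: $f\in C^1([0,\infty))$, $f(0)>0$; $(f_1)$: $f$ nondecreasing; $(f_2)'$: $\lim_{t\to\infty}f(t)/t^{q-1+\gamma}=0$. *)

theory Defs
  imports "HOL-Analysis.Analysis"
begin

definition Lp_on :: "real \<Rightarrow> 'a::euclidean_space set \<Rightarrow> ('a \<Rightarrow> real) \<Rightarrow> bool" where
  "Lp_on r S u \<longleftrightarrow> u \<in> borel_measurable (lebesgue_on S) \<and>
     integrable (lebesgue_on S) (\<lambda>x. \<bar>u x\<bar> powr r)"

definition Lpv_on :: "real \<Rightarrow> 'a::euclidean_space set \<Rightarrow> ('a \<Rightarrow> 'a) \<Rightarrow> bool" where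
  "Lpv_on r S G \<longleftrightarrow> G \<in> borel_measurable (lebesgue_on S) \<and>
     integrable (lebesgue_on S) (\<lambda>x. norm (G x) powr r)"

definition Lloc_on :: "real \<Rightarrow> 'a::euclidean_space set \<Rightarrow> ('a \<Rightarrow> real) \<Rightarrow> bool" where
  "Lloc_on r S u \<longleftrightarrow> (\<forall>K. compact K \<and> K \<subseteq> S \<longrightarrow> Lp_on r K u)"

definition C1c_test :: "'a::euclidean_space set \<Rightarrow> ('a \<Rightarrow> real) \<Rightarrow> ('a \<Rightarrow> 'a) \<Rightarrow> bool" where
  "C1c_test S phi Dphi \<longleftrightarrow>
     (\<exists>K. compact K \<and> K \<subseteq> S \<and> (\<forall>x. x \<notin> K \<longrightarrow> phi x = 0)) \<and>
     continuous_on UNIV Dphi \<and>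
     (\<forall>x. (phi has_derivative (\<lambda>h. Dphi x \<bullet> h)) (at x))"

definition weak_gradient :: "'a::euclidean_space set \<Rightarrow> ('a \<Rightarrow> real) \<Rightarrow> ('a \<Rightarrow> 'a) \<Rightarrow> bool" where
  "weak_gradient S u G \<longleftrightarrow>
     (\<forall>K. compact K \<and> K \<subseteq> S \<longrightarrow> set_integrable lebesgue K u \<and> set_integrable lebesgue K G) \<and>
     (\<forall>phi Dphi. C1c_test S phi Dphi \<longrightarrow>
        (\<integral>x. u x *\<^sub>R Dphi x \<partial>lebesgue_on S) = - (\<integral>x. phi x *\<^sub>R G x \<partial>lebesgue_on S))"

definition sobolev_W0 :: "real \<Rightarrow> 'a::euclidean_space set \<Rightarrow> ('a \<Rightarrow> real) \<Rightarrow> ('a \<Rightarrow> 'a) \<Rightarrow> bool" where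
  "sobolev_W0 r S u G \<longleftrightarrow> Lp_on r S u \<and> Lpv_on r S G \<and> weak_gradient S u G \<and>
     (\<exists>phi Dphi. (\<forall>n. C1c_test S (phi n) (Dphi n)) \<and>
        (\<lambda>n. \<integral>x. \<bar>phi n x - u x\<bar> powr r \<partial>lebesgue_on S) \<longlonglongrightarrow> 0 \<and>
        (\<lambda>n. \<integral>x. norm (Dphi n x - G x) powr r \<partial>lebesgue_on S) \<longlonglongrightarrow> 0)"

text \<open>Integrand of the (p,q)-Laplacian weak form:
  (|G|^{p-2} + |G|^{q-2}) G . H  (with the convention 0^s = 0 of powr).\<close>
definition pq_flux :: "real \<Rightarrow> real \<Rightarrow> 'a::euclidean_space \<Rightarrow> 'a \<Rightarrow> real" where
  "pq_flux p q G H = (norm G powr (p - 2) + norm G powr (q - 2)) * (G \<bullet> H)"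

definition admissible_test :: "real \<Rightarrow> 'a::euclidean_space set \<Rightarrow> ('a \<Rightarrow> real) \<Rightarrow> ('a \<Rightarrow> 'a) \<Rightarrow> bool" where
  "admissible_test q \<Omega> xi H \<longleftrightarrow>
     (\<exists>\<Omega>'. open \<Omega>' \<and> compact (closure \<Omega>') \<and> closure \<Omega>' \<subseteq> \<Omega> \<and> sobolev_W0 q \<Omega>' xi H \<and>
        (\<forall>x. x \<notin> \<Omega>' \<longrightarrow> xi x = 0 \<and> H x = 0)) \<and> (\<forall>x. 0 \<le> xi x)"

definition sol_class :: "real \<Rightarrow> 'a::euclidean_space set \<Rightarrow> (real \<Rightarrow> real) \<Rightarrow> ('a \<Rightarrow> real) \<Rightarrow> ('a \<Rightarrow> 'a) \<Rightarrow> bool" where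
  "sol_class q \<Omega> f u G \<longleftrightarrow> sobolev_W0 q \<Omega> u G \<and>
     (\<forall>K. compact K \<and> K \<subseteq> \<Omega> \<longrightarrow> (\<exists>c>0. AE x in lebesgue_on K. c \<le> u x)) \<and>
     Lloc_on (q / (q - 1)) \<Omega> (\<lambda>x. f (u x))"

definition weak_subsol :: "'a::euclidean_space set \<Rightarrow> real \<Rightarrow> real \<Rightarrow> real \<Rightarrow> (real \<Rightarrow> real) \<Rightarrow> real \<Rightarrow> real \<Rightarrow> ('a \<Rightarrow> real) \<Rightarrow> bool" where
  "weak_subsol \<Omega> p q \<gamma> f lam chi u \<longleftrightarrow> (\<exists>G. sol_class q \<Omega> f u G \<and>
     (\<forall>xi H. admissible_test q \<Omega> xi H \<longrightarrow>
        (\<integral>x. pq_flux p q (G x) (H x) \<partial>lebesgue_on \<Omega>)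
          \<le> lam * (\<integral>x. f (u x) * u x powr (-\<gamma>) * xi x \<partial>lebesgue_on \<Omega>) - chi * (\<integral>x. xi x \<partial>lebesgue_on \<Omega>)))"

definition weak_supersol :: "'a::euclidean_space set \<Rightarrow> real \<Rightarrow> real \<Rightarrow> real \<Rightarrow> (real \<Rightarrow> real) \<Rightarrow> real \<Rightarrow> real \<Rightarrow> ('a \<Rightarrow> real) \<Rightarrow> bool" where
  "weak_supersol \<Omega> p q \<gamma> f lam chi u \<longleftrightarrow> (\<exists>G. sol_class q \<Omega> f u G \<and>
     (\<forall>xi H. admissible_test q \<Omega> xi H \<longrightarrow>
        (\<integral>x. pq_flux p q (G x) (H x) \<partial>lebesgue_on \<Omega>)
          \<ge> lam * (\<integral>x. f (u x) * u x powr (-\<gamma>) * xi x \<partial>lebesgue_on \<Omega>) + chi * (\<integral>x. xi x \<partial>lebesgue_on \<Omega>)))"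

definition C1_fun :: "'a::euclidean_space set \<Rightarrow> ('a \<Rightarrow> real) \<Rightarrow> ('a \<Rightarrow> 'a) \<Rightarrow> bool" where
  "C1_fun U g Dg \<longleftrightarrow> continuous_on U Dg \<and> (\<forall>x\<in>U. (g has_derivative (\<lambda>h. Dg x \<bullet> h)) (at x))"

definition C2_boundary :: "'a::euclidean_space set \<Rightarrow> bool" where
  "C2_boundary \<Omega> \<longleftrightarrow> (\<forall>x0\<in>frontier \<Omega>. \<exists>r>0. \<exists>\<psi> D\<psi>.
     C1_fun (ball x0 r) \<psi> D\<psi> \<and> (\<forall>i\<in>Basis. \<exists>Hi. C1_fun (ball x0 r) (\<lambda>x. D\<psi> x \<bullet> i) Hi) \<and>
     (\<forall>x\<in>ball x0 r. D\<psi> x \<noteq> 0) \<and>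
     \<Omega> \<inter> ball x0 r = {x \<in> ball x0 r. \<psi> x < 0})"

definition C1l_closure :: "'a::euclidean_space set \<Rightarrow> real \<Rightarrow> ('a \<Rightarrow> real) \<Rightarrow> bool" where
  "C1l_closure \<Omega> l u \<longleftrightarrow> continuous_on (closure \<Omega>) u \<and>
     (\<exists>Du. (\<forall>x\<in>\<Omega>. (u has_derivative (\<lambda>h. Du x \<bullet> h)) (at x)) \<and>
        (\<exists>C. \<forall>x\<in>closure \<Omega>. \<forall>y\<in>closure \<Omega>. norm (Du x - Du y) \<le> C * dist x y powr l))"

definition C_delta_plus :: "'a::euclidean_space set \<Rightarrow> ('a \<Rightarrow> real) \<Rightarrow> bool" where
  "C_delta_plus \<Omega> u \<longleftrightarrow> continuous_on (closure \<Omega>) u \<and> (\<forall>x\<in>frontier \<Omega>. u x = 0) \<and>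
     (\<exists>c1 c2. 0 < c1 \<and> c1 \<le> c2 \<and>
        (\<forall>x\<in>closure \<Omega>. c1 * infdist x (frontier \<Omega>) \<le> u x \<and> u x \<le> c2 * infdist x (frontier \<Omega>)))"

end

theory Submission
  imports Defs
begin

text \<open>Both functions are explicit; no existence or regularity theory for the operator is needed.
  Let \<open>d\<close> be the distance to the boundary, which is \<open>C\<^sup>2\<close> in a collar of \<open>\<partial>\<Omega>\<close>.

  The subsolution is \<open>\<epsilon> G(d)\<close> with \<open>G' = ((3a - d)\<^sub>+)\<^sup>J\<close>: for large \<open>J\<close> its fluxes are \<open>C\<^sup>1\<close>, hence
  \<open>-L\<close> of it is bounded, while the singular reaction term blows up as \<open>\<epsilon> \<longrightarrow> 0\<close>.

  The supersolution is \<open>T w\<close> with \<open>w = 1 - exp(-v)\<close> and \<open>v = K(d) + y \<chi>(d)\<close>, where \<open>y\<close> is an affine function with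
  unit gradient \<open>e\<close>, \<open>\<chi> = 1\<close> away from the boundary, and \<open>k = K'\<close> decreases so fast that it absorbs the curvature of the
  level sets of \<open>d\<close>. Since \<open>|\<nabla>d| = 1\<close>, the gradient \<open>k(d) \<nabla>d + e\<close> of \<open>v\<close> can vanish only where \<open>k(d) = 1\<close>, that is on
  the single level set \<open>d = 2a\<close>; there \<open>k\<close> has a root-type singularity, which makes the \<open>q\<close>-Laplacian strictly negative
  in spite of the degeneracy. Where \<open>v\<close> is affine, the concave function \<open>1 - exp(-v)\<close> yields strictness, and a term
  \<open>- d\<close> to the power \<open>1 - \<gamma>\<close> in \<open>log k\<close> yields the rate \<open>d\<close> to the power \<open>-\<gamma>\<close> at the boundary. So \<open>-\<Delta>\<^sub>q w \<ge> c d powr (-\<gamma>)\<close> and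
  \<open>-\<Delta>\<^sub>p w \<ge> 0\<close>, and by subcritical growth of \<open>f\<close> a large multiple of \<open>w\<close> is a strict supersolution. Test functions in
  \<open>W\<^sub>0\<close> are approximated by sign-changing smooth ones, so the inequalities are first proved as identities for
  regularised \<open>C\<^sup>1\<close> fluxes and then passed to the limit.\<close>

section \<open>Integration by parts\<close>

text \<open>The exponent \<alpha> of the root in \<open>k\<close> comes from a balance. Put z = d -
  2a. Near z = 0 the gradient of \<open>v\<close> may be as small as |z|^\<alpha>, while k' behaves
  like -|z|^(\<alpha>-1); then -\<Delta>_q v is of order |z|^(\<alpha>(q-1)-1), which stays away
  from 0 if \<alpha>(q-1) \<le> 1. The choice \<alpha> = 1/q meets this for every q > 1. Only the
  q-part has to be strictly positive. For u = T w the reaction is at most a small multiple of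
  T^(q-1) d^(-\<gamma>), whereas the p-part carries the weaker factor T^(p-1) and merely needs the
  right sign. As w is comparable to d, the reaction really can be of size d^(-\<gamma>) at the
  boundary, so the lower bound for the q-part must have this rate. The affine function replaces d in
  the interior, where d may fail to be differentiable. Two roots limit the smoothness of the
  gradient, |d - 2a|^\<alpha> and d^(1-\<gamma>); the Hoelder exponent is therefore the minimum of
  \<alpha> and 1 - \<gamma>.\<close>

definition C1_on :: "'a::euclidean_space set \<Rightarrow> ('a \<Rightarrow> 'b::real_normed_vector) \<Rightarrow> ('a \<Rightarrow> 'a \<Rightarrow> 'b) \<Rightarrow> bool" where
  "C1_on S f f' \<longleftrightarrow> (\<forall>x\<in>S. (f has_derivative f' x) (at x)) \<and> (\<forall>h. continuous_on S (\<lambda>x. f' x h))"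

lemma C1_on_derivative: "C1_on S f f' \<Longrightarrow> x \<in> S \<Longrightarrow> (f has_derivative f' x) (at x)"
  by (simp add: C1_on_def)

lemma C1_on_continuous_derivative: "C1_on S f f' \<Longrightarrow> continuous_on S (\<lambda>x. f' x h)"
  by (simp add: C1_on_def)

lemma C1_on_continuous: "C1_on S f f' \<Longrightarrow> continuous_on S f"
  by (meson C1_on_derivative continuous_at_imp_continuous_on has_derivative_continuous)

text \<open>Applied to the derivative of a field at one point, so this is the trace of a linear
  map.\<close>

definition divergence :: "('a::euclidean_space \<Rightarrow> 'a) \<Rightarrow> real" where
  "divergence L = (\<Sum>b\<in>Basis. L b \<bullet> b)"

lemma C1_on_continuous_divergence: "C1_on S V V' \<Longrightarrow> continuous_on S (\<lambda>x. divergence (V' x))"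
  unfolding divergence_def C1_on_def by (intro continuous_intros) auto

lemma continuous_on_zero_extension:
  fixes f :: "'a::metric_space \<Rightarrow> 'b::real_normed_vector"
  assumes "open S" "closed K" "K \<subseteq> S" "continuous_on S f" "\<And>x. x \<in> S - K \<Longrightarrow> f x = 0"
  shows "continuous_on UNIV (\<lambda>x. if x \<in> S then f x else 0)"
proof -
  let ?F = "\<lambda>x. if x \<in> S then f x else 0"
  have "continuous_on S ?F"
    using assms(4) by (rule continuous_on_eq) simp
  moreover have "continuous_on (-K) ?F"
    by (rule continuous_on_eq[of _ "\<lambda>x. 0"]) (use assms in auto)
  ultimately have "continuous_on (S \<union> -K) ?F"
    by (intro continuous_on_open_Un) (use assms in auto)
  moreover have "S \<union> -K = UNIV" using assms by auto
  ultimately show ?thesis by simp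
qed

lemma has_derivative_zero_extension:
  fixes f :: "'a::real_normed_vector \<Rightarrow> 'b::real_normed_vector"
  assumes "open S" "closed K" "K \<subseteq> S" "\<And>x. x \<in> S \<Longrightarrow> (f has_derivative f' x) (at x)"
    "\<And>x. x \<in> S - K \<Longrightarrow> f x = 0"
  shows "((\<lambda>x. if x \<in> S then f x else 0) has_derivative (if x \<in> S then f' x else (\<lambda>h. 0))) (at x)"
proof (cases "x \<in> S")
  case True
  then show ?thesis
    using has_derivative_transform_within_open[OF assms(4)[OF True] assms(1) True, of "\<lambda>x. if x \<in> S then f x else 0"]
    by auto
next
  case False
  have "((\<lambda>x. if x \<in> S then f x else 0) has_derivative (\<lambda>h. 0)) (at x)"
    by (rule has_derivative_transform_within_open[of "\<lambda>x. 0" _ _ _ "-K"]) (use assms False in auto)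
  with False show ?thesis by simp
qed

lemma derivative_zero_off_support:
  fixes f :: "'a::real_normed_vector \<Rightarrow> 'b::real_normed_vector"
  assumes "closed K" "\<And>x. x \<notin> K \<Longrightarrow> f x = 0" "(f has_derivative D) (at x)" "x \<notin> K"
  shows "D = (\<lambda>h. 0)"
proof -
  have "(f has_derivative (\<lambda>h. 0)) (at x)"
    by (rule has_derivative_transform_within_open[of "\<lambda>x. 0" _ _ _ "-K"]) (use assms in auto)
  then show ?thesis using assms(3) has_derivative_unique by blast
qed

text \<open>Translation invariance makes the integral of every difference quotient in direction
  \<open>e\<close> zero; dominated convergence carries this over to the derivative, without iterated
  integrals.\<close>

lemma integral_directional_derivative_eq_0:
  fixes g :: "'a::euclidean_space \<Rightarrow> real"
  assumes der: "\<And>x. (g has_derivative g' x) (at x)" and cont: "continuous_on UNIV (\<lambda>x. g' x e)"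
    and K: "compact K" "\<And>x. x \<notin> K \<Longrightarrow> g x = 0"
  shows "integrable lborel (\<lambda>x. g' x e)" "(\<integral>x. g' x e \<partial>lborel) = 0"
proof -
  have g'0: "g' x e = 0" if "x \<notin> K" for x
    using derivative_zero_off_support[OF compact_imp_closed[OF K(1)] K(2) der that] by simp
  have gcont: "continuous_on UNIV g"
    by (meson der continuous_at_imp_continuous_on has_derivative_continuous)
  have cs: "integrable lborel h" if "continuous_on UNIV h" "\<And>x. x \<notin> K \<Longrightarrow> h x = 0" for h :: "'a \<Rightarrow> real"
  proof -
    have "integrable lborel (\<lambda>x. indicator K x *\<^sub>R h x)"
      by (rule borel_integrable_compact[OF K(1)]) (use that continuous_on_subset in blast)
    moreover have "(\<lambda>x. indicator K x *\<^sub>R h x) = h"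
      using that(2) by (auto simp: indicator_def fun_eq_iff)
    ultimately show ?thesis by simp
  qed
  show int: "integrable lborel (\<lambda>x. g' x e)" using cs[OF cont g'0] .
  have "bounded ((\<lambda>x. g' x e) ` K)"
    by (intro compact_imp_bounded compact_continuous_image continuous_on_subset[OF cont] K) auto
  then obtain B where B: "B > 0" "\<And>x. x \<in> K \<Longrightarrow> \<bar>g' x e\<bar> \<le> B"
    by (auto simp: bounded_pos)
  then have B': "\<bar>g' x e\<bar> \<le> B" for x using g'0[of x] by (cases "x \<in> K") auto
  obtain R where R: "R > 0" "\<And>x. x \<in> K \<Longrightarrow> norm x \<le> R"
    using compact_imp_bounded[OF K(1)] by (auto simp: bounded_pos)
  define s where "s n = inverse (real (Suc n))" for n
  have s: "0 < s n" "s n \<le> 1" for n by (auto simp: s_def divide_simps)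
  define Q where "Q n x = (g (x + s n *\<^sub>R e) - g x) / s n" for n x
  have gint: "integrable lborel g" using cs[OF gcont K(2)] .
  have shift: "integrable lborel (\<lambda>x. g (x + c))" "(\<integral>x. g (x + c) \<partial>lborel) = (\<integral>x. g x \<partial>lborel)" for c
  proof -
    have m: "g \<in> borel_measurable borel" using gint by (auto dest: borel_measurable_integrable)
    have *: "distr lborel borel ((+) c) = lborel" by (rule lborel_distr_plus)
    show "integrable lborel (\<lambda>x. g (x + c))"
      using gint * integrable_distr_eq[of "(+) c" lborel borel g] m by (simp add: add.commute)
    show "(\<integral>x. g (x + c) \<partial>lborel) = (\<integral>x. g x \<partial>lborel)"
      using * integral_distr[of "(+) c" lborel borel g] m by (simp add: add.commute)
  qed
  have Q0: "(\<integral>x. Q n x \<partial>lborel) = 0" for n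
    unfolding Q_def using shift[of "s n *\<^sub>R e"] gint by simp
  have lim: "(\<lambda>n. Q n x) \<longlonglongrightarrow> g' x e" for x
  proof -
    have "((\<lambda>t. g (x + t *\<^sub>R e)) has_derivative (\<lambda>t. g' x (t *\<^sub>R e))) (at 0)"
      by (rule has_derivative_compose[of "\<lambda>t. x + t *\<^sub>R e" "\<lambda>t. t *\<^sub>R e" 0 UNIV g "g' x", simplified])
        (auto intro!: derivative_eq_intros der)
    moreover have "g' x (t *\<^sub>R e) = g' x e * t" for t
      using linear_cmul[OF has_derivative_linear[OF der[of x]], of t e] by simp
    ultimately have "((\<lambda>t. g (x + t *\<^sub>R e)) has_real_derivative g' x e) (at 0)"
      by (simp add: has_field_derivative_def)
    then have l: "((\<lambda>t. (g (x + t *\<^sub>R e) - g x) / t) \<longlongrightarrow> g' x e) (at 0)"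
      by (simp add: DERIV_def)
    have "filterlim s (at 0) sequentially"
      unfolding s_def using LIMSEQ_inverse_real_of_nat
      by (intro filterlim_atI) auto
    from filterlim_compose[OF l this] show ?thesis by (simp add: Q_def)
  qed
  \<comment> \<open>The mean value theorem bounds the quotients by \<open>B\<close>. As the step
    lengths are at most 1, all supports stay in one ball of radius
    \<open>R + norm e\<close>.\<close>
  have bnd: "\<bar>Q n x\<bar> \<le> B * indicator (cball 0 (R + norm e)) x" for n x
  proof (cases "x \<in> cball 0 (R + norm e)")
    case True
    have "\<exists>t. t > 0 \<and> t < s n \<and> g (x + s n *\<^sub>R e) - g (x + 0 *\<^sub>R e) = (s n - 0) * g' (x + t *\<^sub>R e) e"
    proof (rule MVT2)
      show "0 < s n" by (rule s)
      fix t :: real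
      have "((\<lambda>t. g (x + t *\<^sub>R e)) has_derivative (\<lambda>u. g' (x + t *\<^sub>R e) (u *\<^sub>R e))) (at t)"
        by (rule has_derivative_compose[of "\<lambda>t. x + t *\<^sub>R e" "\<lambda>t. t *\<^sub>R e" t UNIV g "g' (x + t *\<^sub>R e)", simplified])
          (auto intro!: derivative_eq_intros der)
      moreover have "g' (x + t *\<^sub>R e) (u *\<^sub>R e) = g' (x + t *\<^sub>R e) e * u" for u
        using linear_cmul[OF has_derivative_linear[OF der[of "x + t *\<^sub>R e"]], of u e] by simp
      ultimately show "((\<lambda>t. g (x + t *\<^sub>R e)) has_real_derivative g' (x + t *\<^sub>R e) e) (at t)"
        by (simp add: has_field_derivative_def)
    qed
    then obtain t where "Q n x = g' (x + t *\<^sub>R e) e" unfolding Q_def using s[of n] by auto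
    with True B' show ?thesis by simp
  next
    case False
    then have n: "norm x > R + norm e" by simp
    have "norm (s n *\<^sub>R e) \<le> norm e" using s[of n] mult_left_le_one_le[of "norm e" "s n"] by simp
    then have "norm (x + s n *\<^sub>R e) > R"
      using n norm_diff_ineq[of x "s n *\<^sub>R e"] by linarith
    moreover have "norm x > R" using n norm_ge_zero[of e] by linarith
    ultimately have "x \<notin> K" "x + s n *\<^sub>R e \<notin> K" using R(2) by (meson not_le)+
    then show ?thesis using K(2) B(1) by (simp add: Q_def)
  qed
  have "(\<lambda>n. \<integral>x. Q n x \<partial>lborel) \<longlonglongrightarrow> (\<integral>x. g' x e \<partial>lborel)"
  proof (rule integral_dominated_convergence[where w="\<lambda>x. B * indicator (cball 0 (R + norm e)) x"])
    show "integrable lborel (\<lambda>x. B * indicator (cball 0 (R + norm e)) x :: real)"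
      by (intro integrable_mult_right integrable_real_indicator) (auto simp: emeasure_bounded_finite less_top[symmetric] simp flip: infinity_ennreal_def)
    show "(\<lambda>x. g' x e) \<in> borel_measurable lborel" using int by auto
    show "Q n \<in> borel_measurable lborel" for n
      unfolding Q_def using shift(1)[of "s n *\<^sub>R e"] gint by (intro borel_measurable_divide borel_measurable_diff borel_measurable_const) (auto dest: borel_measurable_integrable)
    show "AE x in lborel. (\<lambda>n. Q n x) \<longlonglongrightarrow> g' x e" using lim by (rule AE_I2)
    show "AE x in lborel. norm (Q n x) \<le> B * indicator (cball 0 (R + norm e)) x" for n
      unfolding real_norm_def by (rule AE_I2) (rule bnd)
  qed
  then show "(\<integral>x. g' x e \<partial>lborel) = 0"
    unfolding Q0 by (simp add: LIMSEQ_const_iff)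
qed

lemma C1c_testD:
  assumes "C1c_test S phi Dphi"
  obtains K where "compact K" "K \<subseteq> S" "\<And>x. x \<notin> K \<Longrightarrow> phi x = 0" "\<And>x. x \<notin> K \<Longrightarrow> Dphi x = 0"
proof -
  obtain K where K: "compact K" "K \<subseteq> S" "\<And>x. x \<notin> K \<Longrightarrow> phi x = 0"
    using assms unfolding C1c_test_def by metis
  have "Dphi x = 0" if "x \<notin> K" for x
  proof -
    have "(phi has_derivative (\<lambda>h. Dphi x \<bullet> h)) (at x)" using assms by (simp add: C1c_test_def)
    from fun_cong[OF derivative_zero_off_support[OF compact_imp_closed[OF K(1)] K(3) this that], of "Dphi x"]
    show ?thesis by simp
  qed
  with K that show ?thesis by blast
qed

lemma C1c_test_continuous: "C1c_test S phi Dphi \<Longrightarrow> continuous_on UNIV phi"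
  unfolding C1c_test_def by (meson continuous_at_imp_continuous_on has_derivative_continuous)

lemma integral_lebesgue_on_zero_extension:
  fixes f :: "'a::euclidean_space \<Rightarrow> 'b::euclidean_space"
  assumes "open S" "integrable lborel (\<lambda>x. if x \<in> S then f x else 0)"
  shows "integrable (lebesgue_on S) f" "(\<integral>x. f x \<partial>lebesgue_on S) = (\<integral>x. (if x \<in> S then f x else 0) \<partial>lborel)"
proof -
  have S: "S \<inter> space lebesgue \<in> sets lebesgue" using assms(1) by auto
  have eq: "(\<lambda>x. indicator S x *\<^sub>R f x) = (\<lambda>x. if x \<in> S then f x else 0)" by (auto simp: indicator_def)
  have m: "(\<lambda>x. if x \<in> S then f x else 0) \<in> borel_measurable lborel" using assms(2) by auto
  show "integrable (lebesgue_on S) f"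
    using assms(2) integrable_completion[OF m] by (simp add: integrable_restrict_space[OF S] eq)
  show "(\<integral>x. f x \<partial>lebesgue_on S) = (\<integral>x. (if x \<in> S then f x else 0) \<partial>lborel)"
    using integral_completion[OF m] by (simp add: integral_restrict_space[OF S] eq)
qed

lemma integrable_continuous_compact_support:
  fixes f :: "'a::euclidean_space \<Rightarrow> 'b::euclidean_space"
  assumes "open S" "continuous_on S f" "compact K" "K \<subseteq> S" "\<And>x. x \<in> S - K \<Longrightarrow> f x = 0"
  shows "integrable lborel (\<lambda>x. if x \<in> S then f x else 0)" "integrable (lebesgue_on S) f"
proof -
  have c: "continuous_on UNIV (\<lambda>x. if x \<in> S then f x else 0)"
    by (rule continuous_on_zero_extension[OF assms(1) compact_imp_closed[OF assms(3)] assms(4,2,5)])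
  have "integrable lborel (\<lambda>x. indicator K x *\<^sub>R (if x \<in> S then f x else 0))"
    by (rule borel_integrable_compact[OF assms(3)]) (use c continuous_on_subset in blast)
  moreover have "(\<lambda>x. indicator K x *\<^sub>R (if x \<in> S then f x else 0)) = (\<lambda>x. if x \<in> S then f x else 0)"
    using assms by (auto simp: indicator_def fun_eq_iff)
  ultimately show "integrable lborel (\<lambda>x. if x \<in> S then f x else 0)" by simp
  from integral_lebesgue_on_zero_extension(1)[OF assms(1) this] show "integrable (lebesgue_on S) f" .
qed

text \<open>The scalar functions \<open>phi x * (V x \<bullet> b)\<close>, extended by 0, are C1 on
  the whole space although \<open>V\<close> is controlled only on \<open>S\<close>. Their
  b-derivatives integrate to 0, and the sum over the basis is phi div V + V . Dphi.\<close>

lemma integration_by_parts_C1: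
  fixes V :: "'a::euclidean_space \<Rightarrow> 'a"
  assumes S: "open S" and V: "C1_on S V V'" and phi: "C1c_test S phi Dphi"
  shows "(\<integral>x. V x \<bullet> Dphi x \<partial>lebesgue_on S) = - (\<integral>x. phi x * divergence (V' x) \<partial>lebesgue_on S)"
proof -
  obtain K where K: "compact K" "K \<subseteq> S" "\<And>x. x \<notin> K \<Longrightarrow> phi x = 0" "\<And>x. x \<notin> K \<Longrightarrow> Dphi x = 0"
    using C1c_testD[OF phi] by metis
  have dphi: "(phi has_derivative (\<lambda>h. Dphi x \<bullet> h)) (at x)" for x
    using phi by (simp add: C1c_test_def)
  have cphi [continuous_intros]: "continuous_on S phi" "continuous_on S Dphi"
    using phi C1c_test_continuous[OF phi] continuous_on_subset unfolding C1c_test_def by blast+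
  have cV [continuous_intros]: "continuous_on S V" "\<And>h. continuous_on S (\<lambda>x. V' x h)"
    "continuous_on S (\<lambda>x. divergence (V' x))"
    using V C1_on_continuous C1_on_continuous_derivative C1_on_continuous_divergence by blast+
  define g where "g b x = (if x \<in> S then phi x * (V x \<bullet> b) else 0)" for b x
  define g' where "g' b x = (if x \<in> S then (\<lambda>h. phi x * (V' x h \<bullet> b) + (Dphi x \<bullet> h) * (V x \<bullet> b)) else (\<lambda>h. 0))" for b x
  have der: "(g b has_derivative g' b x) (at x)" for b x
    unfolding g_def g'_def
  proof (rule has_derivative_zero_extension[OF S compact_imp_closed[OF K(1)] K(2)])
    fix x assume "x \<in> S"
    note [derivative_intros] = dphi C1_on_derivative[OF V this]
    show "((\<lambda>x. phi x * (V x \<bullet> b)) has_derivative (\<lambda>h. phi x * (V' x h \<bullet> b) + Dphi x \<bullet> h * (V x \<bullet> b))) (at x)"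
      by (auto intro!: derivative_eq_intros)
  qed (use K in auto)
  have cont: "continuous_on UNIV (\<lambda>x. g' b x b)" for b
  proof -
    have "continuous_on UNIV (\<lambda>x. if x \<in> S then phi x * (V' x b \<bullet> b) + (Dphi x \<bullet> b) * (V x \<bullet> b) else 0)"
      by (rule continuous_on_zero_extension[OF S compact_imp_closed[OF K(1)] K(2)])
        (use K in \<open>auto intro!: continuous_intros\<close>)
    then show ?thesis by (rule continuous_on_eq) (simp add: g'_def)
  qed
  have g0: "g b x = 0" if "x \<notin> K" for b x using K that by (simp add: g_def)
  note z = integral_directional_derivative_eq_0[OF der cont K(1) g0]
  have sum: "(\<Sum>b\<in>Basis. g' b x b) = (if x \<in> S then phi x * divergence (V' x) else 0) + (if x \<in> S then V x \<bullet> Dphi x else 0)" for x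
  proof -
    have "V x \<bullet> Dphi x = (\<Sum>b\<in>Basis. (Dphi x \<bullet> b) * (V x \<bullet> b))"
      by (subst euclidean_inner) (simp add: mult.commute)
    then show ?thesis
      by (simp add: g'_def divergence_def sum.distrib sum_distrib_left)
  qed
  note i1 = integrable_continuous_compact_support[OF S _ K(1,2), of "\<lambda>x. phi x * divergence (V' x)"]
  note i2 = integrable_continuous_compact_support[OF S _ K(1,2), of "\<lambda>x. V x \<bullet> Dphi x"]
  have I1: "integrable lborel (\<lambda>x. if x \<in> S then phi x * divergence (V' x) else 0)"
    by (rule i1) (use K in \<open>auto intro!: continuous_intros\<close>)
  have I2: "integrable lborel (\<lambda>x. if x \<in> S then V x \<bullet> Dphi x else 0)"
    by (rule i2) (use K in \<open>auto intro!: continuous_intros\<close>)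
  have "0 = (\<Sum>b\<in>Basis. \<integral>x. g' b x b \<partial>lborel)" using z(2) by simp
  also have "\<dots> = (\<integral>x. (\<Sum>b\<in>Basis. g' b x b) \<partial>lborel)"
    by (rule Bochner_Integration.integral_sum[symmetric]) (rule z(1))
  also have "\<dots> = (\<integral>x. phi x * divergence (V' x) \<partial>lebesgue_on S) + (\<integral>x. V x \<bullet> Dphi x \<partial>lebesgue_on S)"
    unfolding sum using I1 I2
    by (simp add: integral_lebesgue_on_zero_extension[OF S I1] integral_lebesgue_on_zero_extension[OF S I2])
  finally show ?thesis by simp
qed

section \<open>Approximation of admissible test functions\<close>

lemma finite_measure_lebesgue_on_bounded: "bounded S \<Longrightarrow> open S \<Longrightarrow> finite_measure (lebesgue_on S)"
  for S :: "'a::euclidean_space set"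
  by (rule finite_measureI) (use lmeasurable_open[of S] in \<open>auto simp: emeasure_restrict_space fmeasurable_def\<close>)

text \<open>An elementary form of Young's inequality. On a finite measure space it yields L^1 bounds
  from L^q bounds, up to an additive error as small as desired.\<close>

lemma le_small_plus_powr:
  fixes a q \<eta> :: real
  assumes "0 \<le> a" "1 \<le> q" "0 < \<eta>"
  shows "a \<le> \<eta> + \<eta> powr (1 - q) * a powr q"
proof (cases "a \<le> \<eta>")
  case False
  then have "\<eta> powr (1 - q) * a powr q \<ge> a powr (1 - q) * a powr q"
    using assms by (intro mult_right_mono powr_mono2') auto
  moreover have "a powr (1 - q) * a powr q = a"
    using False assms by (simp add: powr_add[symmetric])
  ultimately show ?thesis using assms by linarith
qed (use assms in \<open>simp add: add_increasing2\<close>)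

lemma powr_add_le_scaled:
  fixes a b q :: real
  assumes "0 \<le> a" "0 \<le> b" "0 \<le> q"
  shows "(a + b) powr q \<le> 2 powr q * (a powr q + b powr q)"
proof -
  have "(a + b) powr q \<le> (2 * max a b) powr q"
    using assms by (intro powr_mono2) auto
  also have "\<dots> = 2 powr q * max a b powr q" using assms by (simp add: powr_mult)
  also have "max a b powr q \<le> a powr q + b powr q" by (auto simp: max_def)
  finally show ?thesis by simp
qed

lemma (in finite_measure) integrable_if_powr_integrable:
  fixes f :: "'a \<Rightarrow> 'b::{banach, second_countable_topology}"
  assumes "f \<in> borel_measurable M" "integrable M (\<lambda>x. norm (f x) powr q)" "1 \<le> q"
  shows "integrable M f"
proof (rule Bochner_Integration.integrable_bound[where f="\<lambda>x. 1 + norm (f x) powr q"])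
  show "AE x in M. norm (f x) \<le> norm (1 + norm (f x) powr q)"
    using le_small_plus_powr[of "norm (f _)" q 1] assms(3) by auto
qed (use assms in auto)

lemma (in finite_measure) integral_norm_tendsto_0_if_powr:
  fixes f :: "nat \<Rightarrow> 'a \<Rightarrow> 'b::{banach, second_countable_topology}"
  assumes m: "\<And>n. f n \<in> borel_measurable M" and i: "\<And>n. integrable M (\<lambda>x. norm (f n x) powr q)"
    and q: "1 \<le> q" and lim: "(\<lambda>n. \<integral>x. norm (f n x) powr q \<partial>M) \<longlonglongrightarrow> 0"
  shows "(\<lambda>n. \<integral>x. norm (f n x) \<partial>M) \<longlonglongrightarrow> 0"
proof (rule LIMSEQ_I)
  fix e :: real assume e: "0 < e"
  define mu where "mu = measure M (space M)"
  have mu: "mu \<ge> 0" by (simp add: mu_def)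
  \<comment> \<open>The constant part \<open>\<eta> * mu\<close> takes at most e/2; the summand 1
    keeps the quotient meaningful when the space has measure 0.\<close>
  define \<eta> where "\<eta> = e / (2 * (mu + 1))"
  have \<eta>: "0 < \<eta>" "\<eta> * mu \<le> e / 2" using e mu by (auto simp: \<eta>_def field_simps)
  have "0 < e / (2 * \<eta> powr (1 - q))" using e \<eta> by simp
  from LIMSEQ_D[OF lim this] obtain N where
    N: "\<And>n. n \<ge> N \<Longrightarrow> \<bar>\<integral>x. norm (f n x) powr q \<partial>M\<bar> < e / (2 * \<eta> powr (1 - q))" by auto
  have "norm ((\<integral>x. norm (f n x) \<partial>M) - 0) < e" if "n \<ge> N" for n
  proof -
    have "(\<integral>x. norm (f n x) \<partial>M) \<le> (\<integral>x. \<eta> + \<eta> powr (1 - q) * norm (f n x) powr q \<partial>M)"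
      using integrable_if_powr_integrable[OF m i q] i q \<eta>
      by (intro integral_mono) (auto intro!: le_small_plus_powr)
    also have "\<dots> = \<eta> * mu + \<eta> powr (1 - q) * (\<integral>x. norm (f n x) powr q \<partial>M)"
      using i by (simp add: mu_def)
    also have "\<dots> < e / 2 + \<eta> powr (1 - q) * (e / (2 * \<eta> powr (1 - q)))"
      using \<eta> N[OF that] by (intro add_le_less_mono mult_strict_left_mono) auto
    also have "\<dots> = e" using \<eta> by simp
    finally show ?thesis by simp
  qed
  then show "\<exists>N. \<forall>n\<ge>N. norm ((\<integral>x. norm (f n x) \<partial>M) - 0) < e" by blast
qed

lemma integrable_lebesgue_on_zero_outside:
  fixes f :: "'a::euclidean_space \<Rightarrow> 'b::euclidean_space"
  assumes "open S" "open T" "S \<subseteq> T" "\<And>x. x \<notin> S \<Longrightarrow> f x = 0"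
  shows "integrable (lebesgue_on S) f \<longleftrightarrow> integrable (lebesgue_on T) f"
    "(\<integral>x. f x \<partial>lebesgue_on S) = (\<integral>x. f x \<partial>lebesgue_on T)"
proof -
  have "S \<inter> space lebesgue \<in> sets lebesgue" "T \<inter> space lebesgue \<in> sets lebesgue"
    using assms by auto
  note r = integrable_restrict_space[OF this(1), of f] integrable_restrict_space[OF this(2), of f]
    integral_restrict_space[OF this(1), of f] integral_restrict_space[OF this(2), of f]
  have "(\<lambda>x. indicator S x *\<^sub>R f x) = (\<lambda>x. indicator T x *\<^sub>R f x)"
    using assms by (auto simp: indicator_def fun_eq_iff)
  with r show "integrable (lebesgue_on S) f \<longleftrightarrow> integrable (lebesgue_on T) f"
    "(\<integral>x. f x \<partial>lebesgue_on S) = (\<integral>x. f x \<partial>lebesgue_on T)" by auto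
qed

lemma continuous_on_measurable_lebesgue_on:
  "continuous_on S f \<Longrightarrow> open S \<Longrightarrow> f \<in> borel_measurable (lebesgue_on S)"
  for f :: "'a::euclidean_space \<Rightarrow> 'b::euclidean_space"
  by (rule continuous_imp_measurable_on_sets_lebesgue) auto

lemma C1c_test_mono: "C1c_test S phi Dphi \<Longrightarrow> S \<subseteq> T \<Longrightarrow> C1c_test T phi Dphi"
  unfolding C1c_test_def by (meson subset_trans)

text \<open>The fields and factors paired with test functions later are bounded on compact subsets,
  so L^1 convergence suffices. The closure of the inner domain is one compact set that carries the
  test pair and all approximants. Only \<open>xi\<close> is nonnegative; the sign of
  \<open>phi n\<close> is not controlled.\<close>

lemma admissible_testE:
  fixes xi :: "'a::euclidean_space \<Rightarrow> real"
  assumes adm: "admissible_test q \<Omega> xi H" and q: "1 < q" and \<Omega>: "open \<Omega>"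
  obtains K phi Dphi where "compact K" "K \<subseteq> \<Omega>" "\<And>x. 0 \<le> xi x" "\<And>x. x \<notin> K \<Longrightarrow> xi x = 0" "\<And>x. x \<notin> K \<Longrightarrow> H x = 0"
    "integrable (lebesgue_on \<Omega>) xi" "integrable (lebesgue_on \<Omega>) H"
    "\<And>n. C1c_test \<Omega> (phi n) (Dphi n)" "\<And>n x. x \<notin> K \<Longrightarrow> phi n x = 0" "\<And>n x. x \<notin> K \<Longrightarrow> Dphi n x = 0"
    "(\<lambda>n. \<integral>x. norm (phi n x - xi x) \<partial>lebesgue_on \<Omega>) \<longlonglongrightarrow> 0"
    "(\<lambda>n. \<integral>x. norm (Dphi n x - H x) \<partial>lebesgue_on \<Omega>) \<longlonglongrightarrow> 0"
proof -
  obtain O' where O': "open O'" "compact (closure O')" "closure O' \<subseteq> \<Omega>" "sobolev_W0 q O' xi H"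
    "\<And>x. x \<notin> O' \<Longrightarrow> xi x = 0" "\<And>x. x \<notin> O' \<Longrightarrow> H x = 0" "\<And>x. 0 \<le> xi x"
    using adm unfolding admissible_test_def by blast
  obtain phi Dphi where phi: "\<And>n. C1c_test O' (phi n) (Dphi n)"
    "(\<lambda>n. \<integral>x. \<bar>phi n x - xi x\<bar> powr q \<partial>lebesgue_on O') \<longlonglongrightarrow> 0"
    "(\<lambda>n. \<integral>x. norm (Dphi n x - H x) powr q \<partial>lebesgue_on O') \<longlonglongrightarrow> 0"
    using O'(4) unfolding sobolev_W0_def by blast
  have sub: "O' \<subseteq> \<Omega>" using O'(3) closure_subset by blast
  have "bounded O'" by (rule bounded_subset[OF compact_imp_bounded[OF O'(2)] closure_subset])
  then interpret finite_measure "lebesgue_on O'"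
    using O'(1) by (rule finite_measure_lebesgue_on_bounded)
  have L: "xi \<in> borel_measurable (lebesgue_on O')" "integrable (lebesgue_on O') (\<lambda>x. norm (xi x) powr q)"
    "H \<in> borel_measurable (lebesgue_on O')" "integrable (lebesgue_on O') (\<lambda>x. norm (H x) powr q)"
    using O'(4) by (auto simp: sobolev_W0_def Lp_on_def Lpv_on_def)
  have p0: "phi n x = 0" "Dphi n x = 0" if "x \<notin> O'" for n x
    using C1c_testD[OF phi(1)[of n]] that by (metis subsetD)+
  have c: "continuous_on UNIV (phi n)" "continuous_on UNIV (Dphi n)" for n
    using C1c_test_continuous[OF phi(1)] phi(1) by (auto simp: C1c_test_def)
  have m: "phi n \<in> borel_measurable (lebesgue_on O')" "Dphi n \<in> borel_measurable (lebesgue_on O')" for n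
    using c[of n] O'(1) continuous_on_subset by (blast intro: continuous_on_measurable_lebesgue_on)+
  have ip: "integrable (lebesgue_on O') (\<lambda>x. norm (phi n x) powr q)"
    "integrable (lebesgue_on O') (\<lambda>x. norm (Dphi n x) powr q)" for n
  proof -
    obtain K where K: "compact K" "K \<subseteq> O'" "\<And>x. x \<notin> K \<Longrightarrow> phi n x = 0" "\<And>x. x \<notin> K \<Longrightarrow> Dphi n x = 0"
      using C1c_testD[OF phi(1)[of n]] by metis
    have "continuous_on O' (phi n)" "continuous_on O' (Dphi n)"
      using c[of n] by (auto intro: continuous_on_subset)
    then have "continuous_on O' (\<lambda>x. norm (phi n x) powr q)" "continuous_on O' (\<lambda>x. norm (Dphi n x) powr q)"
      using q by (intro continuous_on_powr' continuous_on_norm continuous_on_const; simp)+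
    then show "integrable (lebesgue_on O') (\<lambda>x. norm (phi n x) powr q)"
      "integrable (lebesgue_on O') (\<lambda>x. norm (Dphi n x) powr q)"
      using K q by (auto intro!: integrable_continuous_compact_support[OF O'(1) _ K(1,2)])
  qed
  \<comment> \<open>A Bochner integral of a non-integrable function is 0, so the limits in
    \<open>sobolev_W0\<close> carry information only together with this integrability.\<close>
  have id: "integrable (lebesgue_on O') (\<lambda>x. norm (f x - g x) powr q)"
    if "f \<in> borel_measurable (lebesgue_on O')" "g \<in> borel_measurable (lebesgue_on O')"
      "integrable (lebesgue_on O') (\<lambda>x. norm (f x) powr q)" "integrable (lebesgue_on O') (\<lambda>x. norm (g x) powr q)"
    for f g :: "'a \<Rightarrow> 'c::euclidean_space"
  proof (rule Bochner_Integration.integrable_bound[where f="\<lambda>x. 2 powr q * (norm (f x) powr q + norm (g x) powr q)"])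
    show "AE x in lebesgue_on O'. norm (norm (f x - g x) powr q) \<le> norm (2 powr q * (norm (f x) powr q + norm (g x) powr q))"
    proof (rule AE_I2)
      fix x
      have "norm (f x - g x) powr q \<le> (norm (f x) + norm (g x)) powr q"
        using q by (intro powr_mono2 norm_triangle_ineq4) auto
      also have "\<dots> \<le> 2 powr q * (norm (f x) powr q + norm (g x) powr q)"
        using q by (intro powr_add_le_scaled) auto
      finally show "norm (norm (f x - g x) powr q) \<le> norm (2 powr q * (norm (f x) powr q + norm (g x) powr q))"
        by simp
    qed
  qed (use that in auto)
  have l: "(\<lambda>n. \<integral>x. norm (phi n x - xi x) \<partial>lebesgue_on O') \<longlonglongrightarrow> 0"
    "(\<lambda>n. \<integral>x. norm (Dphi n x - H x) \<partial>lebesgue_on O') \<longlonglongrightarrow> 0"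
    using integral_norm_tendsto_0_if_powr[OF _ id, of phi "\<lambda>_. xi"]
      integral_norm_tendsto_0_if_powr[OF _ id, of Dphi "\<lambda>_. H"] phi(2,3) m L ip q by simp_all
  note e = integrable_lebesgue_on_zero_outside[OF O'(1) \<Omega> sub]
  have i: "integrable (lebesgue_on O') xi" "integrable (lebesgue_on O') H"
    using integrable_if_powr_integrable[OF L(1), of q] integrable_if_powr_integrable[OF L(3), of q] L q by simp_all
  have 1: "integrable (lebesgue_on \<Omega>) xi" "integrable (lebesgue_on \<Omega>) H"
    using i e(1)[of xi] e(1)[of H] O' by auto
  have 2: "(\<integral>x. norm (phi n x - xi x) \<partial>lebesgue_on O') = (\<integral>x. norm (phi n x - xi x) \<partial>lebesgue_on \<Omega>)"
    "(\<integral>x. norm (Dphi n x - H x) \<partial>lebesgue_on O') = (\<integral>x. norm (Dphi n x - H x) \<partial>lebesgue_on \<Omega>)" for n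
    by (intro e; simp add: O' p0)+
  have cl: "x \<notin> closure O' \<Longrightarrow> x \<notin> O'" for x using closure_subset by blast
  show thesis
    by (rule that[OF O'(2,3,7)]) (use O' 1 l 2 p0 cl C1c_test_mono[OF phi(1) sub] in auto)
qed

text \<open>A bound over \<open>K\<close> alone admits factors that blow up at the boundary, such as
  a negative power of the distance.\<close>

lemma integrable_inner_compact_support:
  fixes f g :: "'a::euclidean_space \<Rightarrow> 'b::euclidean_space"
  assumes f: "integrable (lebesgue_on S) f" "\<And>x. x \<notin> K \<Longrightarrow> f x = 0"
    and g: "g \<in> borel_measurable (lebesgue_on S)" "\<And>x. x \<in> K \<Longrightarrow> norm (g x) \<le> M"
  shows "integrable (lebesgue_on S) (\<lambda>x. g x \<bullet> f x)"
    "\<bar>\<integral>x. g x \<bullet> f x \<partial>lebesgue_on S\<bar> \<le> M * (\<integral>x. norm (f x) \<partial>lebesgue_on S)"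
proof -
  have b: "\<bar>g x \<bullet> f x\<bar> \<le> M * norm (f x)" for x
  proof (cases "x \<in> K")
    case True
    have "\<bar>g x \<bullet> f x\<bar> \<le> norm (g x) * norm (f x)" by (rule Cauchy_Schwarz_ineq2)
    also have "\<dots> \<le> M * norm (f x)" using g(2)[OF True] by (intro mult_right_mono) auto
    finally show ?thesis .
  qed (use f in simp)
  show i: "integrable (lebesgue_on S) (\<lambda>x. g x \<bullet> f x)"
    by (rule Bochner_Integration.integrable_bound[of _ "\<lambda>x. M * norm (f x)"])
      (use f(1) g(1) order_trans[OF b abs_ge_self] in auto)
  have "\<bar>\<integral>x. g x \<bullet> f x \<partial>lebesgue_on S\<bar> \<le> (\<integral>x. \<bar>g x \<bullet> f x\<bar> \<partial>lebesgue_on S)"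
    by (rule integral_abs_bound)
  also have "\<dots> \<le> (\<integral>x. M * norm (f x) \<partial>lebesgue_on S)"
    by (rule integral_mono) (use i f(1) b in auto)
  finally show "\<bar>\<integral>x. g x \<bullet> f x \<partial>lebesgue_on S\<bar> \<le> M * (\<integral>x. norm (f x) \<partial>lebesgue_on S)"
    by simp
qed

lemma tendsto_integral_inner_compact_support:
  fixes f :: "nat \<Rightarrow> 'a::euclidean_space \<Rightarrow> 'b::euclidean_space"
  assumes f: "\<And>n. integrable (lebesgue_on S) (f n)" "\<And>n x. x \<notin> K \<Longrightarrow> f n x = 0"
    and f0: "integrable (lebesgue_on S) f0" "\<And>x. x \<notin> K \<Longrightarrow> f0 x = 0"
    and g: "g \<in> borel_measurable (lebesgue_on S)" "\<And>x. x \<in> K \<Longrightarrow> norm (g x) \<le> M"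
    and lim: "(\<lambda>n. \<integral>x. norm (f n x - f0 x) \<partial>lebesgue_on S) \<longlonglongrightarrow> 0"
  shows "(\<lambda>n. \<integral>x. g x \<bullet> f n x \<partial>lebesgue_on S) \<longlonglongrightarrow> (\<integral>x. g x \<bullet> f0 x \<partial>lebesgue_on S)"
proof -
  have "(\<lambda>n. \<integral>x. g x \<bullet> (f n x - f0 x) \<partial>lebesgue_on S) \<longlonglongrightarrow> 0"
  proof (rule Lim_null_comparison[OF _ tendsto_mult_right_zero[OF lim, of M]])
    show "\<forall>\<^sub>F n in sequentially. norm (\<integral>x. g x \<bullet> (f n x - f0 x) \<partial>lebesgue_on S) \<le> M * (\<integral>x. norm (f n x - f0 x) \<partial>lebesgue_on S)"
      unfolding real_norm_def
      by (intro always_eventually allI integrable_inner_compact_support(2)[where K=K])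
        (use f f0 g in auto)
  qed
  moreover have "(\<integral>x. g x \<bullet> (f n x - f0 x) \<partial>lebesgue_on S) = (\<integral>x. g x \<bullet> f n x \<partial>lebesgue_on S) - (\<integral>x. g x \<bullet> f0 x \<partial>lebesgue_on S)" for n
    using integrable_inner_compact_support(1)[OF f(1)[of n] f(2)[of _ n] g] integrable_inner_compact_support(1)[OF f0 g]
    by (simp add: inner_diff_right)
  ultimately show ?thesis by (simp add: LIM_zero_iff)
qed

text \<open>On a fixed compact set \<open>V\<close> and its divergence are bounded, so both sides
  are continuous in the test pair with respect to L^1 convergence.\<close>

lemma admissible_integration_by_parts:
  fixes V :: "'a::euclidean_space \<Rightarrow> 'a"
  assumes \<Omega>: "open \<Omega>" and V: "C1_on \<Omega> V V'" and adm: "admissible_test q \<Omega> xi H" and q: "1 < q"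
  shows "integrable (lebesgue_on \<Omega>) (\<lambda>x. V x \<bullet> H x)"
    "integrable (lebesgue_on \<Omega>) (\<lambda>x. divergence (V' x) * xi x)"
    "(\<integral>x. V x \<bullet> H x \<partial>lebesgue_on \<Omega>) = - (\<integral>x. divergence (V' x) * xi x \<partial>lebesgue_on \<Omega>)"
proof -
  obtain K phi Dphi where K: "compact K" "K \<subseteq> \<Omega>" and pos: "\<And>x. 0 \<le> xi x"
    and xi: "\<And>x. x \<notin> K \<Longrightarrow> xi x = 0" "\<And>x. x \<notin> K \<Longrightarrow> H x = 0"
    "integrable (lebesgue_on \<Omega>) xi" "integrable (lebesgue_on \<Omega>) H"
    and phi: "\<And>n. C1c_test \<Omega> (phi n) (Dphi n)" "\<And>n x. x \<notin> K \<Longrightarrow> phi n x = 0" "\<And>n x. x \<notin> K \<Longrightarrow> Dphi n x = 0"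
    and lim: "(\<lambda>n. \<integral>x. norm (phi n x - xi x) \<partial>lebesgue_on \<Omega>) \<longlonglongrightarrow> 0"
    "(\<lambda>n. \<integral>x. norm (Dphi n x - H x) \<partial>lebesgue_on \<Omega>) \<longlonglongrightarrow> 0"
    by (rule admissible_testE[OF adm q \<Omega>]) (rule that; assumption)
  define h where "h x = divergence (V' x)" for x
  have cV: "continuous_on \<Omega> V" "continuous_on \<Omega> h"
    using C1_on_continuous[OF V] C1_on_continuous_divergence[OF V] by (auto simp: h_def)
  have mV: "V \<in> borel_measurable (lebesgue_on \<Omega>)" "h \<in> borel_measurable (lebesgue_on \<Omega>)"
    using cV \<Omega> by (auto intro: continuous_on_measurable_lebesgue_on)
  have "bounded (V ` K)" "bounded (h ` K)"
    by (rule compact_imp_bounded[OF compact_continuous_image[OF continuous_on_subset[OF cV(1) K(2)] K(1)]],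
        rule compact_imp_bounded[OF compact_continuous_image[OF continuous_on_subset[OF cV(2) K(2)] K(1)]])
  then obtain M1 M2 where M: "\<And>x. x \<in> K \<Longrightarrow> norm (V x) \<le> M1" "\<And>x. x \<in> K \<Longrightarrow> norm (h x) \<le> M2"
    unfolding bounded_iff by fast
  have ip: "integrable (lebesgue_on \<Omega>) (phi n)" "integrable (lebesgue_on \<Omega>) (Dphi n)" for n
  proof -
    have "continuous_on UNIV (Dphi n)" using phi(1)[of n] by (simp add: C1c_test_def)
    then have "continuous_on \<Omega> (phi n)" "continuous_on \<Omega> (Dphi n)"
      using C1c_test_continuous[OF phi(1)[of n]] by (auto intro: continuous_on_subset)
    then show "integrable (lebesgue_on \<Omega>) (phi n)" "integrable (lebesgue_on \<Omega>) (Dphi n)"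
      using phi(2,3) by (auto intro!: integrable_continuous_compact_support(2)[OF \<Omega> _ K])
  qed
  show "integrable (lebesgue_on \<Omega>) (\<lambda>x. V x \<bullet> H x)"
    by (rule integrable_inner_compact_support(1)[OF xi(4,2) mV(1) M(1)])
  show "integrable (lebesgue_on \<Omega>) (\<lambda>x. divergence (V' x) * xi x)"
    using integrable_inner_compact_support(1)[OF xi(3,1) mV(2) M(2)] by (simp add: h_def)
  have l1: "(\<lambda>n. \<integral>x. V x \<bullet> Dphi n x \<partial>lebesgue_on \<Omega>) \<longlonglongrightarrow> (\<integral>x. V x \<bullet> H x \<partial>lebesgue_on \<Omega>)"
    by (rule tendsto_integral_inner_compact_support[OF ip(2) phi(3) xi(4,2) mV(1) M(1) lim(2)])
  have l2: "(\<lambda>n. \<integral>x. h x * phi n x \<partial>lebesgue_on \<Omega>) \<longlonglongrightarrow> (\<integral>x. h x * xi x \<partial>lebesgue_on \<Omega>)"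
    using tendsto_integral_inner_compact_support[OF ip(1) phi(2) xi(3,1) mV(2) M(2) lim(1)] by simp
  have "(\<integral>x. V x \<bullet> Dphi n x \<partial>lebesgue_on \<Omega>) = - (\<integral>x. h x * phi n x \<partial>lebesgue_on \<Omega>)" for n
    using integration_by_parts_C1[OF \<Omega> V phi(1)[of n]] by (simp add: h_def mult.commute)
  with l1 have "(\<lambda>n. - (\<integral>x. h x * phi n x \<partial>lebesgue_on \<Omega>)) \<longlonglongrightarrow> (\<integral>x. V x \<bullet> H x \<partial>lebesgue_on \<Omega>)"
    by simp
  from LIMSEQ_unique[OF this tendsto_minus[OF l2]]
  show "(\<integral>x. V x \<bullet> H x \<partial>lebesgue_on \<Omega>) = - (\<integral>x. divergence (V' x) * xi x \<partial>lebesgue_on \<Omega>)"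
    by (simp add: h_def)
qed

section \<open>Positive C1 functions with zero boundary values lie in W0\<close>

lemma has_real_derivative_pos_part_powr:
  fixes a t :: real
  assumes "1 < a"
  shows "((\<lambda>t. max 0 t powr a) has_real_derivative a * max 0 t powr (a - 1)) (at t)"
proof (cases t "0::real" rule: linorder_cases)
  case less
  have "((\<lambda>t. max 0 t powr a) has_derivative (\<lambda>h. 0)) (at t)"
    by (rule has_derivative_transform_within_open[of "\<lambda>x. 0" _ _ _ "{..<0}"]) (use less assms in auto)
  then show ?thesis using less by (simp add: has_field_derivative_def lambda_zero)
next
  case greater
  have "((\<lambda>t. t powr a) has_derivative (*) (a * t powr (a - 1))) (at t)"
    using has_real_derivative_powr[OF greater, of a] by (simp add: has_field_derivative_def)
  then have "((\<lambda>t. max 0 t powr a) has_derivative (*) (a * t powr (a - 1))) (at t)"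
    by (rule has_derivative_transform_within_open[of _ _ _ _ "{0<..}"]) (use greater in auto)
  then show ?thesis using greater by (simp add: has_field_derivative_def)
next
  case equal
  \<comment> \<open>At 0 the difference quotient is at most |h|^(a-1), which tends to 0 because a >
    1.\<close>
  have "((\<lambda>h. max 0 h powr a / h) \<longlongrightarrow> 0) (at 0)"
  proof (rule Lim_null_comparison)
    show "\<forall>\<^sub>F h in at 0. norm (max 0 h powr a / h) \<le> \<bar>h\<bar> powr (a - 1)"
      by (intro always_eventually allI) (auto simp: max_def powr_diff divide_le_0_iff)
    have "((\<lambda>h. \<bar>h\<bar> powr (a - 1)) \<longlongrightarrow> \<bar>0::real\<bar> powr (a - 1)) (at 0)"
      by (rule tendsto_powr2) (use assms in \<open>auto intro!: tendsto_eq_intros\<close>)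
    then show "((\<lambda>h::real. \<bar>h\<bar> powr (a - 1)) \<longlongrightarrow> 0) (at 0)" by simp
  qed
  then show ?thesis using equal assms by (simp add: DERIV_def)
qed

text \<open>For a basis vector \<open>b\<close> the field u b has divergence G . b, so the
  b-component of the vector identity is integration by parts for that field.\<close>

lemma C1_on_weak_gradient:
  fixes u :: "'a::euclidean_space \<Rightarrow> real"
  assumes S: "open S" and u: "\<And>x. x \<in> S \<Longrightarrow> (u has_derivative (\<lambda>h. G x \<bullet> h)) (at x)"
    and G: "continuous_on S G"
  shows "weak_gradient S u G"
proof -
  have cu: "continuous_on S u"
    using u by (meson continuous_at_imp_continuous_on has_derivative_continuous)
  have 1: "set_integrable lebesgue K f" if "compact K" "K \<subseteq> S" "continuous_on S f" for K and f :: "'a \<Rightarrow> 'c::euclidean_space"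
  proof -
    have "integrable lborel (\<lambda>x. indicator K x *\<^sub>R f x)"
      by (rule borel_integrable_compact) (use that continuous_on_subset in auto)
    then show ?thesis unfolding set_integrable_def
      using integrable_completion borel_measurable_integrable by blast
  qed
  have "(\<integral>x. u x *\<^sub>R Dphi x \<partial>lebesgue_on S) = - (\<integral>x. phi x *\<^sub>R G x \<partial>lebesgue_on S)"
    if phi: "C1c_test S phi Dphi" for phi Dphi
  proof (rule euclidean_eqI)
    fix b :: 'a assume b: "b \<in> Basis"
    obtain K where K: "compact K" "K \<subseteq> S" "\<And>x. x \<notin> K \<Longrightarrow> phi x = 0" "\<And>x. x \<notin> K \<Longrightarrow> Dphi x = 0"
      using C1c_testD[OF phi] by metis
    have c: "continuous_on S phi" "continuous_on S Dphi"
      using phi C1c_test_continuous[OF phi] continuous_on_subset unfolding C1c_test_def by blast+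
    have i: "integrable (lebesgue_on S) (\<lambda>x. u x *\<^sub>R Dphi x)" "integrable (lebesgue_on S) (\<lambda>x. phi x *\<^sub>R G x)"
      by (rule integrable_continuous_compact_support(2)[OF S _ K(1,2)];
          use K in \<open>auto intro!: continuous_on_scaleR c cu G\<close>)+
    have V: "C1_on S (\<lambda>x. u x *\<^sub>R b) (\<lambda>x h. (G x \<bullet> h) *\<^sub>R b)"
      unfolding C1_on_def using u by (auto intro!: derivative_eq_intros continuous_intros G)
    have d: "divergence (\<lambda>h. (G x \<bullet> h) *\<^sub>R b) = G x \<bullet> b" for x
      unfolding divergence_def using b by (simp add: inner_Basis sum.delta if_distrib cong: if_cong)
    have "(\<integral>x. u x *\<^sub>R Dphi x \<partial>lebesgue_on S) \<bullet> b = (\<integral>x. (u x *\<^sub>R Dphi x) \<bullet> b \<partial>lebesgue_on S)"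
      by (rule integral_inner_left[symmetric]) (rule i(1))
    also have "\<dots> = (\<integral>x. (u x *\<^sub>R b) \<bullet> Dphi x \<partial>lebesgue_on S)"
      by (simp add: inner_commute)
    also have "\<dots> = - (\<integral>x. phi x * (G x \<bullet> b) \<partial>lebesgue_on S)"
      using integration_by_parts_C1[OF S V phi] by (simp add: d)
    also have "(\<integral>x. phi x * (G x \<bullet> b) \<partial>lebesgue_on S) = (\<integral>x. phi x *\<^sub>R G x \<partial>lebesgue_on S) \<bullet> b"
      unfolding inner_scaleR_left[symmetric] by (rule integral_inner_left) (rule i(2))
    also have "- \<dots> = (- (\<integral>x. phi x *\<^sub>R G x \<partial>lebesgue_on S)) \<bullet> b" by simp
    finally show "(\<integral>x. u x *\<^sub>R Dphi x \<partial>lebesgue_on S) \<bullet> b = (- (\<integral>x. phi x *\<^sub>R G x \<partial>lebesgue_on S)) \<bullet> b" .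
  qed
  then show ?thesis by (simp add: weak_gradient_def 1[OF _ _ cu] 1[OF _ _ G])
qed

text \<open>The truncations \<open>((u - 1/n)\<^sub>+)\<^sup>2 / u\<close> are compactly supported and converge to \<open>u\<close> together with their gradients.\<close>

lemma C1_positive_in_W0:
  fixes u :: "'a::euclidean_space \<Rightarrow> real"
  assumes S: "open S" "bounded S" and r: "1 < r"
    and u: "\<And>x. x \<in> S \<Longrightarrow> (u has_derivative (\<lambda>h. G x \<bullet> h)) (at x)"
    and G: "continuous_on S G" and M: "\<And>x. x \<in> S \<Longrightarrow> norm (G x) \<le> M"
    and cu: "continuous_on (closure S) u" and u0: "\<And>x. x \<in> frontier S \<Longrightarrow> u x = 0"
    and pos: "\<And>x. x \<in> S \<Longrightarrow> 0 < u x"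
  shows "sobolev_W0 r S u G"
proof -
  interpret finite_measure "lebesgue_on S" by (rule finite_measure_lebesgue_on_bounded[OF S(2,1)])
  have cuS: "continuous_on S u" using cu closure_subset continuous_on_subset by blast
  have mu: "u \<in> borel_measurable (lebesgue_on S)" and mG: "G \<in> borel_measurable (lebesgue_on S)"
    using cuS G S(1) by (auto intro: continuous_on_measurable_lebesgue_on)
  have "bounded (u ` closure S)"
    by (rule compact_imp_bounded[OF compact_continuous_image[OF cu]]) (use S in auto)
  then obtain B where B': "\<And>x. x \<in> closure S \<Longrightarrow> \<bar>u x\<bar> \<le> B" by (auto simp: bounded_iff)
  then have B: "\<bar>u x\<bar> \<le> B" if "x \<in> S" for x using that closure_subset by blast
  have bi: "integrable (lebesgue_on S) f" if "f \<in> borel_measurable (lebesgue_on S)" "\<And>x. x \<in> S \<Longrightarrow> norm (f x) \<le> C"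
    for f :: "'a \<Rightarrow> real" and C
    by (rule integrable_const_bound[of _ C]) (use that in \<open>auto intro!: AE_I2\<close>)
  have L: "Lp_on r S u" unfolding Lp_on_def
    using mu B r by (auto intro!: bi[where C="B powr r"] powr_mono2)
  have Lv: "Lpv_on r S G" unfolding Lpv_on_def
    using mG M r by (auto intro!: bi[where C="M powr r"] powr_mono2)
  define s where "s n = inverse (real (Suc n))" for n
  have s: "0 < s n" for n by (auto simp: s_def)
  have s0: "s \<longlonglongrightarrow> 0" unfolding s_def by (rule LIMSEQ_inverse_real_of_nat)
  define P where "P n x = max 0 (u x - s n)" for n x
  define phi where "phi n x = (if x \<in> S then P n x ^ 2 / u x else 0)" for n x
  \<comment> \<open>The derivative of t -> ((t - s)_+)^2 / t at t = u x. It equals 1 - (1 - P/u)^2,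
    hence lies between 0 and 1, which gives a dominating function for the gradients.\<close>
  define c where "c n x = (2 * P n x * u x - P n x ^ 2) / u x ^ 2" for n x
  define Dphi where "Dphi n x = (if x \<in> S then c n x *\<^sub>R G x else 0)" for n x
  have P: "0 \<le> P n x" "P n x \<le> u x" if "x \<in> S" for n x using pos[OF that] s[of n] by (auto simp: P_def)
  have cbd: "0 \<le> c n x" "c n x \<le> 1" if "x \<in> S" for n x
  proof -
    have "P n x ^ 2 \<le> P n x * u x" using P[OF that, of n] by (simp add: power2_eq_square mult_left_mono)
    moreover have "0 \<le> P n x * u x" using P[OF that, of n] pos[OF that] by simp
    ultimately have "0 \<le> 2 * P n x * u x - P n x ^ 2" by linarith
    then show "0 \<le> c n x" by (simp add: c_def)
    have "0 \<le> (u x - P n x)\<^sup>2" by simp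
    then have "2 * P n x * u x - P n x ^ 2 \<le> u x ^ 2" by (simp add: power2_diff algebra_simps)
    then show "c n x \<le> 1" using pos[OF that] by (simp add: c_def divide_le_eq_1)
  qed
  have test: "C1c_test S (phi n) (Dphi n)" for n
  proof -
    \<comment> \<open>A superlevel set at a positive height stays away from the frontier, where
      \<open>u\<close> vanishes; the truncation is zero off it.\<close>
    define K where "K = {x \<in> closure S. s n \<le> u x}"
    have "compact K"
    proof -
      have "K = closure S \<inter> u -` {s n..}" by (auto simp: K_def)
      moreover have "closed (closure S \<inter> u -` {s n..})" by (rule continuous_closed_preimage[OF cu]) auto
      moreover have "bounded K" using S(2) by (auto simp: K_def intro: bounded_subset[of "closure S"])
      ultimately show ?thesis by (simp add: compact_eq_bounded_closed)
    qed
    have KS: "K \<subseteq> S"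
    proof
      fix x assume x: "x \<in> K"
      then have "x \<notin> frontier S" using u0[of x] s[of n] by (auto simp: K_def)
      then show "x \<in> S" using x S(1) by (auto simp: K_def frontier_def interior_open)
    qed
    have off: "P n x = 0" if "x \<in> S - K" for x
      using that closure_subset by (auto simp: K_def P_def)
    have phi0: "phi n x = 0" if "x \<notin> K" for x using off that by (auto simp: phi_def)
    have "(phi n has_derivative (if x \<in> S then (\<lambda>h. c n x * (G x \<bullet> h)) else (\<lambda>h. 0))) (at x)" for x
      unfolding phi_def
    proof (rule has_derivative_zero_extension[OF S(1) compact_imp_closed[OF \<open>compact K\<close>] KS])
      fix x assume x: "x \<in> S"
      have "((\<lambda>t. max 0 t powr 2) has_real_derivative 2 * max 0 (u x - s n) powr (2 - 1)) (at (u x - s n))"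
        by (rule has_real_derivative_pos_part_powr) simp
      then have "((\<lambda>t. (max 0 t) ^ 2) has_real_derivative 2 * max 0 (u x - s n)) (at (u x - s n))"
        by simp
      then have d: "((\<lambda>t. (max 0 t) ^ 2) has_derivative (*) (2 * P n x)) (at (u x - s n))"
        by (simp add: has_field_derivative_def P_def)
      have "((\<lambda>x. P n x ^ 2) has_derivative (\<lambda>h. 2 * P n x * (G x \<bullet> h))) (at x)"
      proof -
        have "((\<lambda>x. u x - s n) has_derivative (\<lambda>h. G x \<bullet> h)) (at x)"
          using u[OF x] by (auto intro!: derivative_eq_intros)
        from has_derivative_compose[OF this d] show ?thesis by (simp add: P_def)
      qed
      from has_derivative_divide'[OF this u[OF x]] pos[OF x]
      have d: "((\<lambda>x. P n x ^ 2 / u x) has_derivative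
          (\<lambda>h. (2 * P n x * (G x \<bullet> h) * u x - P n x ^ 2 * (G x \<bullet> h)) / (u x * u x))) (at x)"
        by simp
      show "((\<lambda>x. P n x ^ 2 / u x) has_derivative (\<lambda>h. c n x * (G x \<bullet> h))) (at x)"
        by (rule has_derivative_eq_rhs[OF d])
          (use pos[OF x] in \<open>auto simp: c_def field_simps power2_eq_square\<close>)
    qed (use off in auto)
    then have der: "(phi n has_derivative (\<lambda>h. Dphi n x \<bullet> h)) (at x)" for x
      by (cases "x \<in> S") (simp_all add: Dphi_def, metis+)
    have "continuous_on S (\<lambda>x. c n x *\<^sub>R G x)"
      unfolding c_def P_def using pos by (auto intro!: continuous_intros cuS G simp: less_imp_neq[symmetric])
    then have "continuous_on UNIV (Dphi n)"
      unfolding Dphi_def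
      by (rule continuous_on_zero_extension[OF S(1) compact_imp_closed[OF \<open>compact K\<close>] KS])
        (use off in \<open>auto simp: c_def\<close>)
    with \<open>compact K\<close> KS phi0 der show ?thesis unfolding C1c_test_def by blast
  qed
  have mphi: "phi n \<in> borel_measurable (lebesgue_on S)" "Dphi n \<in> borel_measurable (lebesgue_on S)" for n
    using test[of n] C1c_test_continuous[OF test[of n]] S(1)
    by (auto simp: C1c_test_def intro!: continuous_on_measurable_lebesgue_on intro: continuous_on_subset)
  have Plim: "(\<lambda>n. P n x) \<longlonglongrightarrow> u x" if "x \<in> S" for x
  proof -
    have "(\<lambda>n. max 0 (u x - s n)) \<longlonglongrightarrow> max 0 (u x - 0)" by (intro tendsto_intros s0)
    then show ?thesis using pos[OF that] by (simp add: P_def max_absorb2)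
  qed
  have "(\<lambda>n. \<integral>x. \<bar>phi n x - u x\<bar> powr r \<partial>lebesgue_on S) \<longlonglongrightarrow> (\<integral>x. 0 \<partial>lebesgue_on S)"
  proof (rule integral_dominated_convergence[where w="\<lambda>_. B powr r"])
    show "AE x in lebesgue_on S. (\<lambda>n. \<bar>phi n x - u x\<bar> powr r) \<longlonglongrightarrow> 0"
    proof (rule AE_I2)
      fix x assume "x \<in> space (lebesgue_on S)"
      then have x: "x \<in> S" by simp
      have "(\<lambda>n. \<bar>phi n x - u x\<bar> powr r) \<longlonglongrightarrow> \<bar>u x ^ 2 / u x - u x\<bar> powr r"
        using x pos[OF x] r by (intro tendsto_powr2) (auto simp: phi_def intro!: tendsto_intros Plim)
      then show "(\<lambda>n. \<bar>phi n x - u x\<bar> powr r) \<longlonglongrightarrow> 0" using pos[OF x] by (simp add: power2_eq_square)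
    qed
    show "AE x in lebesgue_on S. norm (\<bar>phi n x - u x\<bar> powr r) \<le> B powr r" for n
    proof (rule AE_I2)
      fix x assume "x \<in> space (lebesgue_on S)"
      then have x: "x \<in> S" by simp
      have "P n x ^ 2 \<le> u x ^ 2" using P[OF x, of n] by (intro power_mono)
      then have "0 \<le> phi n x" "phi n x \<le> u x"
        using x pos[OF x] by (auto simp: phi_def divide_le_eq power2_eq_square)
      then have "\<bar>phi n x - u x\<bar> \<le> B" using B[OF x] by linarith
      then show "norm (\<bar>phi n x - u x\<bar> powr r) \<le> B powr r" using r by (simp add: powr_mono2)
    qed
  qed (use mphi mu in auto)
  moreover have "(\<lambda>n. \<integral>x. norm (Dphi n x - G x) powr r \<partial>lebesgue_on S) \<longlonglongrightarrow> (\<integral>x. 0 \<partial>lebesgue_on S)"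
  proof (rule integral_dominated_convergence[where w="\<lambda>_. M powr r"])
    show "AE x in lebesgue_on S. (\<lambda>n. norm (Dphi n x - G x) powr r) \<longlonglongrightarrow> 0"
    proof (rule AE_I2)
      fix x assume "x \<in> space (lebesgue_on S)"
      then have x: "x \<in> S" by simp
      have "(\<lambda>n. norm (Dphi n x - G x) powr r) \<longlonglongrightarrow> norm (((2 * u x * u x - u x ^ 2) / u x ^ 2) *\<^sub>R G x - G x) powr r"
        using x pos[OF x] r by (intro tendsto_powr2) (auto simp: Dphi_def c_def intro!: tendsto_intros Plim)
      then show "(\<lambda>n. norm (Dphi n x - G x) powr r) \<longlonglongrightarrow> 0" using pos[OF x] by (simp add: power2_eq_square)
    qed
    show "AE x in lebesgue_on S. norm (norm (Dphi n x - G x) powr r) \<le> M powr r" for n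
    proof (rule AE_I2)
      fix x assume "x \<in> space (lebesgue_on S)"
      then have x: "x \<in> S" by simp
      have "Dphi n x - G x = (c n x - 1) *\<^sub>R G x" using x by (simp add: Dphi_def algebra_simps)
      then have "norm (Dphi n x - G x) = \<bar>c n x - 1\<bar> * norm (G x)" by simp
      also have "\<dots> \<le> 1 * M" using cbd[OF x, of n] M[OF x] by (intro mult_mono) auto
      finally show "norm (norm (Dphi n x - G x) powr r) \<le> M powr r" using r by (simp add: powr_mono2)
    qed
  qed (use mphi mG in auto)
  ultimately show ?thesis
    unfolding sobolev_W0_def using L Lv C1_on_weak_gradient[OF S(1) u G] test by auto
qed

section \<open>The distance to a \<open>C\<^sup>2\<close> boundary\<close>

lemma linear_Basis_expansion:
  "linear f \<Longrightarrow> f h = (\<Sum>b\<in>Basis. (h \<bullet> b) *\<^sub>R f b)"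
  for f :: "'a::euclidean_space \<Rightarrow> 'b::real_vector"
  by (metis (no_types, lifting) euclidean_representation linear_scale linear_sum sum.cong)

lemma C1_on_linear: "C1_on S f f' \<Longrightarrow> x \<in> S \<Longrightarrow> linear (f' x)"
  using C1_on_derivative has_derivative_linear by blast

lemma C1_on_subset: "C1_on S f f' \<Longrightarrow> T \<subseteq> S \<Longrightarrow> C1_on T f f'"
  unfolding C1_on_def using continuous_on_subset by blast

lemma C1_on_compose:
  assumes f: "C1_on S f f'" and g: "C1_on T g g'" and sub: "f ` S \<subseteq> T"
  shows "C1_on S (\<lambda>x. g (f x)) (\<lambda>x h. g' (f x) (f' x h))"
  unfolding C1_on_def
proof (intro conjI ballI allI)
  fix x assume x: "x \<in> S"
  then have "f x \<in> T" using sub by auto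
  from has_derivative_compose[OF C1_on_derivative[OF f x] C1_on_derivative[OF g this]]
  show "((\<lambda>x. g (f x)) has_derivative (\<lambda>h. g' (f x) (f' x h))) (at x)" .
next
  fix h
  \<comment> \<open>Continuity of the outer derivative is known for fixed directions, whereas the
    direction \<open>f' x h\<close> moves with x; the basis expansion reduces to fixed ones.\<close>
  have "continuous_on S (\<lambda>x. \<Sum>b\<in>Basis. (f' x h \<bullet> b) *\<^sub>R g' (f x) b)"
    using sub by (intro continuous_intros C1_on_continuous_derivative[OF f]
      continuous_on_compose2[OF C1_on_continuous_derivative[OF g] C1_on_continuous[OF f]]) auto
  then show "continuous_on S (\<lambda>x. g' (f x) (f' x h))"
  proof (rule continuous_on_eq)
    fix x assume "x \<in> S"
    then have "f x \<in> T" using sub by auto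
    from linear_Basis_expansion[OF C1_on_linear[OF g this], symmetric]
    show "(\<Sum>b\<in>Basis. (f' x h \<bullet> b) *\<^sub>R g' (f x) b) = g' (f x) (f' x h)" .
  qed
qed

lemma C1_on_bounded_derivative:
  fixes f :: "'a::euclidean_space \<Rightarrow> 'b::real_normed_vector"
  assumes "C1_on S f f'" "compact K" "K \<subseteq> S"
  obtains C where "0 \<le> C" "\<And>x h. x \<in> K \<Longrightarrow> norm (f' x h) \<le> C * norm h"
proof -
  have "\<exists>B. \<forall>x\<in>K. norm (f' x b) \<le> B" for b
    using compact_imp_bounded[OF compact_continuous_image[OF continuous_on_subset[OF C1_on_continuous_derivative[OF assms(1), of b] assms(3)] assms(2)]]
    by (auto simp: bounded_iff)
  then obtain B where B: "\<And>b x. x \<in> K \<Longrightarrow> norm (f' x b) \<le> B b" by metis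
  define C where "C = (\<Sum>b\<in>(Basis::'a set). \<bar>B b\<bar>)"
  have "norm (f' x h) \<le> C * norm h" if x: "x \<in> K" for x h
  proof -
    have "linear (f' x)" using C1_on_linear[OF assms(1)] x assms(3) by blast
    then have "norm (f' x h) = norm (\<Sum>b\<in>Basis. (h \<bullet> b) *\<^sub>R f' x b)"
      by (rule arg_cong[OF linear_Basis_expansion])
    also have "\<dots> \<le> (\<Sum>b\<in>Basis. norm ((h \<bullet> b) *\<^sub>R f' x b))" by (rule norm_sum)
    also have "\<dots> \<le> (\<Sum>b\<in>Basis. norm h * \<bar>B b\<bar>)"
    proof (rule sum_mono)
      fix b :: 'a assume b: "b \<in> Basis"
      show "norm ((h \<bullet> b) *\<^sub>R f' x b) \<le> norm h * \<bar>B b\<bar>"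
        unfolding norm_scaleR using Basis_le_norm[OF b, of h] B[OF x, of b]
        by (intro mult_mono) auto
    qed
    also have "\<dots> = C * norm h" by (simp add: C_def sum_distrib_left mult.commute)
    finally show ?thesis .
  qed
  moreover have "0 \<le> C" by (simp add: C_def sum_nonneg)
  ultimately show ?thesis using that by blast
qed

text \<open>Continuity of the derivative of the inverse rests on the resolvent identity g'(y) -
  g'(y0) = g'(y0) o (F(g y0) - F(g y)) o g'(y).\<close>

lemma C1_inverse_function:
  fixes f :: "'a::euclidean_space \<Rightarrow> 'a"
  assumes U: "open U" and f: "C1_on U f f'" and x0: "x0 \<in> U" and inj: "\<And>h. f' x0 h = 0 \<Longrightarrow> h = 0"
  obtains U' V g g' where "open U'" "U' \<subseteq> U" "x0 \<in> U'" "open V" "f x0 \<in> V" "homeomorphism U' V f g"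
    "C1_on V g g'"
proof -
  define F where "F x = Blinfun (f' x)" for x
  have F: "blinfun_apply (F x) = f' x" if "x \<in> U" for x
    unfolding F_def using C1_on_derivative[OF f that] has_derivative_bounded_linear bounded_linear_Blinfun_apply by blast
  have 1: "(f has_derivative blinfun_apply (F x)) (at x)" if "x \<in> U" for x
    using C1_on_derivative[OF f that] F[OF that] by simp
  have 2: "continuous_on U F"
  proof (rule continuous_on_blinfun_componentwise)
    fix i :: 'a
    show "continuous_on U (\<lambda>x. blinfun_apply (F x) i)"
      by (rule continuous_on_eq[OF C1_on_continuous_derivative[OF f, of i]]) (simp add: F)
  qed
  have lin: "linear (f' x0)" by (rule C1_on_linear[OF f x0])
  then obtain L where L: "linear L" "L \<circ> f' x0 = id"
    using linear_injective_left_inverse[of "f' x0"] inj linear_injective_0[OF lin] by blast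
  have "blinfun_apply (Blinfun L) = L" using L(1) by (simp add: bounded_linear_Blinfun_apply linear_conv_bounded_linear)
  then have 3: "Blinfun L o\<^sub>L F x0 = id_blinfun"
    using L(2) F[OF x0] by (intro blinfun_eqI) (simp add: fun_eq_iff)
  obtain U' V g g' where *: "open U'" "U' \<subseteq> U" "x0 \<in> U'" "open V" "f x0 \<in> V" "homeomorphism U' V f g"
    and g: "\<And>y. y \<in> V \<Longrightarrow> (g has_derivative (g' y)) (at y)"
    and inv: "\<And>y. y \<in> V \<Longrightarrow> g' y = inv (blinfun_apply (F (g y)))"
    and bij: "\<And>y. y \<in> V \<Longrightarrow> bij (blinfun_apply (F (g y)))"
    using inverse_function_theorem[OF U 1 2 x0 3] by blast
  have gU: "g y \<in> U" if "y \<in> V" for y using *(2,6) that by (auto simp: homeomorphism_def)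
  have cg: "continuous_on V g" using *(6) by (simp add: homeomorphism_def)
  have "((\<lambda>y. g' y h) \<longlongrightarrow> g' y0 h) (at y0 within V)" if y0: "y0 \<in> V" for y0 h
  proof -
    have "bounded_linear (g' y0)" using g[OF y0] has_derivative_bounded_linear by blast
    then obtain b where b: "b > 0" "\<And>v. norm (g' y0 v) \<le> norm v * b"
      using bounded_linear.pos_bounded by blast
    define \<epsilon> where "\<epsilon> y = norm (F (g y0) - F (g y))" for y
    have "continuous_on V (\<lambda>y. F (g y))"
      by (rule continuous_on_compose2[OF 2 cg]) (use gU in auto)
    then have "((\<lambda>y. F (g y)) \<longlongrightarrow> F (g y0)) (at y0 within V)" using y0 by (simp add: continuous_on_def)
    then have "((\<lambda>y. F (g y0) - F (g y)) \<longlongrightarrow> F (g y0) - F (g y0)) (at y0 within V)" by (intro tendsto_intros)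
    then have e0: "(\<epsilon> \<longlongrightarrow> 0) (at y0 within V)" unfolding \<epsilon>_def by (simp add: tendsto_norm_zero)
    \<comment> \<open>The unknown \<open>g' y h\<close> on the right is split into the difference
      and \<open>g' y0 h\<close>; with \<open>b * \<epsilon> y\<close> at most 1/2 the difference is
      absorbed on the left.\<close>
    have key: "norm (g' y h - g' y0 h) \<le> 2 * b * \<epsilon> y * norm (g' y0 h)" if y: "y \<in> V" and small: "b * \<epsilon> y \<le> 1/2" for y
    proof -
      have r: "blinfun_apply (F (g z)) (g' z v) = v" "g' z (blinfun_apply (F (g z)) v) = v" if "z \<in> V" for z v
        using inv[OF that] bij[OF that] by (simp_all add: bij_is_surj surj_f_inv_f bij_is_inj)
      let ?wa = "g' y h" and ?wb = "g' y0 h"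
      have "g' y0 (blinfun_apply (F (g y0) - F (g y)) ?wa) = ?wa - ?wb"
        using r(2)[OF y0] r(1)[OF y] linear_diff[OF has_derivative_linear[OF g[OF y0]]]
        by (simp add: blinfun.diff_left)
      then have "norm (?wa - ?wb) \<le> norm (blinfun_apply (F (g y0) - F (g y)) ?wa) * b" using b(2) by metis
      also have "\<dots> \<le> (\<epsilon> y * norm ?wa) * b"
        unfolding \<epsilon>_def using b(1) by (intro mult_right_mono norm_blinfun) auto
      also have "\<dots> = (b * \<epsilon> y) * norm ?wa" by simp
      also have "norm ?wa \<le> norm (?wa - ?wb) + norm ?wb" by (metis add.commute norm_triangle_sub)
      finally have "norm (?wa - ?wb) \<le> (b * \<epsilon> y) * norm (?wa - ?wb) + (b * \<epsilon> y) * norm ?wb"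
        using b(1) by (simp add: \<epsilon>_def distrib_left mult_left_mono)
      also have "(b * \<epsilon> y) * norm (?wa - ?wb) \<le> 1/2 * norm (?wa - ?wb)"
        by (intro mult_right_mono small) auto
      finally show ?thesis by simp
    qed
    have "\<forall>\<^sub>F y in at y0 within V. \<epsilon> y < 1 / (2 * b)"
      using e0 b(1) by (intro order_tendstoD(2)[where y=0]) auto
    moreover have "\<forall>\<^sub>F y in at y0 within V. y \<in> V" by (simp add: eventually_at_filter)
    ultimately have "\<forall>\<^sub>F y in at y0 within V. norm (g' y h - g' y0 h) \<le> 2 * b * \<epsilon> y * norm (g' y0 h)"
    proof eventually_elim
      case (elim y)
      then show ?case using b(1) by (intro key) (auto simp: field_simps)
    qed
    moreover have "((\<lambda>y. 2 * b * \<epsilon> y * norm (g' y0 h)) \<longlongrightarrow> 0) (at y0 within V)"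
      by (rule tendsto_eq_rhs[of _ "2 * b * 0 * norm (g' y0 h)"]) (intro tendsto_intros e0, simp)
    ultimately have "((\<lambda>y. g' y h - g' y0 h) \<longlongrightarrow> 0) (at y0 within V)"
      by (rule Lim_null_comparison)
    then show ?thesis by (simp add: LIM_zero_iff)
  qed
  then have "C1_on V g g'" using g by (simp add: C1_on_def continuous_on_def)
  with * show thesis using that by blast
qed

text \<open>The polar cone of an open half space is a ray. The component \<open>M\<close> of
  \<open>N\<close> orthogonal to \<open>a\<close> is tested with \<open>M + t *\<^sub>R a\<close>,
  which lies in the half space for every t > 0; letting t tend to 0 gives M = 0.\<close>

lemma half_space_polar:
  fixes N a :: "'a::real_inner"
  assumes "a \<noteq> 0" and le: "\<And>h. 0 < h \<bullet> a \<Longrightarrow> N \<bullet> h \<le> 0"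
  shows "\<exists>c\<ge>0. N = - c *\<^sub>R a"
proof -
  define c where "c = - (N \<bullet> a) / (a \<bullet> a)"
  have aa: "a \<bullet> a > 0" using assms(1) by simp
  have "N \<bullet> a \<le> 0" using le[OF aa] by simp
  then have c: "0 \<le> c" unfolding c_def using aa by (intro divide_nonneg_pos) auto
  define M where "M = N + c *\<^sub>R a"
  have Ma: "M \<bullet> a = 0" using aa unfolding M_def c_def by (simp add: inner_add_left inner_diff_left)
  have "M \<bullet> M \<le> e" if e: "0 < e" for e
  proof -
    define t where "t = e / (1 + \<bar>N \<bullet> a\<bar>)"
    have t: "0 < t" using e by (simp add: t_def add_pos_nonneg)
    have "(M + t *\<^sub>R a) \<bullet> a > 0" using t aa Ma by (simp add: inner_add_left)
    from le[OF this] have "N \<bullet> M + t * (N \<bullet> a) \<le> 0" by (simp add: inner_add_right)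
    moreover have "N \<bullet> M = (M - c *\<^sub>R a) \<bullet> M" by (simp add: M_def)
    then have "N \<bullet> M = M \<bullet> M" using Ma by (simp add: inner_diff_right inner_commute)
    moreover have "- (t * (N \<bullet> a)) \<le> t * (1 + \<bar>N \<bullet> a\<bar>)" using t by (simp add: algebra_simps abs_if)
    moreover have "t * (1 + \<bar>N \<bullet> a\<bar>) = e" by (simp add: t_def)
    ultimately show ?thesis by linarith
  qed
  then have "M \<bullet> M \<le> 0" by (meson dense_ge)
  then have "M = 0" by (metis inner_eq_zero_iff inner_ge_zero antisym)
  then have "N = - c *\<^sub>R a" by (simp add: M_def eq_neg_iff_add_eq_0)
  with c show ?thesis by blast
qed

text \<open>\<open>C2_boundary\<close> only says where \<psi> is negative. If \<psi> were positive
  at a boundary point, a whole neighbourhood would miss \<Omega>.\<close>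

lemma frontier_level_set:
  fixes \<psi> :: "'a::euclidean_space \<Rightarrow> real"
  assumes "open \<Omega>" "continuous_on (ball x0 r) \<psi>" "\<Omega> \<inter> ball x0 r = {x \<in> ball x0 r. \<psi> x < 0}"
    and y: "y \<in> frontier \<Omega>" "y \<in> ball x0 r"
  shows "\<psi> y = 0"
proof (rule antisym)
  have "y \<notin> \<Omega>" using y(1) assms(1) by (simp add: frontier_def interior_open)
  then show "0 \<le> \<psi> y" using assms(3) y(2) by (metis (mono_tags, lifting) IntE mem_Collect_eq not_le)
  show "\<psi> y \<le> 0"
  proof (rule ccontr)
    assume "\<not> \<psi> y \<le> 0"
    have "open (ball x0 r \<inter> \<psi> -` {0<..})"
      by (rule continuous_open_preimage[OF assms(2)]) auto
    moreover have "y \<in> ball x0 r \<inter> \<psi> -` {0<..}" using \<open>\<not> \<psi> y \<le> 0\<close> y(2) by auto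
    moreover have "y \<in> closure \<Omega>" using y(1) by (simp add: frontier_def)
    ultimately have "\<Omega> \<inter> (ball x0 r \<inter> \<psi> -` {0<..}) \<noteq> {}"
      by (metis closure_iff_nhds_not_empty inf_commute order_refl)
    then obtain z where "z \<in> \<Omega>" "z \<in> ball x0 r" "\<psi> z > 0" by auto
    then show False using assms(3) by (metis (mono_tags, lifting) IntI mem_Collect_eq less_asym)
  qed
qed

text \<open>The open ball about x through y lies in \<Omega>, so \<psi> cannot increase along a
  direction pointing into this ball. Hence the gradient \<open>N\<close> lies in the polar of a half
  space, which is the Lagrange condition.\<close>

lemma nearest_point_Lagrange:
  fixes \<psi> :: "'a::euclidean_space \<Rightarrow> real"
  assumes \<Omega>: "open \<Omega>" and "x \<in> \<Omega>" and y: "y \<in> frontier \<Omega>" "y \<in> ball x0 r"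
    and near: "dist x y = infdist x (frontier \<Omega>)"
    and psi: "(\<psi> has_derivative (\<lambda>h. N \<bullet> h)) (at y)" "\<psi> y = 0"
    and eq: "\<Omega> \<inter> ball x0 r = {x \<in> ball x0 r. \<psi> x < 0}" and "N \<noteq> 0"
  shows "x = y - (dist x y / norm N) *\<^sub>R N"
proof -
  define a where "a = x - y"
  have "y \<notin> \<Omega>" using y(1) \<Omega> by (simp add: frontier_def interior_open)
  then have a0: "a \<noteq> 0" using \<open>x \<in> \<Omega>\<close> by (auto simp: a_def)
  have ballsub: "ball x (dist x y) \<subseteq> \<Omega>"
  proof (rule ccontr)
    assume n: "\<not> ?thesis"
    have "dist x y > 0" using a0 by (simp add: a_def)
    then have "x \<in> ball x (dist x y)" by simp
    with \<open>x \<in> \<Omega>\<close> have "ball x (dist x y) \<inter> \<Omega> \<noteq> {}" by blast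
    moreover have "ball x (dist x y) - \<Omega> \<noteq> {}" using n by auto
    ultimately have "ball x (dist x y) \<inter> frontier \<Omega> \<noteq> {}"
      using connected_Int_frontier[OF connected_ball] by blast
    then obtain z where "z \<in> frontier \<Omega>" "dist x z < dist x y" by auto
    then show False using infdist_le[of z "frontier \<Omega>" x] near by simp
  qed
  have "N \<bullet> h \<le> 0" if h: "0 < h \<bullet> a" for h
  proof (rule ccontr)
    assume c: "\<not> N \<bullet> h \<le> 0"
    have "((\<lambda>t. y + t *\<^sub>R h) has_derivative (\<lambda>t. t *\<^sub>R h)) (at 0)" by (auto intro!: derivative_eq_intros)
    moreover have "(\<psi> has_derivative (\<lambda>h. N \<bullet> h)) (at (y + 0 *\<^sub>R h))" using psi(1) by simp
    ultimately have "((\<lambda>t. \<psi> (y + t *\<^sub>R h)) has_derivative (\<lambda>t. N \<bullet> (t *\<^sub>R h))) (at 0)"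
      by (rule has_derivative_compose)
    then have "((\<lambda>t. \<psi> (y + t *\<^sub>R h)) has_real_derivative (N \<bullet> h)) (at 0)"
      unfolding has_field_derivative_def by (rule has_derivative_eq_rhs) (auto simp: fun_eq_iff)
    from DERIV_pos_inc_right[OF this] c psi(2)
    obtain d where d: "d > 0" "\<And>t. 0 < t \<Longrightarrow> t < d \<Longrightarrow> 0 < \<psi> (y + t *\<^sub>R h)" by auto
    have h0: "h \<noteq> 0" using h by auto
    define e where "e = r - dist x0 y"
    have e: "0 < e" using y(2) by (simp add: e_def)
    \<comment> \<open>The three bounds keep \<psi> positive at the new point, keep the point in the
      chart, and bring it closer to x than y is.\<close>
    define t where "t = Min {d / 2, e / (2 * norm h), (h \<bullet> a) / (h \<bullet> h)}"
    have hh: "0 < h \<bullet> h" using h0 by simp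
    have t: "0 < t" "t \<le> d/2" "t \<le> e / (2 * norm h)" "t \<le> (h \<bullet> a) / (h \<bullet> h)"
    proof -
      show "0 < t" unfolding t_def using d(1) e h0 h hh by simp
    qed (simp_all only: t_def, (rule Min_le; simp)+)
    let ?z = "y + t *\<^sub>R h"
    have "norm (t *\<^sub>R h) < e" using t(1,3) h0 e by (simp add: field_simps)
    moreover have "dist x0 ?z \<le> dist x0 y + norm (t *\<^sub>R h)" by (metis dist_triangle dist_norm add_diff_cancel_left' norm_minus_commute)
    ultimately have zr: "?z \<in> ball x0 r" by (simp add: e_def)
    have "(norm (a - t *\<^sub>R h))\<^sup>2 = (norm a)\<^sup>2 - t * (2 * (h \<bullet> a) - t * (h \<bullet> h))"
      by (simp add: power2_norm_eq_inner inner_diff_left inner_diff_right inner_commute algebra_simps)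
    moreover have "t * (h \<bullet> h) \<le> h \<bullet> a" using t(4) hh by (simp add: field_simps)
    then have "0 < t * (2 * (h \<bullet> a) - t * (h \<bullet> h))" using t(1) h by (intro mult_pos_pos) auto
    ultimately have "(norm (a - t *\<^sub>R h))\<^sup>2 < (norm a)\<^sup>2" by linarith
    then have "norm (a - t *\<^sub>R h) < norm a" by (rule power2_less_imp_less) simp
    then have "?z \<in> ball x (dist x y)" by (simp add: a_def dist_norm algebra_simps)
    then have "?z \<in> \<Omega>" using ballsub by blast
    then have "\<psi> ?z < 0" using eq zr by blast
    moreover have "0 < \<psi> ?z" using d(1) t by (intro d(2)) auto
    ultimately show False by simp
  qed
  from half_space_polar[OF a0 this] obtain c where c: "0 \<le> c" "N = - c *\<^sub>R a" by blast
  have "c \<noteq> 0" using c(2) \<open>N \<noteq> 0\<close> by auto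
  then have "(dist x y / norm N) *\<^sub>R N = - a"
    using c a0 by (simp add: a_def dist_norm)
  then show ?thesis by (simp add: a_def)
qed

lemma C1_on_components:
  fixes D :: "'a::euclidean_space \<Rightarrow> 'b::euclidean_space"
  assumes "\<And>i. i \<in> Basis \<Longrightarrow> \<exists>Hi. C1_fun S (\<lambda>x. D x \<bullet> i) Hi"
  shows "\<exists>D'. C1_on S D D'"
proof -
  obtain H where H: "\<And>i. i \<in> Basis \<Longrightarrow> C1_fun S (\<lambda>x. D x \<bullet> i) (H i)" using assms by metis
  have "C1_on S D (\<lambda>x h. \<Sum>i\<in>Basis. (H i x \<bullet> h) *\<^sub>R i)"
    unfolding C1_on_def
  proof (intro conjI ballI allI)
    fix x assume x: "x \<in> S"
    have "((\<lambda>x. \<Sum>i\<in>Basis. (D x \<bullet> i) *\<^sub>R i) has_derivative (\<lambda>h. \<Sum>i\<in>Basis. (H i x \<bullet> h) *\<^sub>R i)) (at x)"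
      using H x by (intro has_derivative_sum has_derivative_scaleR_left) (auto simp: C1_fun_def)
    then show "(D has_derivative (\<lambda>h. \<Sum>i\<in>Basis. (H i x \<bullet> h) *\<^sub>R i)) (at x)"
      by (simp add: euclidean_representation)
  next
    fix h show "continuous_on S (\<lambda>x. \<Sum>i\<in>Basis. (H i x \<bullet> h) *\<^sub>R i)"
      using H by (intro continuous_intros) (auto simp: C1_fun_def)
  qed
  then show ?thesis by blast
qed

lemma C1_on_normalize:
  fixes f :: "'a::euclidean_space \<Rightarrow> 'b::euclidean_space"
  assumes f: "C1_on S f f'" and nz: "\<And>x. x \<in> S \<Longrightarrow> f x \<noteq> 0"
  shows "C1_on S (\<lambda>x. (1 / norm (f x)) *\<^sub>R f x)
    (\<lambda>x h. (1 / norm (f x)) *\<^sub>R f' x h - ((f x \<bullet> f' x h) / norm (f x) ^ 3) *\<^sub>R f x)"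
  unfolding C1_on_def
proof (intro conjI ballI allI)
  fix x assume x: "x \<in> S"
  note d = C1_on_derivative[OF f x]
  have n: "((\<lambda>x. norm (f x)) has_derivative (\<lambda>h. (f x \<bullet> f' x h) / norm (f x))) (at x)"
    using has_derivative_compose[OF d has_derivative_norm[OF nz[OF x]]]
    by (simp add: sgn_div_norm divide_inverse mult.commute inner_commute)
  show "((\<lambda>x. (1 / norm (f x)) *\<^sub>R f x) has_derivative
     (\<lambda>h. (1 / norm (f x)) *\<^sub>R f' x h - ((f x \<bullet> f' x h) / norm (f x) ^ 3) *\<^sub>R f x)) (at x)"
    by (rule has_derivative_eq_rhs[OF has_derivative_scaleR[OF has_derivative_divide'[OF has_derivative_const n] d]])
      (use nz[OF x] in \<open>auto simp: fun_eq_iff power3_eq_cube\<close>)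
next
  fix h
  show "continuous_on S (\<lambda>x. (1 / norm (f x)) *\<^sub>R f' x h - ((f x \<bullet> f' x h) / norm (f x) ^ 3) *\<^sub>R f x)"
    using nz by (intro continuous_intros C1_on_continuous[OF f] C1_on_continuous_derivative[OF f]) auto
qed

lemma C1_on_uminus: "C1_on S f f' \<Longrightarrow> C1_on S (\<lambda>x. - f x) (\<lambda>x h. - f' x h)"
  unfolding C1_on_def by (auto intro!: has_derivative_minus continuous_intros)

text \<open>Near a boundary point the pair (nearest boundary point \<open>y\<close>, multiplier \<open>s\<close>) solves
  \<open>y - s D\<psi>(y) = x, \<psi>(y) = 0\<close>, and the inverse function theorem applies to this system.\<close>

lemma distance_C2_near_boundary_point:
  fixes \<Omega> :: "'a::euclidean_space set"
  assumes \<Omega>: "open \<Omega>" and C2: "C2_boundary \<Omega>" and x0: "x0 \<in> frontier \<Omega>"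
  shows "\<exists>\<rho>>0. \<exists>n n'. C1_on (ball x0 \<rho>) n n' \<and> (\<forall>x\<in>ball x0 \<rho>. norm (n x) = 1) \<and>
    (\<forall>x\<in>\<Omega> \<inter> ball x0 \<rho>. ((\<lambda>x. infdist x (frontier \<Omega>)) has_derivative (\<lambda>h. n x \<bullet> h)) (at x))"
proof -
  from bspec[OF C2[unfolded C2_boundary_def] x0] obtain r \<psi> N where r: "r > 0"
    and *: "C1_fun (ball x0 r) \<psi> N \<and> (\<forall>i\<in>Basis. \<exists>Hi. C1_fun (ball x0 r) (\<lambda>x. N x \<bullet> i) Hi) \<and>
      (\<forall>x\<in>ball x0 r. N x \<noteq> 0) \<and> \<Omega> \<inter> ball x0 r = {x \<in> ball x0 r. \<psi> x < 0}"
    by (elim exE conjE) (rule that; (intro conjI)?; assumption)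
  have psi: "C1_fun (ball x0 r) \<psi> N"
    and H: "\<And>i. i \<in> Basis \<Longrightarrow> \<exists>Hi. C1_fun (ball x0 r) (\<lambda>x. N x \<bullet> i) Hi"
    and N0: "\<And>x. x \<in> ball x0 r \<Longrightarrow> N x \<noteq> 0"
    and eq: "\<Omega> \<inter> ball x0 r = {x \<in> ball x0 r. \<psi> x < 0}"
    using * by simp_all
  obtain N' where N': "C1_on (ball x0 r) N N'" using C1_on_components[OF H] by blast
  have dpsi: "(\<psi> has_derivative (\<lambda>h. N x \<bullet> h)) (at x)" if "x \<in> ball x0 r" for x
    using psi that by (simp add: C1_fun_def)
  have cpsi: "continuous_on (ball x0 r) \<psi>"
    by (meson dpsi continuous_at_imp_continuous_on has_derivative_continuous)
  have cN: "continuous_on (ball x0 r) N" by (rule C1_on_continuous[OF N'])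
  have level: "\<psi> y = 0" if "y \<in> frontier \<Omega>" "y \<in> ball x0 r" for y
    using frontier_level_set[OF \<Omega> cpsi eq that] .
  have x0r: "x0 \<in> ball x0 r" using r by simp
  define U where "U = ball x0 r \<times> (UNIV :: real set)"
  define E where "E p = (fst p - snd p *\<^sub>R N (fst p), \<psi> (fst p))" for p :: "'a \<times> real"
  define E' where "E' p h = (fst h - (snd p *\<^sub>R N' (fst p) (fst h) + snd h *\<^sub>R N (fst p)), N (fst p) \<bullet> fst h)" for p h :: "'a \<times> real"
  have E: "C1_on U E E'"
    unfolding C1_on_def
  proof (intro conjI ballI allI)
    fix p assume "p \<in> U"
    then have p: "fst p \<in> ball x0 r" by (auto simp: U_def)
    have f: "(fst has_derivative fst) (at p)" "(snd has_derivative snd) (at p)"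
      by (auto intro!: derivative_eq_intros)
    show "(E has_derivative E' p) (at p)"
      unfolding E_def[abs_def] E'_def
      by (intro has_derivative_Pair has_derivative_diff has_derivative_scaleR f
          has_derivative_compose[OF f(1) C1_on_derivative[OF N' p]] has_derivative_compose[OF f(1) dpsi[OF p]])
  next
    fix h :: "'a \<times> real"
    have "continuous_on U (\<lambda>p. N (fst p))" "continuous_on U (\<lambda>p. N' (fst p) (fst h))"
      by (rule continuous_on_compose2[OF cN] continuous_on_compose2[OF C1_on_continuous_derivative[OF N']];
          auto simp: U_def intro!: continuous_intros)+
    then show "continuous_on U (\<lambda>p. E' p h)" unfolding E'_def by (intro continuous_intros)
  qed
  \<comment> \<open>At s = 0 the term with N' drops out and the linearised system reads h = t N, N .
    h = 0; its injectivity is just N x0 being nonzero.\<close>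
  have inj: "h = 0" if "E' (x0, 0) h = 0" for h
  proof -
    have "fst h = snd h *\<^sub>R N x0" "N x0 \<bullet> fst h = 0" using that by (auto simp: E'_def prod_eq_iff)
    then have "snd h * (N x0 \<bullet> N x0) = 0" by simp
    then have "snd h = 0" using N0[OF x0r] by simp
    with \<open>fst h = _\<close> show ?thesis by (simp add: prod_eq_iff)
  qed
  have "open U" unfolding U_def by (intro open_Times) auto
  moreover have "(x0, 0) \<in> U" using x0r by (simp add: U_def)
  ultimately obtain U' V g g' where U': "open U'" "U' \<subseteq> U" "(x0, 0) \<in> U'" and V: "open V" "E (x0, 0) \<in> V"
    and hom: "homeomorphism U' V E g" and g: "C1_on V g g'"
    using C1_inverse_function[OF _ E _ inj] by metis
  have "E (x0, 0) = (x0, 0)" using level[OF x0 x0r] by (simp add: E_def)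
  then have V0: "(x0, 0) \<in> V" using V(2) by simp
  obtain A B where AB: "open A" "open B" "x0 \<in> A" "0 \<in> B" "A \<times> B \<subseteq> V"
    using open_prod_elim[OF V(1) V0] by (metis mem_Sigma_iff)
  obtain A' B' where AB': "open A'" "open B'" "x0 \<in> A'" "(0::real) \<in> B'" "A' \<times> B' \<subseteq> U'"
    using open_prod_elim[OF U'(1,3)] by (metis mem_Sigma_iff)
  obtain r1 where r1: "r1 > 0" "ball x0 r1 \<subseteq> A" using AB openE by blast
  obtain r2 where r2: "r2 > 0" "ball x0 r2 \<subseteq> A'" using AB' openE by blast
  obtain r3 where r3: "r3 > 0" "ball 0 r3 \<subseteq> B'" using AB' openE by blast
  define c where "c = norm (N x0) / 2"
  have c: "c > 0" using N0[OF x0r] by (simp add: c_def)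
  have "continuous (at x0) N" using cN x0r by (simp add: continuous_on_eq_continuous_at)
  then obtain r4 where r4: "r4 > 0" "\<And>y. dist y x0 < r4 \<Longrightarrow> dist (N y) (N x0) < c"
    using c unfolding continuous_at_eps_delta by blast
  have Nc: "norm (N y) > c" if "dist y x0 < r4" for y
    using r4(2)[OF that] norm_triangle_sub[of "N x0" "N y"] by (simp add: c_def dist_norm norm_minus_commute)
  \<comment> \<open>A nearest boundary point of z in \<open>ball x0 \<rho>\<close> has distance less
    than 2 \<rho> from x0, hence the halves. The bound \<open>r3 * c\<close> pushes the multiplier,
    the distance divided by the norm of N, below \<open>r3\<close>.\<close>
  define \<rho> where "\<rho> = Min {r1, r2/2, r4/2, r/2, r3 * c}"
  have \<rho>: "\<rho> > 0" "\<rho> \<le> r1" "2 * \<rho> \<le> r2" "2 * \<rho> \<le> r4" "2 * \<rho> \<le> r" "\<rho> \<le> r3 * c"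
    using r r1 r2 r3 r4 c by (auto simp: \<rho>_def)
  define W where "W = ball x0 \<rho>"
  have emb: "C1_on W (\<lambda>x. (x, 0::real)) (\<lambda>x h. (h, 0))"
    unfolding C1_on_def by (auto intro!: derivative_eq_intros has_derivative_Pair continuous_intros)
  have inV: "(x, 0) \<in> V" if "x \<in> W" for x
  proof -
    have "x \<in> ball x0 r1" using that \<rho> by (simp add: W_def)
    then show ?thesis using r1 AB by blast
  qed
  have G: "C1_on W (\<lambda>x. g (x, 0)) (\<lambda>x h. g' (x, 0) (h, 0))"
    by (rule C1_on_compose[OF emb g]) (use inV in auto)
  define Y where "Y x = fst (g (x, 0))" for x
  define Y' where "Y' x h = fst (g' (x, 0) (h, 0))" for x h
  have Y: "C1_on W Y Y'"
    using G unfolding C1_on_def Y_def[abs_def] Y'_def[abs_def]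
    by (auto intro!: has_derivative_fst continuous_on_fst)
  have gU: "g (x, 0) \<in> U'" "E (g (x, 0)) = (x, 0)" if "x \<in> W" for x
    using hom inV[OF that] by (auto simp: homeomorphism_def)
  have Yr: "Y x \<in> ball x0 r" if "x \<in> W" for x
    using gU(1)[OF that] U'(2) by (auto simp: U_def Y_def)
  have psiY: "\<psi> (Y x) = 0" if "x \<in> W" for x
    using gU(2)[OF that] by (simp add: E_def Y_def)
  define n where "n x = - ((1 / norm (N (Y x))) *\<^sub>R N (Y x))" for x
  have NY: "C1_on W (\<lambda>x. N (Y x)) (\<lambda>x h. N' (Y x) (Y' x h))"
    by (rule C1_on_compose[OF Y N']) (use Yr in auto)
  have NYnz: "N (Y x) \<noteq> 0" if "x \<in> W" for x using N0[OF Yr[OF that]] .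
  have "\<exists>n'. C1_on W n n'"
    unfolding n_def[abs_def] using C1_on_uminus[OF C1_on_normalize[OF NY NYnz]] by blast
  moreover have "norm (n x) = 1" if "x \<in> W" for x using NYnz[OF that] by (simp add: n_def)
  moreover have "((\<lambda>x. infdist x (frontier \<Omega>)) has_derivative (\<lambda>h. n x \<bullet> h)) (at x)" if x: "x \<in> \<Omega> \<inter> W" for x
  proof -
    \<comment> \<open>The nearest point and its multiplier solve the system and lie in
      \<open>U'\<close>, where \<open>E\<close> is injective. So they are the value of the local
      inverse, and \<open>Y z\<close> is the nearest point.\<close>
    have main: "infdist z (frontier \<Omega>) = norm (z - Y z) \<and> norm (z - Y z) > 0 \<and>
        z - Y z = norm (z - Y z) *\<^sub>R n z" if z: "z \<in> \<Omega> \<inter> W" for z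
    proof -
      have "closed (frontier \<Omega>)" "frontier \<Omega> \<noteq> {}" using x0 by auto
      then obtain y where y: "y \<in> frontier \<Omega>" "infdist z (frontier \<Omega>) = dist z y"
        using infdist_attains_inf by blast
      have "dist z y \<le> dist z x0" using infdist_le[OF x0, of z] y(2) by simp
      moreover have "dist z x0 < \<rho>" using z by (simp add: W_def dist_commute)
      ultimately have d: "dist z y < \<rho>" "dist y x0 < 2 * \<rho>"
        using dist_triangle[of y x0 z] by (auto simp: dist_commute)
      then have yr: "y \<in> ball x0 r" using \<rho> by (simp add: dist_commute)
      have "y \<notin> \<Omega>" using y(1) \<Omega> by (simp add: frontier_def interior_open)
      then have "dist z y > 0" using z by auto
      define s where "s = dist z y / norm (N y)"
      have Ny: "norm (N y) > c" using d \<rho> by (intro Nc) auto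
      have zy: "z = y - s *\<^sub>R N y"
        unfolding s_def using z y
        by (intro nearest_point_Lagrange[OF \<Omega> _ y(1) yr _ dpsi[OF yr] level[OF y(1) yr] eq N0[OF yr]]) auto
      have "s < r3"
      proof -
        have "dist z y < r3 * c" using d \<rho> by simp
        also have "\<dots> < r3 * norm (N y)" using Ny r3 by simp
        finally show ?thesis using Ny c r3 by (auto simp: s_def divide_less_eq)
      qed
      moreover have "s > 0" unfolding s_def using \<open>dist z y > 0\<close> Ny c by (intro divide_pos_pos) linarith+
      ultimately have "s \<in> B'" using r3(2) by (auto simp: subset_iff)
      moreover have "y \<in> A'" using d \<rho> r2(2) by (auto simp: subset_iff dist_commute)
      ultimately have "(y, s) \<in> U'" using AB' by auto
      moreover have "E (y, s) = (z, 0)" using zy level[OF y(1) yr] by (simp add: E_def)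
      ultimately have "g (z, 0) = (y, s)" using hom by (metis homeomorphism_def)
      then have Yz: "Y z = y" by (simp add: Y_def)
      have "z - y = norm (z - y) *\<^sub>R n z"
      proof -
        have "z - y = - (s *\<^sub>R N y)" by (subst zy) simp
        then show ?thesis using Yz by (simp add: n_def s_def dist_norm)
      qed
      then show ?thesis using Yz y(2) \<open>dist z y > 0\<close> by (simp add: dist_norm)
    qed
    let ?p = "norm (x - Y x)"
    have p: "?p > 0" "x - Y x = ?p *\<^sub>R n x" using main[OF x] by auto
    have xW: "x \<in> W" using x by simp
    \<comment> \<open>\<open>Y\<close> moves inside a level set of \<psi>, so its derivative is
      tangential and drops out of the derivative of the distance. The gradient is then
      \<open>n\<close> itself, which is C1: this is where one order of smoothness is gained.\<close>
    have orth: "N (Y x) \<bullet> Y' x h = 0" for h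
    proof -
      have "((\<lambda>x. \<psi> (Y x)) has_derivative (\<lambda>h. N (Y x) \<bullet> Y' x h)) (at x)"
        by (rule has_derivative_compose[OF C1_on_derivative[OF Y xW] dpsi[OF Yr[OF xW]]])
      moreover have "((\<lambda>x. \<psi> (Y x)) has_derivative (\<lambda>h. 0)) (at x)"
        by (rule has_derivative_transform_within_open[of "\<lambda>x. 0" _ _ _ W]) (use psiY xW in \<open>auto simp: W_def\<close>)
      ultimately show ?thesis by (metis has_derivative_unique)
    qed
    have d1: "((\<lambda>x. x - Y x) has_derivative (\<lambda>h. h - Y' x h)) (at x)"
      by (intro has_derivative_diff has_derivative_ident C1_on_derivative[OF Y xW])
    have "x - Y x \<noteq> 0" using p by auto
    from has_derivative_compose[OF d1 has_derivative_norm[OF this]]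
    have d2: "((\<lambda>x. norm (x - Y x)) has_derivative (\<lambda>h. (h - Y' x h) \<bullet> sgn (x - Y x))) (at x)" .
    have "sgn (x - Y x) = sgn (?p *\<^sub>R n x)" by (rule arg_cong[OF p(2)])
    also have "\<dots> = n x"
      using p(1) \<open>\<And>x. x \<in> W \<Longrightarrow> norm (n x) = 1\<close>[OF xW] by (simp add: sgn_scaleR sgn_div_norm)
    finally have sgn: "sgn (x - Y x) = n x" .
    have "(h - Y' x h) \<bullet> sgn (x - Y x) = n x \<bullet> h" for h
      using orth[of h] by (simp add: sgn n_def inner_diff_left inner_diff_right inner_commute)
    with d2 have "((\<lambda>x. norm (x - Y x)) has_derivative (\<lambda>h. n x \<bullet> h)) (at x)" by simp
    then show ?thesis
      by (rule has_derivative_transform_within_open[of _ _ _ _ "\<Omega> \<inter> W"])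
        (use main x \<Omega> in \<open>auto simp: W_def\<close>)
  qed
  ultimately show ?thesis using \<rho>(1) unfolding W_def by blast
qed

text \<open>A Lebesgue number for a finite cover of the compact boundary: a whole ball about each
  collar point fits into one convex chart ball, as the mean value estimate for the normal field
  requires.\<close>

lemma infdist_collar_cover:
  fixes \<Omega> :: "'a::euclidean_space set"
  assumes \<Omega>: "open \<Omega>" "bounded \<Omega>" and \<rho>: "\<And>x. x \<in> frontier \<Omega> \<Longrightarrow> 0 < \<rho> x"
  obtains T a where "finite T" "T \<subseteq> frontier \<Omega>" "0 < a"
    "\<And>x. x \<in> \<Omega> \<Longrightarrow> infdist x (frontier \<Omega>) < a \<Longrightarrow> \<exists>t\<in>T. ball x a \<subseteq> cball t (3 * \<rho> t / 4)"
proof -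
  let ?F = "frontier \<Omega>"
  have "compact ?F" using \<Omega> by (simp add: compact_frontier_bounded)
  then obtain T where T: "T \<subseteq> ?F" "finite T" "?F \<subseteq> (\<Union>t\<in>T. ball t (\<rho> t / 4))"
    by (rule compactE_image[of ?F ?F "\<lambda>t. ball t (\<rho> t / 4)"]) (use \<rho> in auto)
  \<comment> \<open>The distance from t to the nearest boundary point is below \<rho>/4, from there
    to x and from x to any point of the ball below a; together less than 3 \<rho>/4. Inserting 1
    covers an empty \<open>T\<close>.\<close>
  define a where "a = Min (insert 1 ((\<lambda>t. \<rho> t / 4) ` T))"
  have a: "0 < a" "\<And>t. t \<in> T \<Longrightarrow> a \<le> \<rho> t / 4"
  proof -
    show "0 < a" unfolding a_def using T \<rho> by (auto simp: subset_iff)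
    show "a \<le> \<rho> t / 4" if "t \<in> T" for t unfolding a_def using T(2) that by (intro Min_le) auto
  qed
  have "\<exists>t\<in>T. ball x a \<subseteq> cball t (3 * \<rho> t / 4)" if x: "x \<in> \<Omega>" "infdist x ?F < a" for x
  proof -
    have "?F \<noteq> {}" using frontier_eq_empty[of \<Omega>] x \<Omega>(2) not_bounded_UNIV by auto
    then obtain y where y: "y \<in> ?F" "infdist x ?F = dist x y"
      using infdist_attains_inf[of ?F x] by auto
    obtain t where t: "t \<in> T" "dist t y < \<rho> t / 4" using T(3) y(1) by auto
    have "dist t z \<le> 3 * \<rho> t / 4" if "dist x z < a" for z
      using that t x y a(2)[OF t(1)] dist_triangle[of t z y] dist_triangle[of y z x] by (simp add: dist_commute)
    then show ?thesis using t(1) by (auto simp: subset_iff)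
  qed
  then show thesis using that[OF T(2,1) a(1)] by blast
qed

text \<open>The local normals agree on overlaps, each being the gradient of the distance. Close
  points are compared by the mean value theorem inside one chart ball, distant points by the
  boundedness of \<nu>.\<close>

lemma distance_C2_collar:
  fixes \<Omega> :: "'a::euclidean_space set"
  assumes \<Omega>: "open \<Omega>" "bounded \<Omega>" and C2: "C2_boundary \<Omega>"
  defines "\<delta> \<equiv> \<lambda>x. infdist x (frontier \<Omega>)"
  obtains a C \<nu> \<nu>' where "0 < a" "0 \<le> C" "C1_on {x \<in> \<Omega>. \<delta> x < a} \<nu> \<nu>'"
    "\<And>x. x \<in> \<Omega> \<Longrightarrow> \<delta> x < a \<Longrightarrow> norm (\<nu> x) = 1"
    "\<And>x. x \<in> \<Omega> \<Longrightarrow> \<delta> x < a \<Longrightarrow> (\<delta> has_derivative (\<lambda>h. \<nu> x \<bullet> h)) (at x)"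
    "\<And>x h. x \<in> \<Omega> \<Longrightarrow> \<delta> x < a \<Longrightarrow> norm (\<nu>' x h) \<le> C * norm h"
    "\<And>x y. x \<in> \<Omega> \<Longrightarrow> \<delta> x < a \<Longrightarrow> y \<in> \<Omega> \<Longrightarrow> \<delta> y < a \<Longrightarrow> norm (\<nu> x - \<nu> y) \<le> C * dist x y"
proof -
  let ?F = "frontier \<Omega>"
  define P where "P x0 \<rho> n n' \<longleftrightarrow> \<rho> > 0 \<and> C1_on (ball x0 \<rho>) n n' \<and> (\<forall>x\<in>ball x0 \<rho>. norm (n x) = 1) \<and>
    (\<forall>x\<in>\<Omega> \<inter> ball x0 \<rho>. (\<delta> has_derivative (\<lambda>h. n x \<bullet> h)) (at x))" for x0 \<rho> n and n' :: "'a \<Rightarrow> 'a \<Rightarrow> 'a"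
  have "\<exists>\<rho> n n'. P x0 \<rho> n n'" if "x0 \<in> ?F" for x0
    using distance_C2_near_boundary_point[OF \<Omega>(1) C2 that] unfolding \<delta>_def P_def by blast
  then obtain \<rho> n n' where "\<And>x0. x0 \<in> ?F \<Longrightarrow> P x0 (\<rho> x0) (n x0) (n' x0)"
    by metis
  note * = this[unfolded P_def]
  have \<rho>: "\<And>t. t \<in> ?F \<Longrightarrow> \<rho> t > 0"
    and n: "\<And>t. t \<in> ?F \<Longrightarrow> C1_on (ball t (\<rho> t)) (n t) (n' t)"
    and n1: "\<And>t x. t \<in> ?F \<Longrightarrow> x \<in> ball t (\<rho> t) \<Longrightarrow> norm (n t x) = 1"
    and d: "\<And>t x. t \<in> ?F \<Longrightarrow> x \<in> \<Omega> \<Longrightarrow> x \<in> ball t (\<rho> t) \<Longrightarrow> (\<delta> has_derivative (\<lambda>h. n t x \<bullet> h)) (at x)"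
    using * by blast+
  obtain T a where T: "finite T" "T \<subseteq> ?F" and a: "0 < a"
    and cov: "\<And>x. x \<in> \<Omega> \<Longrightarrow> infdist x ?F < a \<Longrightarrow> \<exists>t\<in>T. ball x a \<subseteq> cball t (3 * \<rho> t / 4)"
    by (rule infdist_collar_cover[OF \<Omega>, of \<rho>]) (erule \<rho>, rule that)
  let ?B = "\<lambda>t. cball t (3 * \<rho> t / 4)"
  have Bsub: "?B t \<subseteq> ball t (\<rho> t)" if "t \<in> T" for t
    using \<rho>[of t] T that by (auto simp: subset_iff)
  have "\<exists>C\<ge>0. \<forall>x\<in>?B t. \<forall>h. norm (n' t x h) \<le> C * norm h" if "t \<in> T" for t
    by (rule C1_on_bounded_derivative[OF n compact_cball Bsub[OF that]]) (use T that in auto)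
  then obtain c where c: "\<And>t. t \<in> T \<Longrightarrow> 0 \<le> c t" "\<And>t x h. t \<in> T \<Longrightarrow> x \<in> ?B t \<Longrightarrow> norm (n' t x h) \<le> c t * norm h"
    by metis
  \<comment> \<open>The sum dominates every local constant; 2 / a treats pairs at distance at least
    a, since unit vectors differ by at most 2.\<close>
  define C where "C = sum c T + 2 / a"
  have cC: "c t \<le> C" if "t \<in> T" for t
    using member_le_sum[OF that, of c] c(1) T(1) a by (auto simp: C_def intro: add_increasing2)
  have C: "0 \<le> C" "2 / a \<le> C" using c(1) a by (auto simp: C_def sum_nonneg)
  \<comment> \<open>Defined from the distance alone, so that no choice of chart enters.\<close>
  define \<nu> where "\<nu> x = (\<Sum>b\<in>Basis. frechet_derivative \<delta> (at x) b *\<^sub>R b)" for x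
  define \<nu>' where "\<nu>' x = frechet_derivative \<nu> (at x)" for x
  define S where "S = {x \<in> \<Omega>. \<delta> x < a}"
  have nu: "\<nu> x = n t x" if "t \<in> T" "x \<in> \<Omega>" "x \<in> ball t (\<rho> t)" for t x
  proof -
    have "(\<lambda>h. n t x \<bullet> h) = frechet_derivative \<delta> (at x)"
      using d that T by (intro frechet_derivative_at) auto
    then have "\<nu> x = (\<Sum>b\<in>Basis. (n t x \<bullet> b) *\<^sub>R b)" unfolding \<nu>_def by metis
    then show ?thesis by (simp add: euclidean_representation)
  qed
  have dnu: "(\<nu> has_derivative n' t x) (at x)" if "t \<in> T" "x \<in> \<Omega>" "x \<in> ball t (\<rho> t)" for t x
    by (rule has_derivative_transform_within_open[OF C1_on_derivative[OF n that(3)], of "\<Omega> \<inter> ball t (\<rho> t)"])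
      (use that T nu \<Omega> in auto)
  have nu': "\<nu>' x = n' t x" if "t \<in> T" "x \<in> \<Omega>" "x \<in> ball t (\<rho> t)" for t x
    unfolding \<nu>'_def using frechet_derivative_at[OF dnu[OF that]] by simp
  have pick: "\<exists>t\<in>T. ball x a \<subseteq> ?B t \<and> x \<in> ?B t \<and> x \<in> ball t (\<rho> t)" if xS: "x \<in> S" for x
  proof -
    obtain t where t: "t \<in> T" "ball x a \<subseteq> ?B t" using cov[of x] xS by (auto simp: S_def \<delta>_def)
    moreover have "x \<in> ball x a" using a by simp
    ultimately have "x \<in> ?B t" by blast
    then show ?thesis using t Bsub by blast
  qed
  have S: "x \<in> \<Omega>" if "x \<in> S" for x using that by (simp add: S_def)
  have "continuous_on UNIV \<delta>" unfolding \<delta>_def by (intro continuous_intros)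
  have opS: "open S"
  proof -
    have "S = \<Omega> \<inter> \<delta> -` {..<a}" by (auto simp: S_def)
    then show ?thesis using \<Omega>(1) \<open>continuous_on UNIV \<delta>\<close> by (simp add: open_Int open_vimage)
  qed
  have "C1_on S \<nu> \<nu>'"
    unfolding C1_on_def
  proof (intro conjI ballI allI)
    fix x assume x: "x \<in> S"
    obtain t where t: "t \<in> T" "x \<in> ball t (\<rho> t)" using pick[OF x] by blast
    then show "(\<nu> has_derivative \<nu>' x) (at x)" using dnu nu' S[OF x] by metis
  next
    fix h
    show "continuous_on S (\<lambda>x. \<nu>' x h)"
    proof (rule continuous_at_imp_continuous_on, rule ballI)
      fix x assume x: "x \<in> S"
      obtain t where t: "t \<in> T" "x \<in> ball t (\<rho> t)" using pick[OF x] by blast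
      have tF: "t \<in> ?F" using t T by auto
      have "continuous_on (\<Omega> \<inter> ball t (\<rho> t)) (\<lambda>x. n' t x h)"
        using C1_on_continuous_derivative[OF n[OF tF], of h] continuous_on_subset by blast
      then have "continuous_on (\<Omega> \<inter> ball t (\<rho> t)) (\<lambda>x. \<nu>' x h)"
        by (rule continuous_on_eq) (use nu'[OF t(1)] in auto)
      moreover have "open (\<Omega> \<inter> ball t (\<rho> t))" "x \<in> \<Omega> \<inter> ball t (\<rho> t)" using \<Omega> t S[OF x] by auto
      ultimately show "isCont (\<lambda>x. \<nu>' x h) x" using continuous_on_eq_continuous_at by blast
    qed
  qed
  moreover have norm1: "norm (\<nu> x) = 1" if x: "x \<in> S" for x
  proof -
    obtain t where t: "t \<in> T" "x \<in> ball t (\<rho> t)" using pick[OF x] by blast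
    then have "t \<in> ?F" using T by auto
    from n1[OF this t(2)] show ?thesis using nu[OF t(1) S[OF x] t(2)] by simp
  qed
  moreover have "(\<delta> has_derivative (\<lambda>h. \<nu> x \<bullet> h)) (at x)" if x: "x \<in> S" for x
  proof -
    obtain t where t: "t \<in> T" "x \<in> ball t (\<rho> t)" using pick[OF x] by blast
    then have "t \<in> ?F" using T by auto
    from d[OF this S[OF x] t(2)] show ?thesis using nu[OF t(1) S[OF x] t(2)] by simp
  qed
  moreover have "norm (\<nu>' x h) \<le> C * norm h" if x: "x \<in> S" for x h
  proof -
    obtain t where t: "t \<in> T" "x \<in> ball t (\<rho> t)" "x \<in> ?B t" using pick[OF x] by blast
    then have "norm (\<nu>' x h) \<le> c t * norm h" using c(2) nu' S[OF x] by auto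
    also have "\<dots> \<le> C * norm h" using cC[OF t(1)] by (intro mult_right_mono) auto
    finally show ?thesis .
  qed
  moreover have "norm (\<nu> x - \<nu> y) \<le> C * dist x y" if x: "x \<in> S" and y: "y \<in> S" for x y
  proof (cases "dist x y < a")
    case True
    obtain t where t: "t \<in> T" "ball x a \<subseteq> ?B t" "x \<in> ?B t" using pick[OF x] by blast
    have yB: "y \<in> ?B t" using t(2) True by auto
    have tF: "t \<in> ?F" using t T by auto
    have "norm (n t x - n t y) \<le> c t * norm (x - y)"
    proof (rule differentiable_bound[OF convex_cball _ _ t(3) yB])
      fix z assume z: "z \<in> ?B t"
      then have "(n t has_derivative n' t z) (at z)"
        using C1_on_derivative[OF n[OF tF]] Bsub[OF t(1)] by blast
      then show "(n t has_derivative n' t z) (at z within ?B t)" by (rule has_derivative_at_withinI)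
      show "onorm (n' t z) \<le> c t" using c(2)[OF t(1) z] by (rule onorm_bound[OF c(1)[OF t(1)]])
    qed
    also have "\<dots> \<le> C * norm (x - y)" using cC[OF t(1)] by (intro mult_right_mono) auto
    finally show ?thesis
      using nu[OF t(1) S[OF x]] nu[OF t(1) S[OF y]] t(3) yB Bsub[OF t(1)] by (auto simp: dist_norm subset_iff)
  next
    case False
    have "norm (\<nu> x - \<nu> y) \<le> 2" using norm_triangle_ineq4[of "\<nu> x" "\<nu> y"] norm1[OF x] norm1[OF y] by simp
    also have "\<dots> = 2 / a * a" using a by simp
    also have "\<dots> \<le> C * dist x y" using False C a by (intro mult_mono) auto
    finally show ?thesis .
  qed
  ultimately show thesis using that[OF a C(1)] unfolding S_def by simp
qed

section \<open>Divergence of regularised fluxes\<close>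

lemma C1_on_Un:
  assumes "open S" "open T" "C1_on S f f'" "C1_on T f f'"
  shows "C1_on (S \<union> T) f f'"
  using assms by (auto simp: C1_on_def intro!: continuous_on_open_Un)

lemma C1_on_add: "C1_on S f f' \<Longrightarrow> C1_on S g g' \<Longrightarrow> C1_on S (\<lambda>x. f x + g x) (\<lambda>x h. f' x h + g' x h)"
  unfolding C1_on_def by (auto intro!: has_derivative_add continuous_on_add)

lemma C1_on_scaleR:
  fixes f :: "'a::euclidean_space \<Rightarrow> real" and g :: "'a \<Rightarrow> 'b::real_normed_vector"
  assumes "C1_on S f f'" "C1_on S g g'"
  shows "C1_on S (\<lambda>x. f x *\<^sub>R g x) (\<lambda>x h. f x *\<^sub>R g' x h + f' x h *\<^sub>R g x)"
  using assms C1_on_continuous[OF assms(1)] C1_on_continuous[OF assms(2)]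
  unfolding C1_on_def by (auto intro!: has_derivative_scaleR continuous_intros)

lemma C1_on_const: "C1_on S (\<lambda>x. c) (\<lambda>x h. 0)"
  unfolding C1_on_def by (auto intro!: continuous_intros)

lemma C1_on_affine: "C1_on S (\<lambda>x. e \<bullet> x + c) (\<lambda>x h. e \<bullet> h)"
  unfolding C1_on_def by (auto intro!: derivative_eq_intros continuous_intros)

lemma C1_on_real_compose:
  fixes f :: "'a::euclidean_space \<Rightarrow> real" and \<phi> :: "real \<Rightarrow> real"
  assumes f: "C1_on S f f'" and d: "\<And>x. x \<in> S \<Longrightarrow> (\<phi> has_real_derivative \<phi>' (f x)) (at (f x))"
    and c: "continuous_on (f ` S) \<phi>'"
  shows "C1_on S (\<lambda>x. \<phi> (f x)) (\<lambda>x h. \<phi>' (f x) * f' x h)"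
  unfolding C1_on_def
proof (intro conjI ballI allI)
  fix x assume x: "x \<in> S"
  have "(\<phi> has_derivative (*) (\<phi>' (f x))) (at (f x))" using d[OF x] by (simp add: has_field_derivative_def)
  from has_derivative_compose[OF C1_on_derivative[OF f x] this]
  show "((\<lambda>x. \<phi> (f x)) has_derivative (\<lambda>h. \<phi>' (f x) * f' x h)) (at x)" .
next
  fix h
  show "continuous_on S (\<lambda>x. \<phi>' (f x) * f' x h)"
    by (intro continuous_intros C1_on_continuous_derivative[OF f]
        continuous_on_compose2[OF c C1_on_continuous[OF f]]) auto
qed

lemma divergence_add: "divergence (\<lambda>h. f h + g h) = divergence f + divergence g"
  by (simp add: divergence_def inner_add_left sum.distrib)

lemma divergence_scaleR: "divergence (\<lambda>h. c *\<^sub>R f h) = c * divergence f"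
  by (simp add: divergence_def sum_distrib_left)

lemma divergence_rank_one:
  assumes "linear l"
  shows "divergence (\<lambda>h. l h *\<^sub>R w) = l w"
  using linear_Basis_expansion[OF assms, of w] by (simp add: divergence_def mult.commute)

lemma divergence_bound:
  fixes D :: "'a::euclidean_space \<Rightarrow> 'a" and C :: real
  assumes "\<And>h. norm (D h) \<le> C * norm h"
  shows "\<bar>divergence D\<bar> \<le> DIM('a) * C"
proof -
  have "\<bar>divergence D\<bar> \<le> (\<Sum>b\<in>Basis. \<bar>D b \<bullet> b\<bar>)" unfolding divergence_def by (rule sum_abs)
  also have "\<dots> \<le> (\<Sum>b\<in>(Basis::'a set). C)"
  proof (rule sum_mono)
    fix b :: 'a assume b: "b \<in> Basis"
    have "\<bar>D b \<bullet> b\<bar> \<le> norm (D b) * norm b" by (rule Cauchy_Schwarz_ineq2)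
    also have "\<dots> \<le> C" using assms[of b] b by simp
    finally show "\<bar>D b \<bullet> b\<bar> \<le> C" .
  qed
  finally show ?thesis by simp
qed

text \<open>For \<open>X = \<nabla>v\<close> and \<open>\<eta> = 0\<close> this is the \<open>r\<close>-Laplace flux of \<open>1 - exp(-v)\<close>.\<close>

definition reg_flux :: "real \<Rightarrow> real \<Rightarrow> real \<Rightarrow> 'a::euclidean_space \<Rightarrow> 'a" where
  "reg_flux r \<eta> v X = (exp (- (r - 1) * v) * (\<eta> + X \<bullet> X) powr ((r - 2) / 2)) *\<^sub>R X"

text \<open>With \<eta> > 0 the power is smooth also at zeros of X. As X is the gradient of v,
  differentiating the exponential produces -(r - 1) X . X, the one term that survives where X'
  vanishes.\<close>

lemma divergence_reg_flux:
  fixes X :: "'a::euclidean_space \<Rightarrow> 'a"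
  assumes X: "C1_on S X X'" and v: "C1_on S v (\<lambda>x h. X x \<bullet> h)" and \<eta>: "0 < \<eta>"
  obtains V' where "C1_on S (\<lambda>x. reg_flux r \<eta> (v x) (X x)) V'"
    "\<And>x. x \<in> S \<Longrightarrow> divergence (V' x) = exp (- (r - 1) * v x) * (\<eta> + X x \<bullet> X x) powr ((r - 2) / 2) *
      (divergence (X' x) + (r - 2) * (X x \<bullet> X' x (X x)) / (\<eta> + X x \<bullet> X x) - (r - 1) * (X x \<bullet> X x))"
proof -
  define n where "n x = \<eta> + X x \<bullet> X x" for x
  have n: "n x > 0" for x using \<eta> by (simp add: n_def add_pos_nonneg)
  have N: "C1_on S n (\<lambda>x h. 2 * (X x \<bullet> X' x h))"
    using X C1_on_continuous[OF X] unfolding C1_on_def n_def[abs_def]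
    by (auto intro!: derivative_eq_intros continuous_intros simp: inner_commute)
  have W: "C1_on S (\<lambda>x. n x powr ((r - 2) / 2)) (\<lambda>x h. ((r - 2) / 2 * n x powr ((r - 2) / 2 - 1)) * (2 * (X x \<bullet> X' x h)))"
    by (rule C1_on_real_compose[OF N, where \<phi>="\<lambda>t. t powr ((r - 2) / 2)" and \<phi>'="\<lambda>t. (r - 2) / 2 * t powr ((r - 2) / 2 - 1)"])
      (use n has_real_derivative_powr[OF n, of "(r - 2) / 2"] in \<open>auto intro!: continuous_intros simp: less_imp_neq[symmetric]\<close>)
  have E: "C1_on S (\<lambda>x. exp (- (r - 1) * v x)) (\<lambda>x h. (- (r - 1) * exp (- (r - 1) * v x)) * (X x \<bullet> h))"
    by (rule C1_on_real_compose[OF v, where \<phi>="\<lambda>t. exp (- (r - 1) * t)" and \<phi>'="\<lambda>t. - (r - 1) * exp (- (r - 1) * t)"])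
      (auto intro!: derivative_eq_intros continuous_intros)
  let ?E = "\<lambda>x. exp (- (r - 1) * v x)" and ?W = "\<lambda>x. n x powr ((r - 2) / 2)"
  define V' where "V' x h = ?E x *\<^sub>R (?W x *\<^sub>R X' x h + (((r - 2) / 2 * n x powr ((r - 2) / 2 - 1)) * (2 * (X x \<bullet> X' x h))) *\<^sub>R X x) +
    ((- (r - 1) * ?E x) * (X x \<bullet> h)) *\<^sub>R (?W x *\<^sub>R X x)" for x h
  have "C1_on S (\<lambda>x. ?E x *\<^sub>R (?W x *\<^sub>R X x)) V'"
    unfolding V'_def[abs_def] by (rule C1_on_scaleR[OF E C1_on_scaleR[OF W X]])
  moreover have "(\<lambda>x. ?E x *\<^sub>R (?W x *\<^sub>R X x)) = (\<lambda>x. reg_flux r \<eta> (v x) (X x))"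
    by (simp add: reg_flux_def n_def fun_eq_iff)
  moreover have "divergence (V' x) = ?E x * ?W x *
      (divergence (X' x) + (r - 2) * (X x \<bullet> X' x (X x)) / n x - (r - 1) * (X x \<bullet> X x))" if x: "x \<in> S" for x
  proof -
    have l: "linear (X' x)" by (rule C1_on_linear[OF X x])
    have l1: "linear (\<lambda>h. c * (2 * (X x \<bullet> X' x h)))" for c
      by (rule linearI) (simp_all add: linear_add[OF l] linear_scale[OF l] distrib_left inner_add_right)
    have l2: "linear (\<lambda>h. (- (r - 1) * ?E x) * (X x \<bullet> h))"
      by (rule linearI) (simp_all add: algebra_simps inner_add_right)
    have p: "n x powr ((r - 2) / 2 - 1) = ?W x / n x" using n[of x] by (simp add: powr_diff)
    have "divergence (V' x) = ?E x * (?W x * divergence (X' x) + ((r - 2) / 2 * n x powr ((r - 2) / 2 - 1)) * (2 * (X x \<bullet> X' x (X x)))) +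
      (- (r - 1) * ?E x) * (X x \<bullet> (?W x *\<^sub>R X x))"
      unfolding V'_def[abs_def]
      by (simp only: divergence_add divergence_scaleR divergence_rank_one[OF l1] divergence_rank_one[OF l2])
    then show ?thesis unfolding p using n[of x] by (simp add: field_simps)
  qed
  ultimately show thesis using that unfolding n_def by simp
qed

text \<open>\<open>M\<close> has the shape of the Hessian of the barrier: A is the second derivative
  across the level sets of the distance, B stems from the cut-off of the affine part, and K
  multiplies the curvature. For \<tau> = r - 2 and n the normalised gradient, the left side is the
  normalised r-Laplacian, with ellipticity constant min 1 (r - 1).\<close>

lemma elliptic_form_bound:
  fixes \<nu> e n :: "'a::euclidean_space" and D :: "'a \<Rightarrow> 'a" and A B K C \<tau> :: real
  assumes "norm \<nu> = 1" "norm e = 1" "norm n \<le> 1" "-1 < \<tau>" and D: "\<And>h. norm (D h) \<le> C * norm h"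
    and "A \<le> 0" "0 \<le> B" "0 \<le> K"
  defines "M \<equiv> \<lambda>h. (A * (\<nu> \<bullet> h) + B * (e \<bullet> h)) *\<^sub>R \<nu> + (K *\<^sub>R D h + (B * (\<nu> \<bullet> h)) *\<^sub>R e)"
  shows "divergence M + \<tau> * (n \<bullet> M n) \<le> min 1 (1 + \<tau>) * A + 2 * B * (1 + \<bar>\<tau>\<bar>) + K * (C * (DIM('a) + \<bar>\<tau>\<bar>))"
proof -
  have l1: "linear (\<lambda>h. A * (\<nu> \<bullet> h) + B * (e \<bullet> h))" and l2: "linear (\<lambda>h. B * (\<nu> \<bullet> h))"
    by (rule linearI; simp add: algebra_simps inner_add_right)+
  have nn: "\<nu> \<bullet> \<nu> = 1" using assms(1) by (simp add: dot_square_norm)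
  have div: "divergence M = A + 2 * B * (e \<bullet> \<nu>) + K * divergence D"
    unfolding M_def divergence_add divergence_rank_one[OF l1] divergence_rank_one[OF l2] divergence_scaleR
    using nn by (simp add: inner_commute)
  have q: "n \<bullet> M n = A * (\<nu> \<bullet> n)\<^sup>2 + 2 * B * ((e \<bullet> n) * (\<nu> \<bullet> n)) + K * (n \<bullet> D n)"
    unfolding M_def by (simp add: inner_add_right inner_commute power2_eq_square algebra_simps)
  have an: "\<bar>\<nu> \<bullet> n\<bar> \<le> 1" "\<bar>e \<bullet> n\<bar> \<le> 1" "\<bar>e \<bullet> \<nu>\<bar> \<le> 1"
    using Cauchy_Schwarz_ineq2[of \<nu> n] Cauchy_Schwarz_ineq2[of e n] Cauchy_Schwarz_ineq2[of e \<nu>] assms(1-3) by auto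
  have c0: "0 \<le> C"
  proof -
    have "norm (D \<nu>) \<le> C" using D[of \<nu>] assms(1) by simp
    then show ?thesis using norm_ge_zero[of "D \<nu>"] by linarith
  qed
  \<comment> \<open>A is nonpositive, so the smallest factor is wanted. The factor is affine in
    (\<nu> . n)^2, which ranges over [0, 1], so an endpoint decides.\<close>
  have "A * (1 + \<tau> * (\<nu> \<bullet> n)\<^sup>2) \<le> A * min 1 (1 + \<tau>)"
  proof (rule mult_left_mono_neg[OF _ \<open>A \<le> 0\<close>])
    have s: "0 \<le> (\<nu> \<bullet> n)\<^sup>2" "(\<nu> \<bullet> n)\<^sup>2 \<le> 1" using an(1) by (auto simp: abs_square_le_1)
    show "min 1 (1 + \<tau>) \<le> 1 + \<tau> * (\<nu> \<bullet> n)\<^sup>2"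
    proof (cases "0 \<le> \<tau>")
      case False
      then have "\<tau> * 1 \<le> \<tau> * (\<nu> \<bullet> n)\<^sup>2" using s by (intro mult_left_mono_neg) auto
      then show ?thesis by simp
    qed (use s in \<open>simp add: min.coboundedI1\<close>)
  qed
  moreover have "2 * B * (e \<bullet> \<nu> + \<tau> * ((e \<bullet> n) * (\<nu> \<bullet> n))) \<le> 2 * B * (1 + \<bar>\<tau>\<bar>)"
  proof (rule mult_left_mono)
    have "\<bar>(e \<bullet> n) * (\<nu> \<bullet> n)\<bar> \<le> 1 * 1" unfolding abs_mult using an by (intro mult_mono) auto
    then have "\<bar>\<tau> * ((e \<bullet> n) * (\<nu> \<bullet> n))\<bar> \<le> \<bar>\<tau>\<bar> * 1" unfolding abs_mult[of \<tau>] by (intro mult_left_mono) auto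
    then show "e \<bullet> \<nu> + \<tau> * ((e \<bullet> n) * (\<nu> \<bullet> n)) \<le> 1 + \<bar>\<tau>\<bar>" using an(3) by linarith
  qed (use \<open>0 \<le> B\<close> in simp)
  moreover have "K * (divergence D + \<tau> * (n \<bullet> D n)) \<le> K * (C * (DIM('a) + \<bar>\<tau>\<bar>))"
  proof (rule mult_left_mono[OF _ \<open>0 \<le> K\<close>])
    have "\<bar>n \<bullet> D n\<bar> \<le> norm n * norm (D n)" by (rule Cauchy_Schwarz_ineq2)
    also have "\<dots> \<le> 1 * (C * 1)"
      using assms(3) c0 order_trans[OF D[of n] mult_left_mono[OF assms(3) c0]] by (intro mult_mono) auto
    finally have "\<bar>\<tau> * (n \<bullet> D n)\<bar> \<le> \<bar>\<tau>\<bar> * C" unfolding abs_mult by (intro mult_left_mono) auto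
    then show "divergence D + \<tau> * (n \<bullet> D n) \<le> C * (DIM('a) + \<bar>\<tau>\<bar>)"
      using divergence_bound[of D C, OF D] by (simp add: algebra_simps)
  qed
  ultimately show ?thesis unfolding div q by (simp add: algebra_simps)
qed

text \<open>Explicit C1 functions enter the weak setting here: on compact subsets continuity and
  positivity give the lower bound and a bounded f(u).\<close>

lemma sol_classI:
  fixes u :: "'a::euclidean_space \<Rightarrow> real"
  assumes S: "open S" "bounded S" and q: "1 < q"
    and u: "\<And>x. x \<in> S \<Longrightarrow> (u has_derivative (\<lambda>h. G x \<bullet> h)) (at x)"
    and G: "continuous_on S G" and M: "\<And>x. x \<in> S \<Longrightarrow> norm (G x) \<le> M"
    and cu: "continuous_on (closure S) u" and u0: "\<And>x. x \<in> frontier S \<Longrightarrow> u x = 0"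
    and pos: "\<And>x. x \<in> S \<Longrightarrow> 0 < u x" and f: "continuous_on {0..} f"
  shows "sol_class q S f u G"
  unfolding sol_class_def
proof (intro conjI allI impI)
  show "sobolev_W0 q S u G"
    by (rule C1_positive_in_W0[OF S q u G M cu u0 pos])
  have cuS: "continuous_on S u" using cu closure_subset continuous_on_subset by blast
  show "\<exists>c>0. AE x in lebesgue_on K. c \<le> u x" if K: "compact K \<and> K \<subseteq> S" for K
  proof (cases "K = {}")
    case True
    then have "AE x in lebesgue_on K. 1 \<le> u x" by (intro AE_I2) simp
    then show ?thesis using zero_less_one by blast
  next
    case False
    then obtain z where z: "z \<in> K" "\<And>x. x \<in> K \<Longrightarrow> u z \<le> u x"
      using continuous_attains_inf[of K u] K continuous_on_subset[OF cuS] by blast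
    then have "AE x in lebesgue_on K. u z \<le> u x" by (intro AE_I2) simp
    then show ?thesis using pos[of z] z K by blast
  qed
  show "Lloc_on (q / (q - 1)) S (\<lambda>x. f (u x))"
    unfolding Lloc_on_def
  proof (intro allI impI)
    fix K assume K: "compact K \<and> K \<subseteq> S"
    let ?s = "q / (q - 1)"
    have c: "continuous_on K (\<lambda>x. f (u x))"
      by (rule continuous_on_compose2[OF f continuous_on_subset[OF cuS]]) (use K pos in \<open>auto intro: less_imp_le\<close>)
    have lm: "K \<in> lmeasurable" using K lmeasurable_compact by blast
    then have ms: "K \<in> sets lebesgue" by blast
    have m: "(\<lambda>x. f (u x)) \<in> borel_measurable (lebesgue_on K)"
      by (rule continuous_imp_measurable_on_sets_lebesgue[OF c ms])
    obtain B where B: "\<And>x. x \<in> K \<Longrightarrow> \<bar>f (u x)\<bar> \<le> B"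
      using compact_imp_bounded[OF compact_continuous_image[OF c]] K by (auto simp: bounded_iff)
    interpret finite_measure "lebesgue_on K"
      by (rule finite_measureI) (use lm in \<open>auto simp: emeasure_restrict_space fmeasurable_def\<close>)
    have "integrable (lebesgue_on K) (\<lambda>x. \<bar>f (u x)\<bar> powr ?s)"
      by (rule integrable_const_bound[of _ "B powr ?s"])
        (use m B q in \<open>auto intro!: AE_I2 powr_mono2\<close>)
    with m show "Lp_on ?s K (\<lambda>x. f (u x))" by (simp add: Lp_on_def)
  qed
qed

section \<open>The radial profile\<close>

text \<open>Covers both signs of the exponent; for (q - 2) / 2 the sign depends on whether q exceeds
  2.\<close>

lemma powr_between:
  fixes u :: real
  assumes "0 < l" "l \<le> u" "u \<le> h"
  shows "min (l powr b) (h powr b) \<le> u powr b"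
  using assms powr_mono2[of b l u] powr_mono2'[of b u h] by (cases "0 \<le> b") (auto simp: min.coboundedI1 min.coboundedI2)

text \<open>A smooth odd approximation of the signed root sgn z |z|^\<alpha>, which is the case
  \<epsilon> = 0. There the convention 0 powr b = 0 is harmless because of the factor z.\<close>

definition root_profile :: "real \<Rightarrow> real \<Rightarrow> real \<Rightarrow> real" where
  "root_profile \<alpha> \<epsilon> z = z * (z\<^sup>2 + \<epsilon>\<^sup>2) powr ((\<alpha> - 1) / 2)"

definition root_profile' :: "real \<Rightarrow> real \<Rightarrow> real \<Rightarrow> real" where
  "root_profile' \<alpha> \<epsilon> z = (z\<^sup>2 + \<epsilon>\<^sup>2) powr ((\<alpha> - 3) / 2) * (\<alpha> * z\<^sup>2 + \<epsilon>\<^sup>2)"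

lemma power2_powr: "(z\<^sup>2) powr b = \<bar>z\<bar> powr (2 * b)" for z :: real
proof (cases "z = 0")
  case False
  have "(\<bar>z\<bar> powr 2) powr b = \<bar>z\<bar> powr (2 * b)" by (rule powr_powr)
  with False show ?thesis by simp
qed simp

lemma root_profile_0: "root_profile \<alpha> 0 z = sgn z * \<bar>z\<bar> powr \<alpha>"
proof (cases "z = 0")
  case False
  then have "root_profile \<alpha> 0 z = z * \<bar>z\<bar> powr (\<alpha> - 1)" by (simp add: root_profile_def power2_powr diff_divide_distrib)
  also have "\<dots> = sgn z * (\<bar>z\<bar> * \<bar>z\<bar> powr (\<alpha> - 1))" by (simp add: sgn_if)
  also have "\<bar>z\<bar> * \<bar>z\<bar> powr (\<alpha> - 1) = \<bar>z\<bar> powr \<alpha>" using False by (simp add: powr_diff)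
  finally show ?thesis .
qed (simp add: root_profile_def)

lemma abs_root_profile_le:
  assumes "0 < \<alpha>" "\<alpha> \<le> 1"
  shows "\<bar>root_profile \<alpha> \<epsilon> z\<bar> \<le> \<bar>z\<bar> powr \<alpha>"
proof (cases "z = 0")
  case False
  have "(z\<^sup>2 + \<epsilon>\<^sup>2) powr ((\<alpha> - 1) / 2) \<le> (z\<^sup>2) powr ((\<alpha> - 1) / 2)"
    using False assms by (intro powr_mono2') auto
  also have "\<dots> = \<bar>z\<bar> powr (\<alpha> - 1)" by (simp add: power2_powr diff_divide_distrib)
  finally have "\<bar>root_profile \<alpha> \<epsilon> z\<bar> \<le> \<bar>z\<bar> * \<bar>z\<bar> powr (\<alpha> - 1)"
    unfolding root_profile_def abs_mult by (intro mult_mono) auto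
  also have "\<dots> = \<bar>z\<bar> powr \<alpha>" using False by (simp add: powr_diff)
  finally show ?thesis .
qed (simp add: root_profile_def)

lemma root_profile_sign:
  "0 \<le> z \<Longrightarrow> 0 \<le> root_profile \<alpha> \<epsilon> z" "z \<le> 0 \<Longrightarrow> root_profile \<alpha> \<epsilon> z \<le> 0"
  by (auto simp: root_profile_def mult_nonpos_nonneg)

lemma root_profile_deriv:
  assumes "0 < \<epsilon>"
  shows "(root_profile \<alpha> \<epsilon> has_real_derivative root_profile' \<alpha> \<epsilon> z) (at z)"
proof -
  have R: "z\<^sup>2 + \<epsilon>\<^sup>2 > 0" using assms by (simp add: add_nonneg_pos)
  have *: "((\<lambda>z. (z\<^sup>2 + \<epsilon>\<^sup>2) powr ((\<alpha> - 1) / 2)) has_real_derivative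
      ((\<alpha> - 1) / 2) * (z\<^sup>2 + \<epsilon>\<^sup>2) powr ((\<alpha> - 1) / 2 - 1) * (2 * z)) (at z)"
    by (rule DERIV_chain2[where f="\<lambda>t. t powr ((\<alpha> - 1) / 2)" and g="\<lambda>z. z\<^sup>2 + \<epsilon>\<^sup>2", OF has_real_derivative_powr[OF R]])
      (auto intro!: derivative_eq_intros)
  have e: "(\<alpha> - 1) / 2 - 1 = (\<alpha> - 3) / 2" by (simp add: field_simps)
  have p: "(z\<^sup>2 + \<epsilon>\<^sup>2) powr ((\<alpha> - 1) / 2) = (z\<^sup>2 + \<epsilon>\<^sup>2) powr ((\<alpha> - 3) / 2) * (z\<^sup>2 + \<epsilon>\<^sup>2)"
    using R powr_add[of "z\<^sup>2 + \<epsilon>\<^sup>2" "(\<alpha> - 3) / 2" 1] by (simp add: field_simps)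
  show ?thesis
    unfolding root_profile_def[abs_def] root_profile'_def
    by (rule DERIV_cong[OF DERIV_mult[OF DERIV_ident *]])
      (simp only: e p, simp add: field_simps power2_eq_square)
qed

text \<open>As \<alpha> \<le> 1, the summand \<epsilon>^2 in the derivative may be lowered to
  \<alpha> \<epsilon>^2. The resulting bound retains the infinite slope at 0 in the limit.\<close>

lemma root_profile'_ge:
  assumes "0 < \<epsilon>" "0 < \<alpha>" "\<alpha> \<le> 1"
  shows "\<alpha> * (z\<^sup>2 + \<epsilon>\<^sup>2) powr ((\<alpha> - 1) / 2) \<le> root_profile' \<alpha> \<epsilon> z"
proof -
  have R: "z\<^sup>2 + \<epsilon>\<^sup>2 > 0" using assms by (simp add: add_nonneg_pos)
  have p: "(z\<^sup>2 + \<epsilon>\<^sup>2) powr ((\<alpha> - 1) / 2) = (z\<^sup>2 + \<epsilon>\<^sup>2) powr ((\<alpha> - 3) / 2) * (z\<^sup>2 + \<epsilon>\<^sup>2)"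
    using R powr_add[of "z\<^sup>2 + \<epsilon>\<^sup>2" "(\<alpha> - 3) / 2" 1] by (simp add: field_simps)
  have "\<alpha> * \<epsilon>\<^sup>2 \<le> 1 * \<epsilon>\<^sup>2" using assms by (intro mult_right_mono) auto
  then have "\<alpha> * (z\<^sup>2 + \<epsilon>\<^sup>2) \<le> \<alpha> * z\<^sup>2 + \<epsilon>\<^sup>2" by (simp add: algebra_simps)
  then have "(z\<^sup>2 + \<epsilon>\<^sup>2) powr ((\<alpha> - 3) / 2) * (\<alpha> * (z\<^sup>2 + \<epsilon>\<^sup>2)) \<le> root_profile' \<alpha> \<epsilon> z"
    unfolding root_profile'_def by (intro mult_left_mono) auto
  then show ?thesis unfolding p by (simp only: mult.left_commute)
qed

text \<open>This is why the flux is later regularised with \<open>\<eta> = \<epsilon> powr (2 * \<alpha>)\<close>.\<close>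

lemma root_profile_sq_ge:
  assumes "0 < \<epsilon>" "0 < \<alpha>" "\<alpha> \<le> 1"
  shows "(z\<^sup>2 + \<epsilon>\<^sup>2) powr \<alpha> \<le> \<epsilon> powr (2 * \<alpha>) + (root_profile \<alpha> \<epsilon> z)\<^sup>2"
proof -
  have R: "z\<^sup>2 + \<epsilon>\<^sup>2 > 0" using assms by (simp add: add_nonneg_pos)
  have "(z\<^sup>2 + \<epsilon>\<^sup>2) powr (\<alpha> - 1) \<le> (\<epsilon>\<^sup>2) powr (\<alpha> - 1)"
    using assms by (intro powr_mono2') auto
  also have "\<dots> = \<epsilon> powr (2 * \<alpha> - 2)" using assms(1) by (simp add: power2_powr algebra_simps)
  finally have "\<epsilon>\<^sup>2 * (z\<^sup>2 + \<epsilon>\<^sup>2) powr (\<alpha> - 1) \<le> \<epsilon>\<^sup>2 * \<epsilon> powr (2 * \<alpha> - 2)"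
    by (intro mult_left_mono) auto
  also have "\<dots> = \<epsilon> powr (2 * \<alpha>)" using assms(1) by (simp add: powr_diff)
  finally have 1: "\<epsilon>\<^sup>2 * (z\<^sup>2 + \<epsilon>\<^sup>2) powr (\<alpha> - 1) \<le> \<epsilon> powr (2 * \<alpha>)" .
  have "((z\<^sup>2 + \<epsilon>\<^sup>2) powr ((\<alpha> - 1) / 2))\<^sup>2 = (z\<^sup>2 + \<epsilon>\<^sup>2) powr (\<alpha> - 1)"
    by (simp add: power2_eq_square powr_add[symmetric])
  then have 2: "(root_profile \<alpha> \<epsilon> z)\<^sup>2 = z\<^sup>2 * (z\<^sup>2 + \<epsilon>\<^sup>2) powr (\<alpha> - 1)"
    by (simp add: root_profile_def power_mult_distrib)
  have "(z\<^sup>2 + \<epsilon>\<^sup>2) powr \<alpha> = (z\<^sup>2 + \<epsilon>\<^sup>2) * (z\<^sup>2 + \<epsilon>\<^sup>2) powr (\<alpha> - 1)"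
    using R by (simp add: powr_diff)
  then show ?thesis using 1 2 by (simp add: algebra_simps)
qed

lemma root_profile_tendsto:
  assumes "\<epsilon> \<longlonglongrightarrow> 0"
  shows "(\<lambda>n. root_profile \<alpha> (\<epsilon> n) z) \<longlonglongrightarrow> root_profile \<alpha> 0 z"
proof (cases "z = 0")
  case False
  then show ?thesis unfolding root_profile_def
    by (auto intro!: tendsto_eq_intros assms)
qed (simp add: root_profile_def)

text \<open>After division by x + y the two fractions sum to 1, and a number in [0, 1] is at most
  its \<alpha>-th power.\<close>

lemma powr_add_le_add_powr:
  fixes x y :: real
  assumes "0 \<le> x" "0 \<le> y" "0 < \<alpha>" "\<alpha> \<le> 1"
  shows "(x + y) powr \<alpha> \<le> x powr \<alpha> + y powr \<alpha>"
proof (cases "x + y = 0")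
  case False
  then have s: "0 < x + y" using assms by linarith
  have le: "t / (x + y) \<le> (t / (x + y)) powr \<alpha>" if "0 \<le> t" "t \<le> x + y" for t
  proof (cases "t = 0")
    case False
    then have "(t / (x + y)) powr 1 \<le> (t / (x + y)) powr \<alpha>"
      using that s assms by (intro powr_mono') auto
    then show ?thesis using that s by simp
  qed simp
  have "1 = x / (x + y) + y / (x + y)" using s by (simp add: add_divide_distrib[symmetric])
  also have "\<dots> \<le> (x / (x + y)) powr \<alpha> + (y / (x + y)) powr \<alpha>"
    using assms by (intro add_mono le) auto
  also have "\<dots> = (x powr \<alpha> + y powr \<alpha>) / (x + y) powr \<alpha>"
    using assms s by (simp add: powr_divide add_divide_distrib)
  finally show ?thesis using s by (simp add: divide_simps split: if_splits)
qed (use assms in auto)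

lemma powr_Hoelder:
  fixes x y :: real
  assumes "0 \<le> x" "0 \<le> y" "0 < \<alpha>" "\<alpha> \<le> 1"
  shows "\<bar>x powr \<alpha> - y powr \<alpha>\<bar> \<le> \<bar>x - y\<bar> powr \<alpha>"
  using powr_add_le_add_powr[of y "x - y" \<alpha>] powr_add_le_add_powr[of x "y - x" \<alpha>] assms
    powr_mono2[of \<alpha> x y] powr_mono2[of \<alpha> y x]
  by (cases "x \<le> y") auto

lemma root_profile_Hoelder:
  assumes "0 < \<alpha>" "\<alpha> \<le> 1"
  shows "\<bar>root_profile \<alpha> 0 x - root_profile \<alpha> 0 y\<bar> \<le> 2 * \<bar>x - y\<bar> powr \<alpha>"
proof -
  \<comment> \<open>For opposite signs |x| and |y| are each at most |x - y|, which is the source of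
    the factor 2.\<close>
  have opp: "\<bar>x\<bar> powr \<alpha> + \<bar>y\<bar> powr \<alpha> \<le> 2 * \<bar>x - y\<bar> powr \<alpha>" if "x * y \<le> 0" for x y :: real
  proof -
    have "\<bar>x\<bar> \<le> \<bar>x - y\<bar>" "\<bar>y\<bar> \<le> \<bar>x - y\<bar>" using that by (auto simp: mult_le_0_iff)
    then have "\<bar>x\<bar> powr \<alpha> \<le> \<bar>x - y\<bar> powr \<alpha>" "\<bar>y\<bar> powr \<alpha> \<le> \<bar>x - y\<bar> powr \<alpha>"
      using assms by (auto intro!: powr_mono2)
    then show ?thesis by linarith
  qed
  have nonneg: "\<bar>\<bar>x\<bar> powr \<alpha> - \<bar>y\<bar> powr \<alpha>\<bar> \<le> \<bar>x - y\<bar> powr \<alpha>"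
  proof -
    have "\<bar>\<bar>x\<bar> powr \<alpha> - \<bar>y\<bar> powr \<alpha>\<bar> \<le> \<bar>\<bar>x\<bar> - \<bar>y\<bar>\<bar> powr \<alpha>" using assms by (intro powr_Hoelder) auto
    also have "\<dots> \<le> \<bar>x - y\<bar> powr \<alpha>" using assms by (intro powr_mono2) auto
    finally show ?thesis .
  qed
  have p: "0 \<le> \<bar>x - y\<bar> powr \<alpha>" by simp
  consider "x * y \<le> 0" | "sgn x = sgn y" "\<bar>sgn x\<bar> = 1"
    by (cases x "0::real" rule: linorder_cases; cases y "0::real" rule: linorder_cases) (auto simp: mult_le_0_iff)
  then show ?thesis
  proof cases
    case 1
    have "\<bar>root_profile \<alpha> 0 x - root_profile \<alpha> 0 y\<bar> \<le> \<bar>root_profile \<alpha> 0 x\<bar> + \<bar>root_profile \<alpha> 0 y\<bar>" by (rule abs_triangle_ineq4)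
    also have "\<dots> \<le> \<bar>x\<bar> powr \<alpha> + \<bar>y\<bar> powr \<alpha>" using assms by (intro add_mono abs_root_profile_le)
    finally show ?thesis using opp[OF 1] by linarith
  next
    case 2
    then have "root_profile \<alpha> 0 x - root_profile \<alpha> 0 y = sgn x * (\<bar>x\<bar> powr \<alpha> - \<bar>y\<bar> powr \<alpha>)"
      by (simp add: root_profile_0 right_diff_distrib)
    then have "\<bar>root_profile \<alpha> 0 x - root_profile \<alpha> 0 y\<bar> = \<bar>\<bar>x\<bar> powr \<alpha> - \<bar>y\<bar> powr \<alpha>\<bar>"
      by (simp only: abs_mult 2(2) mult_1)
    then show ?thesis using nonneg p by linarith
  qed
qed

text \<open>The profile \<open>k\<close> below crosses the value 1 exactly at \<open>2 * a\<close>, with infinite slope if \<open>\<epsilon> = 0\<close>, and vanishes beyond \<open>3 * a\<close>.\<close>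

locale profile =
  fixes a \<alpha> \<gamma> j :: real
  assumes a: "0 < a" "3 * a \<le> 1" and \<alpha>: "0 < \<alpha>" "\<alpha> < 1" and \<gamma>: "0 < \<gamma>" "\<gamma> < 1" and j: "2 \<le> j"
begin

definition cut :: "real \<Rightarrow> real" where "cut s = max 0 (3 - s / a)"

text \<open>Normalised to vanish at 2a, where \<open>cut\<close> is 1, so that \<open>k\<close>
  takes the value 1 there for every \<epsilon>.\<close>

definition sing :: "real \<Rightarrow> real \<Rightarrow> real" where
  "sing \<epsilon> s = root_profile \<alpha> \<epsilon> (s - 2 * a) + s powr (1 - \<gamma>) - (2 * a) powr (1 - \<gamma>)"

definition k :: "real \<Rightarrow> real \<Rightarrow> real" where "k \<epsilon> s = cut s powr j * exp (- sing \<epsilon> s)"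

definition k' :: "real \<Rightarrow> real \<Rightarrow> real" where
  "k' \<epsilon> s = - ((j / a) * cut s powr (j - 1) + cut s powr j * (root_profile' \<alpha> \<epsilon> (s - 2 * a) + (1 - \<gamma>) * s powr (- \<gamma>))) * exp (- sing \<epsilon> s)"

lemma cut_range: "0 \<le> s \<Longrightarrow> 0 \<le> cut s \<and> cut s \<le> 3"
  using a by (auto simp: cut_def)

lemma cut_eq_0: "3 * a \<le> s \<Longrightarrow> cut s = 0"
  using a by (auto simp: cut_def max_def field_simps)

lemma k_nonneg: "0 \<le> k \<epsilon> s" by (simp add: k_def)

lemma k_eq_0: "3 * a \<le> s \<Longrightarrow> k \<epsilon> s = 0"
  using j by (simp add: k_def cut_eq_0)

lemma k'_eq_0: "3 * a \<le> s \<Longrightarrow> k' \<epsilon> s = 0"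
  using j by (simp add: k'_def cut_eq_0)

lemma k_deriv:
  assumes "0 < \<epsilon>" "0 < s"
  shows "(k \<epsilon> has_real_derivative k' \<epsilon> s) (at s)"
proof -
  have 1: "((\<lambda>s. cut s powr j) has_real_derivative (j * cut s powr (j - 1)) * (- (1 / a))) (at s)"
    unfolding cut_def[abs_def]
    by (rule DERIV_chain2[OF has_real_derivative_pos_part_powr])
      (use j a in \<open>auto intro!: derivative_eq_intros\<close>)
  have 2: "((\<lambda>s. root_profile \<alpha> \<epsilon> (s - 2 * a)) has_real_derivative root_profile' \<alpha> \<epsilon> (s - 2 * a) * 1) (at s)"
    by (rule DERIV_chain2[OF root_profile_deriv[OF assms(1)]]) (auto intro!: derivative_eq_intros)
  have 3: "((\<lambda>s. s powr (1 - \<gamma>)) has_real_derivative (1 - \<gamma>) * s powr (- \<gamma>)) (at s)"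
    using has_real_derivative_powr[OF assms(2), of "1 - \<gamma>"] by simp
  show ?thesis
    unfolding k_def[abs_def] sing_def
    by (rule DERIV_cong[OF DERIV_mult[OF 1 DERIV_chain2[OF DERIV_exp DERIV_minus[OF DERIV_diff[OF DERIV_add[OF 2 3] DERIV_const]]]]])
      (simp add: k'_def sing_def algebra_simps)
qed

lemma k'_continuous: "0 < \<epsilon> \<Longrightarrow> continuous_on {0<..} (k' \<epsilon>)"
proof -
  assume e: "0 < \<epsilon>"
  then have R: "z\<^sup>2 + \<epsilon>\<^sup>2 > 0" for z by (simp add: add_nonneg_pos)
  have c: "continuous_on {0<..} (\<lambda>s. cut s powr b)" if "0 < b" for b
    unfolding cut_def using that a by (intro continuous_on_powr' continuous_intros) auto
  have "continuous_on {0<..} (\<lambda>s. root_profile' \<alpha> \<epsilon> (s - 2 * a))" "continuous_on {0<..} (\<lambda>s. root_profile \<alpha> \<epsilon> (s - 2 * a))"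
    unfolding root_profile'_def root_profile_def using R by (auto intro!: continuous_intros simp: less_imp_neq[symmetric])
  then show ?thesis
    unfolding k'_def[abs_def] sing_def using c[of j] c[of "j - 1"] j \<gamma> a
    by (auto intro!: continuous_intros)
qed

text \<open>A lower bound for the logarithmic decay rate -k'/k. Since \<open>cut\<close> is at most
  3, its power contributes at least j / (3a), which the choice of j makes as large as
  needed.\<close>

lemma k'_le:
  assumes "0 < \<epsilon>" "0 < s"
  shows "k' \<epsilon> s \<le> - ((j / (3 * a) + \<alpha> * ((s - 2 * a)\<^sup>2 + \<epsilon>\<^sup>2) powr ((\<alpha> - 1) / 2) + (1 - \<gamma>) * s powr (- \<gamma>)) * k \<epsilon> s)"
proof -
  have c: "0 \<le> cut s" "cut s \<le> 3" using cut_range[of s] assms by auto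
  have p: "cut s powr j = cut s powr (j - 1) * cut s"
    using c powr_mult_base[of "cut s" "j - 1"] by (cases "cut s = 0") (auto simp: mult.commute)
  have "cut s powr j \<le> cut s powr (j - 1) * 3" unfolding p using c by (intro mult_left_mono) auto
  then have 1: "(j / (3 * a)) * cut s powr j \<le> (j / a) * cut s powr (j - 1)"
    using mult_left_mono[of "cut s powr j" "cut s powr (j - 1) * 3" "j / (3 * a)"] j a by simp
  have 2: "cut s powr j * (\<alpha> * ((s - 2 * a)\<^sup>2 + \<epsilon>\<^sup>2) powr ((\<alpha> - 1) / 2) + (1 - \<gamma>) * s powr (- \<gamma>)) \<le>
      cut s powr j * (root_profile' \<alpha> \<epsilon> (s - 2 * a) + (1 - \<gamma>) * s powr (- \<gamma>))"
    using root_profile'_ge[OF assms(1) \<alpha>(1), of "s - 2 * a"] \<alpha> by (intro mult_left_mono) auto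
  have "((j / (3 * a)) * cut s powr j + cut s powr j * (\<alpha> * ((s - 2 * a)\<^sup>2 + \<epsilon>\<^sup>2) powr ((\<alpha> - 1) / 2) + (1 - \<gamma>) * s powr (- \<gamma>))) * exp (- sing \<epsilon> s)
    \<le> ((j / a) * cut s powr (j - 1) + cut s powr j * (root_profile' \<alpha> \<epsilon> (s - 2 * a) + (1 - \<gamma>) * s powr (- \<gamma>))) * exp (- sing \<epsilon> s)"
    using add_mono[OF 1 2] by (rule mult_right_mono) simp
  then show ?thesis by (simp add: k'_def k_def algebra_simps)
qed

text \<open>The normalisation 3a \<le> 1 makes all powers involved at most 1. The last two parts say
  that on either side of 2a the boundary term only reinforces the root.\<close>

lemma sing_bounds:
  assumes "0 \<le> s" "s \<le> 3 * a"
  shows "\<bar>root_profile \<alpha> \<epsilon> (s - 2 * a)\<bar> \<le> 1" "\<bar>sing \<epsilon> s\<bar> \<le> 2"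
    "s \<le> 2 * a \<Longrightarrow> sing \<epsilon> s \<le> root_profile \<alpha> \<epsilon> (s - 2 * a)"
    "2 * a \<le> s \<Longrightarrow> root_profile \<alpha> \<epsilon> (s - 2 * a) \<le> sing \<epsilon> s"
proof -
  have "\<bar>root_profile \<alpha> \<epsilon> (s - 2 * a)\<bar> \<le> \<bar>s - 2 * a\<bar> powr \<alpha>" using \<alpha> by (intro abs_root_profile_le) auto
  also have "\<dots> \<le> 1 powr \<alpha>" using assms a \<alpha> by (intro powr_mono2) auto
  finally show 1: "\<bar>root_profile \<alpha> \<epsilon> (s - 2 * a)\<bar> \<le> 1" by simp
  have "0 \<le> s powr (1 - \<gamma>)" "0 \<le> (2 * a) powr (1 - \<gamma>)" by auto
  moreover have "s powr (1 - \<gamma>) \<le> 1 powr (1 - \<gamma>)" "(2 * a) powr (1 - \<gamma>) \<le> 1 powr (1 - \<gamma>)"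
    using assms a \<gamma> by (intro powr_mono2; simp)+
  ultimately show "\<bar>sing \<epsilon> s\<bar> \<le> 2" unfolding sing_def abs_le_iff powr_one_eq_one
    using conjunct1[OF 1[unfolded abs_le_iff]] conjunct2[OF 1[unfolded abs_le_iff]] by (intro conjI) linarith+
  show "s \<le> 2 * a \<Longrightarrow> sing \<epsilon> s \<le> root_profile \<alpha> \<epsilon> (s - 2 * a)"
    unfolding sing_def using powr_mono2[of "1 - \<gamma>" s "2 * a"] assms \<gamma> by simp
  show "2 * a \<le> s \<Longrightarrow> root_profile \<alpha> \<epsilon> (s - 2 * a) \<le> sing \<epsilon> s"
    unfolding sing_def using powr_mono2[of "1 - \<gamma>" "2 * a" s] a \<gamma> by simp
qed

lemma k_le: 
  assumes "0 \<le> s"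
  shows "k \<epsilon> s \<le> 3 powr j * exp 2"
proof (cases "s \<le> 3 * a")
  case True
  show ?thesis unfolding k_def
    using cut_range[OF assms] sing_bounds(2)[OF assms True, of \<epsilon>] j by (intro mult_mono powr_mono2) auto
qed (simp add: k_eq_0)

text \<open>Left of 2a the exponential is at least 1 + |root| and \<open>cut\<close> is at least 1.
  Up to s = a it is even at least 2, so the normal part of the gradient then outweighs the unit
  vector \<open>e\<close>.\<close>

lemma k_ge_left:
  assumes "0 \<le> s" "s \<le> 2 * a"
  shows "1 + \<bar>root_profile \<alpha> \<epsilon> (s - 2 * a)\<bar> \<le> k \<epsilon> s" "s \<le> a \<Longrightarrow> 2 \<le> k \<epsilon> s"
proof -
  have s3: "s \<le> 3 * a" using assms a by simp
  have rp: "root_profile \<alpha> \<epsilon> (s - 2 * a) \<le> 0" using assms by (intro root_profile_sign) auto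
  have "1 + \<bar>root_profile \<alpha> \<epsilon> (s - 2 * a)\<bar> \<le> exp (- root_profile \<alpha> \<epsilon> (s - 2 * a))"
    using exp_ge_add_one_self[of "- root_profile \<alpha> \<epsilon> (s - 2 * a)"] rp by simp
  also have "\<dots> \<le> exp (- sing \<epsilon> s)" using sing_bounds(3)[OF assms(1) s3 assms(2), of \<epsilon>] by simp
  finally have e: "1 + \<bar>root_profile \<alpha> \<epsilon> (s - 2 * a)\<bar> \<le> exp (- sing \<epsilon> s)" .
  have c: "1 \<le> cut s" using assms a by (simp add: cut_def le_max_iff_disj field_simps)
  then have "1 \<le> cut s powr j" using j by (simp add: ge_one_powr_ge_zero)
  then have "1 * (1 + \<bar>root_profile \<alpha> \<epsilon> (s - 2 * a)\<bar>) \<le> k \<epsilon> s"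
    unfolding k_def by (intro mult_mono e) auto
  then show "1 + \<bar>root_profile \<alpha> \<epsilon> (s - 2 * a)\<bar> \<le> k \<epsilon> s" by simp
  show "2 \<le> k \<epsilon> s" if "s \<le> a"
  proof -
    have "2 \<le> cut s" using that a by (simp add: cut_def le_max_iff_disj field_simps)
    moreover have "cut s powr 1 \<le> cut s powr j" using c j by (intro powr_mono) auto
    ultimately have "2 \<le> cut s powr j" using c by simp
    moreover have "1 \<le> exp (- sing \<epsilon> s)" using e by linarith
    ultimately have "2 * 1 \<le> k \<epsilon> s" unfolding k_def by (intro mult_mono) auto
    then show ?thesis by simp
  qed
qed

text \<open>For the root part r in [0, 1] one has exp(-r) \<le> 1/(1 + r) \<le> 1 - r/2. Beyond 5a/2
  the factor \<open>cut\<close> is at most 1/2, whatever \<epsilon> is.\<close>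

lemma k_le_right:
  assumes "2 * a \<le> s"
  shows "s \<le> 3 * a \<Longrightarrow> k \<epsilon> s \<le> 1 - \<bar>root_profile \<alpha> \<epsilon> (s - 2 * a)\<bar> / 2" "5 * a / 2 \<le> s \<Longrightarrow> k \<epsilon> s \<le> 1 / 2"
proof -
  have s0: "0 \<le> s" using assms a by simp
  have rp: "0 \<le> root_profile \<alpha> \<epsilon> (s - 2 * a)" using assms by (intro root_profile_sign) auto
  have c: "0 \<le> cut s" "cut s \<le> 1" using assms a by (auto simp: cut_def field_simps)
  show "k \<epsilon> s \<le> 1 - \<bar>root_profile \<alpha> \<epsilon> (s - 2 * a)\<bar> / 2" if s3: "s \<le> 3 * a"
  proof -
    let ?r = "root_profile \<alpha> \<epsilon> (s - 2 * a)"
    have r1: "?r \<le> 1" using sing_bounds(1)[OF s0 s3, of \<epsilon>] by simp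
    have "exp (- sing \<epsilon> s) \<le> exp (- ?r)" using sing_bounds(4)[OF s0 s3 assms, of \<epsilon>] by simp
    also have "\<dots> = 1 / exp ?r" by (simp add: exp_minus divide_inverse)
    also have "\<dots> \<le> 1 / (1 + ?r)" using rp by (intro divide_left_mono) (auto simp: add_pos_nonneg)
    also have "\<dots> \<le> 1 - ?r / 2"
    proof -
      have "?r * ?r \<le> ?r * 1" using rp r1 by (intro mult_left_mono)
      then have "1 \<le> (1 - ?r / 2) * (1 + ?r)" by (simp add: algebra_simps)
      then show ?thesis using rp by (simp add: pos_divide_le_eq add_pos_nonneg)
    qed
    finally have e: "exp (- sing \<epsilon> s) \<le> 1 - ?r / 2" .
    have "cut s powr j \<le> 1 powr j" using c j by (intro powr_mono2) auto
    then have "k \<epsilon> s \<le> 1 * (1 - ?r / 2)" unfolding k_def using e by (intro mult_mono) auto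
    then show ?thesis using rp by simp
  qed
  show "k \<epsilon> s \<le> 1 / 2" if s5: "5 * a / 2 \<le> s"
  proof (cases "s \<le> 3 * a")
    case True
    have "3 - s / a \<le> 1 / 2" using s5 a by (simp add: field_simps)
    then have h: "cut s \<le> 1 / 2" unfolding cut_def by (intro max.boundedI) auto
    have "cut s powr j \<le> (1 / 2) powr j" using c h j by (intro powr_mono2) auto
    also have "\<dots> \<le> (1 / 2) powr 1" using j by (intro powr_mono') auto
    finally have "cut s powr j \<le> 1 / 2" by simp
    moreover have "exp (- sing \<epsilon> s) \<le> 1" using sing_bounds(4)[OF s0 True assms, of \<epsilon>] rp by simp
    ultimately have "k \<epsilon> s \<le> (1 / 2) * 1" unfolding k_def by (intro mult_mono) auto
    then show ?thesis by simp
  qed (simp add: k_eq_0)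
qed

text \<open>Between a and 3a the gradient of the barrier exponent has norm at least |k - 1|, so this
  controls how fast it can degenerate at the level 2a.\<close>

lemma k_away_from_1:
  assumes "0 \<le> s" "s \<le> 3 * a"
  shows "\<bar>root_profile \<alpha> \<epsilon> (s - 2 * a)\<bar> / 2 \<le> \<bar>k \<epsilon> s - 1\<bar>"
  using k_ge_left(1)[of s \<epsilon>] k_le_right(1)[of s \<epsilon>] assms by (cases "s \<le> 2 * a") auto

text \<open>Serves the range where the decay of \<open>k\<close> has to produce strictness; beyond
  5a/2 a lower bound on the gradient takes over.\<close>

lemma k_ge_middle:
  assumes "0 \<le> s" "s \<le> 5 * a / 2"
  shows "(1 / 2) powr j * exp (- 2) \<le> k \<epsilon> s"
proof -
  have s3: "s \<le> 3 * a" using assms a by simp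
  have "1 / 2 \<le> cut s" using assms a by (simp add: cut_def le_max_iff_disj field_simps)
  then show ?thesis unfolding k_def using sing_bounds(2)[OF assms(1) s3, of \<epsilon>] j
    by (intro mult_mono powr_mono2) auto
qed

lemma k_tendsto:
  assumes "\<epsilon> \<longlonglongrightarrow> 0"
  shows "(\<lambda>n. k (\<epsilon> n) s) \<longlonglongrightarrow> k 0 s"
  unfolding k_def sing_def by (intro tendsto_intros root_profile_tendsto assms)

lemma root_profile_continuous_on: "continuous_on S (\<lambda>s. root_profile \<alpha> 0 s)"
  unfolding continuous_on_iff
proof (intro ballI allI impI)
  fix x e :: real assume e: "0 < e"
  \<comment> \<open>Chosen so that 2 d^\<alpha> = e in the Hoelder estimate.\<close>
  define d where "d = (e / 2) powr (1 / \<alpha>)"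
  have d: "0 < d" using e by (simp add: d_def)
  have "dist (root_profile \<alpha> 0 y) (root_profile \<alpha> 0 x) < e" if "dist y x < d" for y
  proof -
    have "\<bar>y - x\<bar> powr \<alpha> < d powr \<alpha>" using that \<alpha> by (intro powr_less_mono2) (auto simp: dist_real_def)
    also have "d powr \<alpha> = e / 2" unfolding d_def using \<alpha> e by (simp add: powr_powr)
    finally show ?thesis using root_profile_Hoelder[OF \<alpha>(1), of y x] \<alpha> by (simp add: dist_real_def)
  qed
  then show "\<exists>d>0. \<forall>x'\<in>S. dist x' x < d \<longrightarrow> dist (root_profile \<alpha> 0 x') (root_profile \<alpha> 0 x) < e"
    using d by blast
qed

lemma k_continuous:
  assumes "0 \<le> \<epsilon>"
  shows "continuous_on {0..} (k \<epsilon>)"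
proof -
  have "continuous_on {0..} (\<lambda>s. root_profile \<alpha> \<epsilon> (s - 2 * a))"
  proof (cases "\<epsilon> = 0")
    case True
    have "continuous_on {0..} (\<lambda>s. s - 2 * a)" by (intro continuous_intros)
    from continuous_on_compose2[OF root_profile_continuous_on[of UNIV] this] True show ?thesis by simp
  next
    case False
    then have "z\<^sup>2 + \<epsilon>\<^sup>2 > 0" for z using assms by (simp add: add_nonneg_pos)
    then show ?thesis unfolding root_profile_def by (auto intro!: continuous_intros simp: less_imp_neq[symmetric])
  qed
  moreover have "continuous_on {0..} (\<lambda>s. cut s powr j)" "continuous_on {0..} (\<lambda>s::real. s powr (1 - \<gamma>))"
    unfolding cut_def using j a \<gamma> by (intro continuous_on_powr' continuous_intros; simp)+
  ultimately show ?thesis unfolding k_def[abs_def] sing_def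
    by (intro continuous_on_mult continuous_on_exp continuous_on_minus continuous_on_diff continuous_on_add continuous_on_const)
qed

section \<open>The antiderivative of the profile and the cut-off of the affine part\<close>

definition K :: "real \<Rightarrow> real \<Rightarrow> real" where "K \<epsilon> s = integral {0..s} (k \<epsilon>)"

lemma k_integrable: "0 \<le> \<epsilon> \<Longrightarrow> k \<epsilon> integrable_on {0..s}"
  by (intro integrable_continuous_interval continuous_on_subset[OF k_continuous]) auto

lemma K_deriv:
  assumes "0 \<le> \<epsilon>" "0 < s"
  shows "(K \<epsilon> has_real_derivative k \<epsilon> s) (at s)"
proof -
  have "((\<lambda>u. integral {0..u} (k \<epsilon>)) has_real_derivative k \<epsilon> s) (at s within {0..s + 1})"
    by (rule integral_has_real_derivative) (use assms in \<open>auto intro: continuous_on_subset[OF k_continuous]\<close>)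
  moreover have "at s within {0..s + 1} = at s" using assms by (intro at_within_interior) (auto simp: interior_atLeastAtMost_real)
  ultimately show ?thesis by (simp add: K_def[abs_def])
qed

lemma K_bounds:
  assumes "0 \<le> \<epsilon>" "0 \<le> s"
  shows "0 \<le> K \<epsilon> s" "K \<epsilon> s \<le> 3 powr j * exp 2 * s"
proof -
  show "0 \<le> K \<epsilon> s" unfolding K_def by (intro Henstock_Kurzweil_Integration.integral_nonneg k_integrable assms k_nonneg)
  have "K \<epsilon> s \<le> integral {0..s} (\<lambda>_. 3 powr j * exp 2)"
    unfolding K_def by (intro integral_le k_integrable assms) (auto intro: k_le)
  then show "K \<epsilon> s \<le> 3 powr j * exp 2 * s" using assms by (simp add: mult_ac)
qed

lemma K_mono: "0 \<le> \<epsilon> \<Longrightarrow> 0 \<le> s \<Longrightarrow> s \<le> t \<Longrightarrow> K \<epsilon> s \<le> K \<epsilon> t"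
  unfolding K_def by (rule integral_subset_le[OF _ k_integrable k_integrable]) (auto simp: k_nonneg)

lemma K_ge:
  assumes "0 \<le> \<epsilon>" "0 \<le> s"
  shows "min s (2 * a) \<le> K \<epsilon> s"
proof -
  have *: "t \<le> K \<epsilon> t" if "0 \<le> t" "t \<le> 2 * a" for t
  proof -
    have k1: "1 \<le> k \<epsilon> x" if "x \<in> {0..t}" for x
    proof -
      have "1 + \<bar>root_profile \<alpha> \<epsilon> (x - 2 * a)\<bar> \<le> k \<epsilon> x" using that \<open>t \<le> 2 * a\<close> by (intro k_ge_left) auto
      then show ?thesis using abs_ge_zero[of "root_profile \<alpha> \<epsilon> (x - 2 * a)"] by linarith
    qed
    have "integral {0..t} (\<lambda>_. 1) \<le> K \<epsilon> t"
      unfolding K_def by (rule integral_le[OF _ k_integrable[OF assms(1)] k1]) auto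
    then show ?thesis using that by simp
  qed
  show ?thesis
    using *[of "min s (2 * a)"] K_mono[OF assms(1), of "min s (2 * a)" s] assms a by auto
qed

lemma K_tendsto:
  assumes "\<epsilon> \<longlonglongrightarrow> 0" "\<And>n. 0 \<le> \<epsilon> n"
  shows "(\<lambda>n. K (\<epsilon> n) s) \<longlonglongrightarrow> K 0 s"
  unfolding K_def
proof (rule Equivalence_Lebesgue_Henstock_Integration.dominated_convergence(2)[where h="\<lambda>_. 3 powr j * exp 2"])
  show "k (\<epsilon> n) integrable_on {0..s}" for n by (rule k_integrable[OF assms(2)])
  show "norm (k (\<epsilon> n) x) \<le> 3 powr j * exp 2" if "x \<in> {0..s}" for n x
    using k_nonneg k_le[of x] that by simp
  show "(\<lambda>n. k (\<epsilon> n) x) \<longlonglongrightarrow> k 0 x" if "x \<in> {0..s}" for x by (rule k_tendsto[OF assms(1)])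
qed auto

text \<open>The cube makes \<open>chi\<close> twice continuously differentiable, so that the
  gradient field stays C1 for \<epsilon> > 0. \<open>chi\<close> vanishes at 0, which gives zero
  boundary values, and it is concave, so \<open>chi''\<close> times a nonnegative function has the
  favourable sign.\<close>

definition chi :: "real \<Rightarrow> real" where "chi s = 1 - (max 0 (1 - s / a)) ^ 3"
definition chi' :: "real \<Rightarrow> real" where "chi' s = 3 / a * (max 0 (1 - s / a))\<^sup>2"
definition chi'' :: "real \<Rightarrow> real" where "chi'' s = - (6 / a\<^sup>2) * max 0 (1 - s / a)"

lemma chi_deriv: "(chi has_real_derivative chi' s) (at s)" "(chi' has_real_derivative chi'' s) (at s)"
proof -
  have p: "((\<lambda>t. max 0 t ^ 3) has_real_derivative 3 * max 0 t ^ 2) (at t)"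
    "((\<lambda>t. max 0 t ^ 2) has_real_derivative 2 * max 0 t) (at t)" for t :: real
    using has_real_derivative_pos_part_powr[of 3 t] has_real_derivative_pos_part_powr[of 2 t] by simp_all
  have l: "((\<lambda>s. 1 - s / a) has_real_derivative - (1 / a)) (at s)"
    using a by (auto intro!: derivative_eq_intros)
  show "(chi has_real_derivative chi' s) (at s)"
    unfolding chi_def[abs_def]
    by (rule DERIV_cong[OF DERIV_diff[OF DERIV_const DERIV_chain2[OF p(1) l]]]) (simp add: chi'_def)
  show "(chi' has_real_derivative chi'' s) (at s)"
    unfolding chi'_def[abs_def]
    by (rule DERIV_cong[OF DERIV_cmult[OF DERIV_chain2[OF p(2) l]]]) (simp add: chi''_def power2_eq_square)
qed

lemma chi_continuous: "continuous_on S chi'" "continuous_on S chi''"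
  unfolding chi'_def[abs_def] chi''_def[abs_def] using a by (auto intro!: continuous_intros)

lemma chi_range:
  assumes "0 \<le> s"
  shows "0 \<le> chi s" "chi s \<le> 1" "chi s \<le> 3 / a * s" "0 \<le> chi' s" "chi' s \<le> 3 / a" "chi'' s \<le> 0"
proof -
  define t where "t = max 0 (1 - s / a)"
  have t: "0 \<le> t" "t \<le> 1" "1 - s / a \<le> t" using assms a by (auto simp: t_def)
  have t1: "t ^ 3 \<le> 1" "t ^ 2 \<le> 1" using t by (auto simp: power_le_one)
  have c: "chi s = 1 - t ^ 3" "chi' s = 3 / a * t\<^sup>2" "chi'' s = - (6 / a\<^sup>2) * t"
    by (simp_all add: chi_def chi'_def chi''_def t_def)
  show "0 \<le> chi s" "chi s \<le> 1" using t t1 c by auto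
  have "1 - t ^ 3 \<le> 3 * (1 - t)"
  proof -
    have "1 - t ^ 3 = (1 - t) * (1 + t + t\<^sup>2)" by (simp add: power3_eq_cube power2_eq_square algebra_simps)
    also have "\<dots> \<le> (1 - t) * 3" using t t1 by (intro mult_left_mono) auto
    finally show ?thesis by simp
  qed
  also have "\<dots> \<le> 3 / a * s" using t(3) by simp
  finally show "chi s \<le> 3 / a * s" using c by simp
  show "0 \<le> chi' s" using c a by simp
  show "chi' s \<le> 3 / a" unfolding c(2) using a mult_left_mono[OF t1(2), of "3 / a"] by simp
  show "chi'' s \<le> 0" unfolding c(3) using t a by (intro mult_nonpos_nonneg) auto
qed

lemma chi_const: "a \<le> s \<Longrightarrow> chi s = 1 \<and> chi' s = 0 \<and> chi'' s = 0"
  using a by (simp add: chi_def chi'_def chi''_def max_absorb1)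

end

section \<open>The barrier\<close>

text \<open>For r > 1 the exponent (r - 1) / 2 is positive, which tames the singular power (r - 2) /
  2 of the case r < 2 at zeros of X.\<close>

lemma norm_reg_flux_le:
  assumes "0 \<le> \<eta>"
  shows "norm (reg_flux r \<eta> v X) \<le> exp (- (r - 1) * v) * (\<eta> + X \<bullet> X) powr ((r - 1) / 2)"
proof (cases "\<eta> + X \<bullet> X = 0")
  case True
  then have "X \<bullet> X = 0" using assms inner_ge_zero[of X] by linarith
  then show ?thesis by (simp add: reg_flux_def)
next
  case False
  then have p: "\<eta> + X \<bullet> X > 0" using assms by (simp add: less_le)
  have "norm X = sqrt (X \<bullet> X)" by (rule norm_eq_sqrt_inner)
  also have "\<dots> \<le> sqrt (\<eta> + X \<bullet> X)" using assms by simp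
  also have "\<dots> = (\<eta> + X \<bullet> X) powr (1 / 2)" using p by (simp add: powr_half_sqrt)
  finally have "(\<eta> + X \<bullet> X) powr ((r - 2) / 2) * norm X \<le> (\<eta> + X \<bullet> X) powr ((r - 2) / 2) * (\<eta> + X \<bullet> X) powr (1 / 2)"
    by (intro mult_left_mono) auto
  also have "\<dots> = (\<eta> + X \<bullet> X) powr ((r - 1) / 2)"
    by (simp add: powr_add[symmetric] diff_divide_distrib)
  finally show ?thesis by (simp add: reg_flux_def mult.assoc)
qed

lemma reg_flux_tendsto:
  fixes X :: "nat \<Rightarrow> 'a::euclidean_space"
  assumes r: "1 < r" and "\<And>n. 0 \<le> \<eta> n" "\<eta> \<longlonglongrightarrow> 0" "v \<longlonglongrightarrow> v0" "X \<longlonglongrightarrow> X0"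
  shows "(\<lambda>n. reg_flux r (\<eta> n) (v n) (X n)) \<longlonglongrightarrow> reg_flux r 0 v0 X0"
proof (cases "X0 = 0")
  case False
  then show ?thesis unfolding reg_flux_def
    by (intro tendsto_intros assms(3-5)) simp
next
  case True
  \<comment> \<open>At a zero of the limit field the power itself may be singular; the norm bound
    shows that the fluxes still tend to 0.\<close>
  have "(\<lambda>n. exp (- (r - 1) * v n) * (\<eta> n + X n \<bullet> X n) powr ((r - 1) / 2)) \<longlonglongrightarrow>
      exp (- (r - 1) * v0) * (0 + X0 \<bullet> X0) powr ((r - 1) / 2)"
    using r assms(2) by (intro tendsto_intros assms(3-5) tendsto_powr2) (auto intro!: always_eventually)
  then have "(\<lambda>n. exp (- (r - 1) * v n) * (\<eta> n + X n \<bullet> X n) powr ((r - 1) / 2)) \<longlonglongrightarrow> 0"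
    using r True by simp
  then have "(\<lambda>n. reg_flux r (\<eta> n) (v n) (X n)) \<longlonglongrightarrow> 0"
    by (rule Lim_null_comparison[OF always_eventually, rotated]) (use norm_reg_flux_le[OF assms(2)] in blast)
  then show ?thesis using True by (simp add: reg_flux_def)
qed

lemma reg_flux_0: "reg_flux r 0 v X = (norm (exp (- v) *\<^sub>R X) powr (r - 2)) *\<^sub>R (exp (- v) *\<^sub>R X)"
proof -
  have "(X \<bullet> X) powr ((r - 2) / 2) = norm X powr (r - 2)"
    using power2_powr[of "norm X" "(r - 2) / 2"] by (simp add: dot_square_norm diff_divide_distrib)
  moreover have "exp (- v) powr (r - 2) = exp (- (r - 2) * v)"
    by (simp add: powr_def algebra_simps)
  moreover have "exp (- (r - 1) * v) = exp (- (r - 2) * v) * exp (- v)"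
    by (simp add: exp_add[symmetric] algebra_simps)
  ultimately show ?thesis by (simp add: reg_flux_def powr_mult)
qed

text \<open>All functions of the distance are constant beyond \<open>3 * a\<close>; the collar is wider, which allows gluing on open sets.\<close>

locale collar =
  fixes \<Omega> :: "'a::euclidean_space set" and a C :: real and \<nu> :: "'a \<Rightarrow> 'a" and \<nu>' :: "'a \<Rightarrow> 'a \<Rightarrow> 'a"
  assumes open_\<Omega>: "open \<Omega>" and bounded_\<Omega>: "bounded \<Omega>" and a_pos: "0 < a" and C_nonneg: "0 \<le> C"
    and C1_\<nu>: "C1_on {x \<in> \<Omega>. infdist x (frontier \<Omega>) < 4 * a} \<nu> \<nu>'"
    and norm_\<nu>: "\<And>x. x \<in> \<Omega> \<Longrightarrow> infdist x (frontier \<Omega>) < 4 * a \<Longrightarrow> norm (\<nu> x) = 1"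
    and deriv_\<delta>: "\<And>x. x \<in> \<Omega> \<Longrightarrow> infdist x (frontier \<Omega>) < 4 * a \<Longrightarrow>
      ((\<lambda>x. infdist x (frontier \<Omega>)) has_derivative (\<lambda>h. \<nu> x \<bullet> h)) (at x)"
    and \<nu>'_bound: "\<And>x h. x \<in> \<Omega> \<Longrightarrow> infdist x (frontier \<Omega>) < 4 * a \<Longrightarrow> norm (\<nu>' x h) \<le> C * norm h"
    and \<nu>_Lipschitz: "\<And>x y. x \<in> \<Omega> \<Longrightarrow> infdist x (frontier \<Omega>) < 4 * a \<Longrightarrow> y \<in> \<Omega> \<Longrightarrow>
      infdist y (frontier \<Omega>) < 4 * a \<Longrightarrow> norm (\<nu> x - \<nu> y) \<le> C * dist x y"
begin

definition \<delta> :: "'a \<Rightarrow> real" where "\<delta> x = infdist x (frontier \<Omega>)"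

lemma \<delta>_nonneg: "0 \<le> \<delta> x" by (simp add: \<delta>_def infdist_nonneg)

lemma \<delta>_pos: 
  assumes "x \<in> \<Omega>"
  shows "0 < \<delta> x"
proof -
  have "frontier \<Omega> \<noteq> {}" using frontier_eq_empty[of \<Omega>] assms bounded_\<Omega> not_bounded_UNIV by auto
  moreover have "x \<notin> frontier \<Omega>" using assms open_\<Omega> by (simp add: frontier_def interior_open)
  ultimately have "\<delta> x \<noteq> 0" unfolding \<delta>_def using in_closed_iff_infdist_zero[OF frontier_closed] by blast
  then show ?thesis using \<delta>_nonneg[of x] by linarith
qed

lemma \<delta>_frontier: "x \<in> frontier \<Omega> \<Longrightarrow> \<delta> x = 0" by (simp add: \<delta>_def)

lemma \<delta>_continuous: "continuous_on S \<delta>" unfolding \<delta>_def[abs_def] by (intro continuous_intros)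

lemma \<delta>_Lipschitz: "\<bar>\<delta> x - \<delta> y\<bar> \<le> dist x y"
  unfolding \<delta>_def using infdist_triangle_abs[of x "frontier \<Omega>" y] .

lemma \<delta>_bounded: obtains D where "0 < D" "\<And>x. x \<in> closure \<Omega> \<Longrightarrow> \<delta> x \<le> D"
proof -
  have "compact (\<delta> ` closure \<Omega>)"
    by (rule compact_continuous_image[OF \<delta>_continuous]) (use bounded_\<Omega> in simp)
  then obtain B where "\<And>x. x \<in> closure \<Omega> \<Longrightarrow> \<bar>\<delta> x\<bar> \<le> B"
    using compact_imp_bounded[of "\<delta> ` closure \<Omega>"] unfolding bounded_iff by auto
  then show thesis by (intro that[of "max 1 B"]) (auto simp: le_max_iff_disj abs_le_iff)
qed

lemma open_collars: "open {x \<in> \<Omega>. \<delta> x < 4 * a}" "open {x \<in> \<Omega>. 3 * a < \<delta> x}"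
proof -
  have "{x \<in> \<Omega>. \<delta> x < 4 * a} = \<Omega> \<inter> \<delta> -` {..<4 * a}" "{x \<in> \<Omega>. 3 * a < \<delta> x} = \<Omega> \<inter> \<delta> -` {3 * a<..}" by auto
  then show "open {x \<in> \<Omega>. \<delta> x < 4 * a}" "open {x \<in> \<Omega>. 3 * a < \<delta> x}"
    using open_\<Omega> \<delta>_continuous[of UNIV] by (simp_all add: open_Int open_vimage)
qed

lemma C1_on_\<Omega>_if_collars:
  assumes "C1_on {x \<in> \<Omega>. \<delta> x < 4 * a} f f'" "C1_on {x \<in> \<Omega>. 3 * a < \<delta> x} f f'"
  shows "C1_on \<Omega> f f'"
proof -
  have "\<Omega> = {x \<in> \<Omega>. \<delta> x < 4 * a} \<union> {x \<in> \<Omega>. 3 * a < \<delta> x}" using a_pos by auto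
  then show ?thesis using C1_on_Un[OF open_collars assms] by simp
qed

lemma C1_on_collar_\<delta>: "C1_on {x \<in> \<Omega>. \<delta> x < 4 * a} \<delta> (\<lambda>x h. \<nu> x \<bullet> h)"
  unfolding C1_on_def using deriv_\<delta> C1_on_continuous[OF C1_\<nu>]
  by (auto simp: \<delta>_def[abs_def] intro!: continuous_intros)

lemma C1_on_const_eq:
  assumes "open S" "\<And>x. x \<in> S \<Longrightarrow> f x = c" "\<And>x h. x \<in> S \<Longrightarrow> f' x h = 0"
  shows "C1_on S f f'"
  unfolding C1_on_def
proof (intro conjI ballI allI)
  fix x assume x: "x \<in> S"
  have "(f has_derivative (\<lambda>h. 0)) (at x)"
    by (rule has_derivative_transform_within_open[of "\<lambda>x. c" _ _ _ S]) (use assms x in auto)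
  moreover have "f' x = (\<lambda>h. 0)" using assms(3)[OF x] by auto
  ultimately show "(f has_derivative f' x) (at x)" by simp
next
  fix h show "continuous_on S (\<lambda>x. f' x h)"
    by (rule continuous_on_eq[of _ "\<lambda>x. 0"]) (use assms in auto)
qed

lemma C1_on_function_of_\<delta>:
  assumes d: "\<And>s. 0 < s \<Longrightarrow> (\<phi> has_real_derivative \<phi>' s) (at s)" and c: "continuous_on {0<..} \<phi>'"
    and z: "\<And>s. 3 * a \<le> s \<Longrightarrow> \<phi>' s = 0"
  shows "C1_on \<Omega> (\<lambda>x. \<phi> (\<delta> x)) (\<lambda>x h. \<phi>' (\<delta> x) * (\<nu> x \<bullet> h))"
proof (rule C1_on_\<Omega>_if_collars)
  show "C1_on {x \<in> \<Omega>. \<delta> x < 4 * a} (\<lambda>x. \<phi> (\<delta> x)) (\<lambda>x h. \<phi>' (\<delta> x) * (\<nu> x \<bullet> h))"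
    by (rule C1_on_real_compose[OF C1_on_collar_\<delta> d continuous_on_subset[OF c]]) (use \<delta>_pos in auto)
  have "\<exists>c. \<forall>s\<in>{3 * a..}. \<phi> s = c"
  proof (rule has_field_derivative_zero_constant)
    show "(\<phi> has_field_derivative 0) (at s within {3 * a..})" if "s \<in> {3 * a..}" for s
      using d[of s] z[of s] that a_pos by (auto intro: has_field_derivative_at_within)
  qed simp
  then obtain c0 where "\<And>s. 3 * a \<le> s \<Longrightarrow> \<phi> s = c0" by auto
  then show "C1_on {x \<in> \<Omega>. 3 * a < \<delta> x} (\<lambda>x. \<phi> (\<delta> x)) (\<lambda>x h. \<phi>' (\<delta> x) * (\<nu> x \<bullet> h))"
    by (intro C1_on_const_eq[where c=c0] open_collars) (use z in auto)
qed

text \<open>Outside the collar \<nu> is an arbitrary function; the vanishing of \<psi> beyond 3a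
  makes the product independent of it.\<close>

lemma C1_on_normal_field:
  assumes d: "\<And>s. 0 < s \<Longrightarrow> (\<psi> has_real_derivative \<psi>' s) (at s)" and c: "continuous_on {0<..} \<psi>'"
    and z: "\<And>s. 3 * a \<le> s \<Longrightarrow> \<psi> s = 0" "\<And>s. 3 * a \<le> s \<Longrightarrow> \<psi>' s = 0"
  shows "C1_on \<Omega> (\<lambda>x. \<psi> (\<delta> x) *\<^sub>R \<nu> x) (\<lambda>x h. \<psi> (\<delta> x) *\<^sub>R \<nu>' x h + (\<psi>' (\<delta> x) * (\<nu> x \<bullet> h)) *\<^sub>R \<nu> x)"
proof (rule C1_on_\<Omega>_if_collars)
  have "C1_on {x \<in> \<Omega>. \<delta> x < 4 * a} (\<lambda>x. \<psi> (\<delta> x)) (\<lambda>x h. \<psi>' (\<delta> x) * (\<nu> x \<bullet> h))"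
    by (rule C1_on_subset[OF C1_on_function_of_\<delta>[OF d c z(2)]]) auto
  from C1_on_scaleR[OF this C1_\<nu>[folded \<delta>_def]]
  show "C1_on {x \<in> \<Omega>. \<delta> x < 4 * a} (\<lambda>x. \<psi> (\<delta> x) *\<^sub>R \<nu> x) (\<lambda>x h. \<psi> (\<delta> x) *\<^sub>R \<nu>' x h + (\<psi>' (\<delta> x) * (\<nu> x \<bullet> h)) *\<^sub>R \<nu> x)" .
  show "C1_on {x \<in> \<Omega>. 3 * a < \<delta> x} (\<lambda>x. \<psi> (\<delta> x) *\<^sub>R \<nu> x) (\<lambda>x h. \<psi> (\<delta> x) *\<^sub>R \<nu>' x h + (\<psi>' (\<delta> x) * (\<nu> x \<bullet> h)) *\<^sub>R \<nu> x)"
    by (intro C1_on_const_eq[where c=0] open_collars) (use z in auto)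
qed

end

text \<open>The shift \<open>c0\<close> makes the affine function nonnegative on
  \<open>\<Omega>\<close>, so that its product with \<open>chi''\<close> preserves the sign of the
  normal second derivative.\<close>

locale barrier = collar \<Omega> a C \<nu> \<nu>' + profile a \<alpha> \<gamma> j
  for \<Omega> :: "'a::euclidean_space set" and a C \<nu> \<nu>' \<alpha> \<gamma> j +
  fixes e :: 'a and c0 Y :: real
  assumes norm_e: "norm e = 1" and y_range: "\<And>x. x \<in> \<Omega> \<Longrightarrow> 0 \<le> e \<bullet> x + c0" "\<And>x. x \<in> \<Omega> \<Longrightarrow> e \<bullet> x + c0 \<le> Y"
begin

definition y :: "'a \<Rightarrow> real" where "y x = e \<bullet> x + c0"

definition v :: "real \<Rightarrow> 'a \<Rightarrow> real" where "v \<epsilon> x = K \<epsilon> (\<delta> x) + y x * chi (\<delta> x)"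

definition X :: "real \<Rightarrow> 'a \<Rightarrow> 'a" where
  "X \<epsilon> x = (k \<epsilon> (\<delta> x) + y x * chi' (\<delta> x)) *\<^sub>R \<nu> x + chi (\<delta> x) *\<^sub>R e"

text \<open>Arranged in the shape that \<open>elliptic_form_bound\<close> expects, with A = k' + y
  chi'', B = chi' and K = k + y chi'.\<close>

definition X' :: "real \<Rightarrow> 'a \<Rightarrow> 'a \<Rightarrow> 'a" where
  "X' \<epsilon> x h = ((k' \<epsilon> (\<delta> x) + y x * chi'' (\<delta> x)) * (\<nu> x \<bullet> h) + chi' (\<delta> x) * (e \<bullet> h)) *\<^sub>R \<nu> x +
    ((k \<epsilon> (\<delta> x) + y x * chi' (\<delta> x)) *\<^sub>R \<nu>' x h + (chi' (\<delta> x) * (\<nu> x \<bullet> h)) *\<^sub>R e)"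

lemma y_bounds: "x \<in> \<Omega> \<Longrightarrow> 0 \<le> y x" "x \<in> \<Omega> \<Longrightarrow> y x \<le> Y"
  using y_range by (auto simp: y_def)

lemma chi_collar: "3 * a \<le> s \<Longrightarrow> chi s = 1 \<and> chi' s = 0 \<and> chi'' s = 0"
  using chi_const[of s] a by auto

lemma C1_y: "C1_on S y (\<lambda>x h. e \<bullet> h)"
  using C1_on_affine[of S e c0] by (simp add: y_def[abs_def])

lemma C1_v:
  assumes "0 \<le> \<epsilon>"
  shows "C1_on \<Omega> (v \<epsilon>) (\<lambda>x h. X \<epsilon> x \<bullet> h)"
proof -
  have 1: "C1_on \<Omega> (\<lambda>x. K \<epsilon> (\<delta> x)) (\<lambda>x h. k \<epsilon> (\<delta> x) * (\<nu> x \<bullet> h))"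
    by (rule C1_on_function_of_\<delta>[OF K_deriv[OF assms] continuous_on_subset[OF k_continuous[OF assms]]]) (auto simp: k_eq_0)
  have 2: "C1_on \<Omega> (\<lambda>x. chi (\<delta> x)) (\<lambda>x h. chi' (\<delta> x) * (\<nu> x \<bullet> h))"
    by (rule C1_on_function_of_\<delta>[OF chi_deriv(1) chi_continuous(1)]) (simp add: chi_collar)
  have "C1_on \<Omega> (\<lambda>x. K \<epsilon> (\<delta> x) + y x *\<^sub>R chi (\<delta> x))
      (\<lambda>x h. k \<epsilon> (\<delta> x) * (\<nu> x \<bullet> h) + (y x *\<^sub>R (chi' (\<delta> x) * (\<nu> x \<bullet> h)) + (e \<bullet> h) *\<^sub>R chi (\<delta> x)))"
    by (rule C1_on_add[OF 1 C1_on_scaleR[OF C1_y 2]])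
  then show ?thesis by (simp add: v_def[abs_def] X_def algebra_simps inner_add_left)
qed

lemma C1_X:
  assumes "0 < \<epsilon>"
  shows "C1_on \<Omega> (X \<epsilon>) (X' \<epsilon>)"
proof -
  note 1 = C1_on_normal_field[OF k_deriv[OF assms] k'_continuous[OF assms] k_eq_0 k'_eq_0]
  have 2: "C1_on \<Omega> (\<lambda>x. chi' (\<delta> x) *\<^sub>R \<nu> x) (\<lambda>x h. chi' (\<delta> x) *\<^sub>R \<nu>' x h + (chi'' (\<delta> x) * (\<nu> x \<bullet> h)) *\<^sub>R \<nu> x)"
    by (rule C1_on_normal_field[OF chi_deriv(2) chi_continuous(2)]) (simp_all add: chi_collar)
  have 3: "C1_on \<Omega> (\<lambda>x. chi (\<delta> x)) (\<lambda>x h. chi' (\<delta> x) * (\<nu> x \<bullet> h))"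
    by (rule C1_on_function_of_\<delta>[OF chi_deriv(1) chi_continuous(1)]) (simp add: chi_collar)
  note 4 = C1_on_add[OF C1_on_add[OF 1 C1_on_scaleR[OF C1_y 2]] C1_on_scaleR[OF 3 C1_on_const[of \<Omega> e]]]
  show ?thesis using 4 by (simp add: X_def[abs_def] X'_def[abs_def] algebra_simps)
qed

text \<open>If \<open>j\<close> is large relative to this number, the decay of \<open>k\<close> dominates the curvature and cut-off terms.\<close>

definition threshold :: "real \<Rightarrow> real" where
  "threshold r = 6 / a * (1 + \<bar>r - 2\<bar>) + C * (real DIM('a) + \<bar>r - 2\<bar>) * (1 + 3 * Y / a)"

text \<open>The part j / (3a) of the decay rate of \<open>k\<close> pays for curvature and cut-off.
  The two singular rates remain, one at the level 2a and one at the boundary.\<close>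

lemma elliptic_X':
  assumes r: "1 < r" and j_large: "threshold r \<le> min 1 (r - 1) * (j / (3 * a))"
    and x: "x \<in> \<Omega>" and \<epsilon>: "0 < \<epsilon>" and \<eta>: "0 < \<eta>"
  shows "divergence (X' \<epsilon> x) + (r - 2) * (X \<epsilon> x \<bullet> X' \<epsilon> x (X \<epsilon> x)) / (\<eta> + X \<epsilon> x \<bullet> X \<epsilon> x) \<le>
    - (min 1 (r - 1) * ((\<alpha> * ((\<delta> x - 2 * a)\<^sup>2 + \<epsilon>\<^sup>2) powr ((\<alpha> - 1) / 2) + (1 - \<gamma>) * \<delta> x powr (- \<gamma>)) * k \<epsilon> (\<delta> x)))"
proof (cases "\<delta> x < 3 * a")
  case False
  then have "X' \<epsilon> x = (\<lambda>h. 0)" by (auto simp: X'_def chi_collar k_eq_0 k'_eq_0)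
  then show ?thesis using False by (simp add: k_eq_0 divergence_def)
next
  case True
  define s where "s = \<delta> x"
  have s: "0 < s" "s < 3 * a" using \<delta>_pos[OF x] True by (auto simp: s_def)
  define P where "P = \<alpha> * ((s - 2 * a)\<^sup>2 + \<epsilon>\<^sup>2) powr ((\<alpha> - 1) / 2) + (1 - \<gamma>) * s powr (- \<gamma>)"
  define m where "m = min 1 (r - 1)"
  have m: "0 < m" using r by (simp add: m_def)
  have P: "0 \<le> P" using \<alpha> \<gamma> by (simp add: P_def)
  have x4: "infdist x (frontier \<Omega>) < 4 * a" using True a by (simp add: \<delta>_def)
  \<comment> \<open>Dividing X by this root turns the quotient with \<eta> + X . X into a quadratic
    form at a vector of norm at most 1.\<close>
  define c where "c = sqrt (\<eta> + X \<epsilon> x \<bullet> X \<epsilon> x)"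
  have c0: "0 < c" using \<eta> by (simp add: c_def add_pos_nonneg)
  have c2: "c * c = \<eta> + X \<epsilon> x \<bullet> X \<epsilon> x" using \<eta> by (simp add: c_def add_pos_nonneg less_imp_le)
  define n where "n = (1 / c) *\<^sub>R X \<epsilon> x"
  have "norm (X \<epsilon> x) \<le> c" unfolding c_def norm_eq_sqrt_inner using \<eta> by simp
  then have n: "norm n \<le> 1" using c0 by (simp add: n_def divide_le_eq)
  have l: "linear (X' \<epsilon> x)" by (rule C1_on_linear[OF C1_X[OF \<epsilon>] x])
  have nX: "n \<bullet> X' \<epsilon> x n = (X \<epsilon> x \<bullet> X' \<epsilon> x (X \<epsilon> x)) / (\<eta> + X \<epsilon> x \<bullet> X \<epsilon> x)"
    by (simp add: n_def linear_scale[OF l] c2[symmetric])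
  have yb: "0 \<le> y x" "y x \<le> Y" using y_bounds[OF x] by auto
  note ch = chi_range[of s]
  have k'le: "k' \<epsilon> s \<le> - ((j / (3 * a) + P) * k \<epsilon> s)"
    using k'_le[OF \<epsilon> s(1)] by (simp add: P_def algebra_simps)
  have kn: "0 \<le> (j / (3 * a) + P) * k \<epsilon> s" using P a j k_nonneg[of \<epsilon> s] by simp
  have A: "k' \<epsilon> s + y x * chi'' s \<le> - ((j / (3 * a) + P) * k \<epsilon> s)"
    using k'le mult_nonneg_nonpos[OF yb(1) ch(6)] s by simp
  have 1: "divergence (X' \<epsilon> x) + (r - 2) * (n \<bullet> X' \<epsilon> x n) \<le>
      min 1 (1 + (r - 2)) * (k' \<epsilon> s + y x * chi'' s) + 2 * chi' s * (1 + \<bar>r - 2\<bar>) +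
      (k \<epsilon> s + y x * chi' s) * (C * (real DIM('a) + \<bar>r - 2\<bar>))"
    unfolding X'_def[abs_def] s_def[symmetric]
    by (rule elliptic_form_bound[OF norm_\<nu>[OF x x4] norm_e n _ \<nu>'_bound[OF x x4]])
      (use r A kn ch s k_nonneg[of \<epsilon> s] yb in auto)
  have 2: "min 1 (1 + (r - 2)) * (k' \<epsilon> s + y x * chi'' s) \<le> m * (- ((j / (3 * a) + P) * k \<epsilon> s))"
    using mult_left_mono[OF A less_imp_le[OF m]] by (simp add: m_def)
  \<comment> \<open>Some cut-off terms carry no factor \<open>k\<close>; but \<open>chi'\<close>
    lives on s \<le> a, where k \<ge> 1 allows inserting one. Beyond a only the curvature term is
    left, which has the factor already.\<close>
  have 3: "2 * chi' s * (1 + \<bar>r - 2\<bar>) + (k \<epsilon> s + y x * chi' s) * (C * (real DIM('a) + \<bar>r - 2\<bar>)) \<le> threshold r * k \<epsilon> s"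
  proof -
    define c1 c2 where "c1 = 1 + \<bar>r - 2\<bar>" and "c2 = C * (real DIM('a) + \<bar>r - 2\<bar>)"
    have cc: "0 \<le> c1" "0 \<le> c2" using C_nonneg by (auto simp: c1_def c2_def)
    have Y0: "0 \<le> Y" using yb by linarith
    show ?thesis
    proof (cases "s \<le> a")
      case True
      then have k1: "1 \<le> k \<epsilon> s" using k_ge_left(2)[of s \<epsilon>] s a by auto
      have ya: "y x * chi' s \<le> Y * (3 / a)" using yb ch s Y0 by (intro mult_mono) auto
      have "2 * chi' s * c1 + (k \<epsilon> s + y x * chi' s) * c2 \<le> 2 * (3 / a) * c1 + (k \<epsilon> s + Y * (3 / a)) * c2"
        using ya cc ch s by (intro add_mono mult_right_mono mult_left_mono) auto
      also have "\<dots> = k \<epsilon> s * c2 + 1 * (6 / a * c1 + 3 * Y / a * c2)" by (simp add: algebra_simps)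
      also have "\<dots> \<le> k \<epsilon> s * c2 + k \<epsilon> s * (6 / a * c1 + 3 * Y / a * c2)"
        using k1 cc a Y0 by (intro add_left_mono mult_right_mono) auto
      finally show ?thesis by (simp add: threshold_def c1_def c2_def algebra_simps)
    next
      case False
      then have "chi' s = 0" using chi_const[of s] by simp
      moreover have "c2 \<le> threshold r"
        unfolding threshold_def c2_def[symmetric] c1_def[symmetric]
        using cc a Y0 by (simp add: distrib_left add_increasing)
      ultimately show ?thesis using k_nonneg[of \<epsilon> s] mult_right_mono[of c2 "threshold r" "k \<epsilon> s"]
        by (simp add: c2_def mult.commute)
    qed
  qed
  have 4: "threshold r * k \<epsilon> s \<le> m * (j / (3 * a)) * k \<epsilon> s"
    using j_large k_nonneg[of \<epsilon> s] unfolding m_def by (intro mult_right_mono)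
  have "m * (- ((j / (3 * a) + P) * k \<epsilon> s)) = - (m * (j / (3 * a)) * k \<epsilon> s) - m * (P * k \<epsilon> s)"
    by (simp add: algebra_simps)
  then have "divergence (X' \<epsilon> x) + (r - 2) * (n \<bullet> X' \<epsilon> x n) \<le> - (m * (P * k \<epsilon> s))"
    using 1 2 3 4 by linarith
  then show ?thesis unfolding nX by (simp add: P_def s_def m_def)
qed

end

context barrier
begin

definition X_max :: real where "X_max = 3 powr j * exp 2 + Y * (3 / a) + 1"

text \<open>\<open>\<nu>\<close> and \<open>e\<close> are unit vectors, so by the reverse triangle
  inequality the norm is at least the difference of their coefficients. That difference is nonzero
  except at the level 2a.\<close>

lemma X_norm:
  assumes x: "x \<in> \<Omega>"
  shows "norm (X \<epsilon> x) \<le> X_max"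
    and "\<delta> x \<le> a \<Longrightarrow> 1 \<le> norm (X \<epsilon> x)"
    and "5 * a / 2 \<le> \<delta> x \<Longrightarrow> 1 / 2 \<le> norm (X \<epsilon> x)"
    and "a \<le> \<delta> x \<Longrightarrow> \<delta> x \<le> 3 * a \<Longrightarrow> \<bar>k \<epsilon> (\<delta> x) - 1\<bar> \<le> norm (X \<epsilon> x)"
proof -
  note s = \<delta>_nonneg[of x] and ch = chi_range[OF \<delta>_nonneg[of x]] and yb = y_bounds[OF x]
  let ?A = "k \<epsilon> (\<delta> x) + y x * chi' (\<delta> x)"
  have A0: "0 \<le> ?A" using k_nonneg ch yb by simp
  have Ale: "?A \<le> 3 powr j * exp 2 + Y * (3 / a)"
    using ch yb k_le[OF s, of \<epsilon>] by (intro add_mono mult_mono) auto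
  \<comment> \<open>Outside the collar \<open>\<nu>\<close> may have any length, but there its
    coefficient is 0.\<close>
  have nu: "norm (\<nu> x) = 1 \<or> (?A = 0 \<and> chi (\<delta> x) = 1)"
  proof (cases "\<delta> x < 4 * a")
    case True
    then show ?thesis using norm_\<nu>[OF x] by (simp add: \<delta>_def)
  next
    case False
    then have "3 * a \<le> \<delta> x" using a by simp
    then show ?thesis by (simp add: k_eq_0 chi_collar)
  qed
  then have n1: "norm (?A *\<^sub>R \<nu> x) = ?A" using A0 by auto
  have n2: "norm (chi (\<delta> x) *\<^sub>R e) = chi (\<delta> x)" using ch norm_e by simp
  have up: "norm (X \<epsilon> x) \<le> ?A + chi (\<delta> x)" unfolding X_def using norm_triangle_ineq[of "?A *\<^sub>R \<nu> x" "chi (\<delta> x) *\<^sub>R e"] n1 n2 by simp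
  have low: "\<bar>?A - chi (\<delta> x)\<bar> \<le> norm (X \<epsilon> x)"
    unfolding X_def using norm_triangle_ineq3[of "?A *\<^sub>R \<nu> x" "- (chi (\<delta> x) *\<^sub>R e)"] n1 n2 by simp
  show "norm (X \<epsilon> x) \<le> X_max" unfolding X_max_def using up Ale ch by linarith
  show "1 \<le> norm (X \<epsilon> x)" if "\<delta> x \<le> a"
  proof -
    have "2 \<le> k \<epsilon> (\<delta> x)" using that s a by (intro k_ge_left(2)) auto
    moreover have "0 \<le> y x * chi' (\<delta> x)" using yb ch by simp
    ultimately show ?thesis using low ch by linarith
  qed
  show m: "\<bar>k \<epsilon> (\<delta> x) - 1\<bar> \<le> norm (X \<epsilon> x)" if "a \<le> \<delta> x"
    using low chi_const[OF that] by simp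
  show "1 / 2 \<le> norm (X \<epsilon> x)" if "5 * a / 2 \<le> \<delta> x"
  proof -
    have "2 * a \<le> \<delta> x" "a \<le> \<delta> x" using that a by auto
    then show ?thesis using m k_le_right(2)[of "\<delta> x" \<epsilon>] that by auto
  qed
qed

lemma v_bounded: obtains Vm where "\<And>\<epsilon> x. 0 \<le> \<epsilon> \<Longrightarrow> x \<in> \<Omega> \<Longrightarrow> 0 \<le> v \<epsilon> x \<and> v \<epsilon> x \<le> Vm"
proof -
  obtain D where D: "0 < D" "\<And>x. x \<in> closure \<Omega> \<Longrightarrow> \<delta> x \<le> D" by (rule \<delta>_bounded) (rule that)
  have "0 \<le> v \<epsilon> x \<and> v \<epsilon> x \<le> 3 powr j * exp 2 * D + Y * 1" if e: "0 \<le> \<epsilon>" and x: "x \<in> \<Omega>" for \<epsilon> x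
  proof -
    note yb = y_bounds[OF x] and ch = chi_range[OF \<delta>_nonneg[of x]] and K = K_bounds[OF e \<delta>_nonneg[of x]]
    have "\<delta> x \<le> D" using D(2) x closure_subset by blast
    then have "3 powr j * exp 2 * \<delta> x \<le> 3 powr j * exp 2 * D" by (intro mult_left_mono) auto
    then have "K \<epsilon> (\<delta> x) \<le> 3 powr j * exp 2 * D" using K by linarith
    moreover have "y x * chi (\<delta> x) \<le> Y * 1" using yb ch by (intro mult_mono) auto
    ultimately show ?thesis unfolding v_def using K yb ch by (auto intro: add_mono)
  qed
  then show thesis by (rule that)
qed

text \<open>The bound of \<open>elliptic_X'\<close> together with the contribution of the
  exponential. Multiplied by \<open>weight\<close> and exp(-(r - 1) v), it bounds minus the
  divergence of the regularised flux from below.\<close>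

definition op_lower :: "real \<Rightarrow> real \<Rightarrow> 'a \<Rightarrow> real" where
  "op_lower r \<epsilon> x = min 1 (r - 1) * ((\<alpha> * ((\<delta> x - 2 * a)\<^sup>2 + \<epsilon>\<^sup>2) powr ((\<alpha> - 1) / 2) + (1 - \<gamma>) * \<delta> x powr (- \<gamma>)) * k \<epsilon> (\<delta> x)) +
    (r - 1) * (X \<epsilon> x \<bullet> X \<epsilon> x)"

definition weight :: "real \<Rightarrow> real \<Rightarrow> 'a \<Rightarrow> real" where
  "weight r \<epsilon> x = (\<epsilon> powr (2 * \<alpha>) + X \<epsilon> x \<bullet> X \<epsilon> x) powr ((r - 2) / 2)"

text \<open>There are three zones, with constants independent of \<epsilon>. Up to a the gradient is
  bounded below and the boundary term gives the rate; between a and 5a/2 the steepness of the root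
  outweighs the degenerate weight; beyond 5a/2 the exponential term acts on a gradient of norm at
  least 1/2.\<close>

lemma weighted_op_lower:
  assumes q: "1 < q" and \<alpha>q: "\<alpha> * (q - 1) \<le> 1"
  shows "\<exists>c>0. \<forall>\<epsilon> x. 0 < \<epsilon> \<and> \<epsilon> \<le> 1 \<and> x \<in> \<Omega> \<longrightarrow> c * \<delta> x powr (- \<gamma>) \<le> weight q \<epsilon> x * op_lower q \<epsilon> x"
proof -
  define b where "b = (q - 2) / 2"
  define m where "m = min 1 (q - 1)"
  define h where "h = 1 + X_max\<^sup>2"
  define k0 where "k0 = (1 / 2) powr j * exp (- 2 :: real)"
  define \<beta> where "\<beta> = (\<alpha> - 1) / 2"
  have m: "0 < m" "m \<le> 1" using q by (auto simp: m_def)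
  have h: "1 \<le> h" by (simp add: h_def)
  have k0: "0 < k0" by (simp add: k0_def)
  define w1 where "w1 = min (1 powr b) (h powr b)"
  define w3 where "w3 = min ((1 / 4) powr b) (h powr b)"
  \<comment> \<open>For q \<ge> 2 the weight may degenerate and is paired with R powr \<beta>; for q
    < 2 its exponent is negative, and the upper bound h of its base suffices.\<close>
  define w2 where "w2 = (if 2 \<le> q then (1 / 4) powr b * 2 powr (\<alpha> * b + \<beta>) else h powr b * 2 powr \<beta>)"
  have w: "0 < w1" "0 < w2" "0 < w3" using h by (auto simp: w1_def w2_def w3_def)
  define c1 where "c1 = w1 * (m * (1 - \<gamma>))"
  \<comment> \<open>Away from the boundary \<delta>^(-\<gamma>) is at most a^(-\<gamma>), hence the
    division here and in \<open>c3\<close>.\<close>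
  define c2 where "c2 = w2 * (m * \<alpha> * k0) / a powr (- \<gamma>)"
  define c3 where "c3 = w3 * ((q - 1) / 4) / a powr (- \<gamma>)"
  have c: "0 < c1" "0 < c2" "0 < c3" using w m k0 \<alpha> \<gamma> q a by (auto simp: c1_def c2_def c3_def)
  have main: "min c1 (min c2 c3) * \<delta> x powr (- \<gamma>) \<le> weight q \<epsilon> x * op_lower q \<epsilon> x"
    if \<epsilon>: "0 < \<epsilon>" "\<epsilon> \<le> 1" and x: "x \<in> \<Omega>" for \<epsilon> x
  proof -
    define s where "s = \<delta> x"
    define R where "R = (s - 2 * a)\<^sup>2 + \<epsilon>\<^sup>2"
    define Q where "Q = \<epsilon> powr (2 * \<alpha>) + X \<epsilon> x \<bullet> X \<epsilon> x"
    define N where "N = norm (X \<epsilon> x)"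
    have s0: "0 < s" using \<delta>_pos[OF x] by (simp add: s_def)
    have N: "X \<epsilon> x \<bullet> X \<epsilon> x = N\<^sup>2" "0 \<le> N" by (simp_all add: N_def dot_square_norm)
    have \<eta>: "0 < \<epsilon> powr (2 * \<alpha>)" "\<epsilon> powr (2 * \<alpha>) \<le> 1"
      using \<epsilon> \<alpha> powr_mono2[of "2 * \<alpha>" \<epsilon> 1] by auto
    have "N\<^sup>2 \<le> X_max\<^sup>2" using X_norm(1)[OF x, of \<epsilon>] N(2) by (intro power_mono) (auto simp: N_def)
    then have Qh: "Q \<le> h" using \<eta> by (simp add: Q_def h_def N)
    have Q0: "0 < Q" using \<eta> by (simp add: Q_def add_pos_nonneg)
    have QN: "N\<^sup>2 \<le> Q" using \<eta> by (simp add: Q_def N)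
    have W: "weight q \<epsilon> x = Q powr b" by (simp add: weight_def Q_def b_def)
    have L: "op_lower q \<epsilon> x = m * (\<alpha> * R powr \<beta>) * k \<epsilon> s + m * ((1 - \<gamma>) * s powr (- \<gamma>)) * k \<epsilon> s + (q - 1) * N\<^sup>2"
      by (simp add: op_lower_def m_def R_def \<beta>_def s_def N algebra_simps)
    have nn: "0 \<le> m * (\<alpha> * R powr \<beta>) * k \<epsilon> s" "0 \<le> m * ((1 - \<gamma>) * s powr (- \<gamma>)) * k \<epsilon> s" "0 \<le> (q - 1) * N\<^sup>2"
      using m \<alpha> \<gamma> q k_nonneg by auto
    have mono: "min c1 (min c2 c3) * s powr (- \<gamma>) \<le> z"
      if "c1 * s powr (- \<gamma>) \<le> z \<or> c2 * s powr (- \<gamma>) \<le> z \<or> c3 * s powr (- \<gamma>) \<le> z" for z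
    proof -
      have "min c1 (min c2 c3) * s powr (- \<gamma>) \<le> c' * s powr (- \<gamma>)" if "min c1 (min c2 c3) \<le> c'" for c'
        using that by (rule mult_right_mono) simp
      moreover have "min c1 (min c2 c3) \<le> c1" "min c1 (min c2 c3) \<le> c2" "min c1 (min c2 c3) \<le> c3" by simp_all
      ultimately show ?thesis using that order_trans by blast
    qed
    have far: "s powr (- \<gamma>) \<le> a powr (- \<gamma>)" if "a \<le> s" using that a \<gamma> by (intro powr_mono2') auto
    have ap: "0 < a powr (- \<gamma>)" using a by simp
    have "min c1 (min c2 c3) * s powr (- \<gamma>) \<le> Q powr b * op_lower q \<epsilon> x"
    proof (rule mono)
      consider "s \<le> a" | "a \<le> s" "s \<le> 5 * a / 2" | "5 * a / 2 \<le> s" by linarith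
      then show "c1 * s powr (- \<gamma>) \<le> Q powr b * op_lower q \<epsilon> x \<or> c2 * s powr (- \<gamma>) \<le> Q powr b * op_lower q \<epsilon> x \<or>
          c3 * s powr (- \<gamma>) \<le> Q powr b * op_lower q \<epsilon> x"
      proof cases
        case 1
        have "1 \<le> N" using X_norm(2)[OF x] 1 by (simp add: N_def s_def)
        then have "1 \<le> N\<^sup>2" by simp
        then have "1 \<le> Q" using QN by linarith
        then have wq: "w1 \<le> Q powr b" unfolding w1_def using Qh by (intro powr_between) auto
        have "1 \<le> k \<epsilon> s" using k_ge_left(2)[of s \<epsilon>] 1 s0 a by auto
        then have "m * ((1 - \<gamma>) * s powr (- \<gamma>)) * 1 \<le> m * ((1 - \<gamma>) * s powr (- \<gamma>)) * k \<epsilon> s"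
          using m \<gamma> by (intro mult_left_mono) auto
        then have "m * (1 - \<gamma>) * s powr (- \<gamma>) \<le> op_lower q \<epsilon> x" using nn by (simp add: L mult.assoc)
        then have "w1 * (m * (1 - \<gamma>) * s powr (- \<gamma>)) \<le> Q powr b * op_lower q \<epsilon> x"
          using wq w m \<gamma> by (intro mult_mono) auto
        then show ?thesis by (simp add: c1_def mult.assoc)
      next
        case 2
        have R: "0 < R" "R \<le> 2"
        proof -
          show "0 < R" using \<epsilon> by (simp add: R_def add_nonneg_pos)
          have "(s - 2 * a)\<^sup>2 \<le> 1" using 2 a by (intro abs_square_le_1[THEN iffD2]) auto
          moreover have "\<epsilon>\<^sup>2 \<le> 1" using \<epsilon> by (simp add: power_le_one)
          ultimately show "R \<le> 2" by (simp add: R_def)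
        qed
        have \<beta>: "\<beta> \<le> 0" using \<alpha> by (simp add: \<beta>_def)
        have kk: "k0 \<le> k \<epsilon> s" unfolding k0_def using 2 s0 by (intro k_ge_middle) auto
        have wr: "w2 \<le> Q powr b * R powr \<beta>"
        proof (cases "2 \<le> q")
          case True
          then have b: "0 \<le> b" by (simp add: b_def)
          have "\<bar>root_profile \<alpha> \<epsilon> (s - 2 * a)\<bar> / 2 \<le> N"
            using k_away_from_1[of s \<epsilon>] X_norm(4)[OF x, of \<epsilon>] 2 s0 a by (simp add: s_def N_def)
          then have "(\<bar>root_profile \<alpha> \<epsilon> (s - 2 * a)\<bar> / 2)\<^sup>2 \<le> N\<^sup>2" by (intro power_mono) auto
          then have "(root_profile \<alpha> \<epsilon> (s - 2 * a))\<^sup>2 / 4 \<le> N\<^sup>2" by (simp add: power_divide)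
          moreover have "R powr \<alpha> \<le> \<epsilon> powr (2 * \<alpha>) + (root_profile \<alpha> \<epsilon> (s - 2 * a))\<^sup>2"
            unfolding R_def using \<epsilon> \<alpha> by (intro root_profile_sq_ge) auto
          ultimately have "1 / 4 * R powr \<alpha> \<le> Q" unfolding Q_def N(1) using \<eta> by linarith
          then have "(1 / 4 * R powr \<alpha>) powr b \<le> Q powr b" using b by (intro powr_mono2) auto
          moreover have "(1 / 4 * R powr \<alpha>) powr b = (1 / 4) powr b * R powr (\<alpha> * b)"
            by (simp only: powr_mult powr_powr)
          ultimately have "(1 / 4) powr b * R powr (\<alpha> * b) \<le> Q powr b" by simp
          then have "(1 / 4) powr b * R powr (\<alpha> * b) * R powr \<beta> \<le> Q powr b * R powr \<beta>" by (intro mult_right_mono) auto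
          then have *: "(1 / 4) powr b * R powr (\<alpha> * b + \<beta>) \<le> Q powr b * R powr \<beta>" by (simp add: powr_add mult.assoc)
          \<comment> \<open>This is where the assumption on \<alpha> enters: a nonpositive exponent
            turns R \<le> 2 into a positive lower bound.\<close>
          have "\<alpha> * b + \<beta> = (\<alpha> * (q - 1) - 1) / 2" by (simp add: b_def \<beta>_def field_simps)
          then have "\<alpha> * b + \<beta> \<le> 0" using \<alpha>q by simp
          then have "2 powr (\<alpha> * b + \<beta>) \<le> R powr (\<alpha> * b + \<beta>)" using R by (intro powr_mono2') auto
          then have "(1 / 4) powr b * 2 powr (\<alpha> * b + \<beta>) \<le> (1 / 4) powr b * R powr (\<alpha> * b + \<beta>)" by (intro mult_left_mono) auto
          also note *
          finally show ?thesis by (simp only: w2_def True if_True)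
        next
          case False
          then have "b \<le> 0" by (simp add: b_def)
          then have "h powr b \<le> Q powr b" using Q0 Qh by (intro powr_mono2')
          moreover have "2 powr \<beta> \<le> R powr \<beta>" using R \<beta> by (intro powr_mono2')
          ultimately have "h powr b * 2 powr \<beta> \<le> Q powr b * R powr \<beta>" by (intro mult_mono) auto
          then show ?thesis using False by (simp add: w2_def)
        qed
        have "c2 * s powr (- \<gamma>) \<le> c2 * a powr (- \<gamma>)" using c far[OF 2(1)] by (intro mult_left_mono) auto
        also have "\<dots> = w2 * (m * \<alpha> * k0)" using ap by (simp add: c2_def)
        also have "\<dots> \<le> (Q powr b * R powr \<beta>) * (m * \<alpha> * k \<epsilon> s)"
          using wr kk m \<alpha> k0 w by (intro mult_mono mult_left_mono) auto
        also have "\<dots> = Q powr b * (m * (\<alpha> * R powr \<beta>) * k \<epsilon> s)" by (simp add: algebra_simps)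
        also have "\<dots> \<le> Q powr b * op_lower q \<epsilon> x" using nn by (intro mult_left_mono) (auto simp: L)
        finally show ?thesis by blast
      next
        case 3
        have "1 / 2 \<le> N" using X_norm(3)[OF x] 3 by (simp add: N_def s_def)
        then have "(1 / 2)\<^sup>2 \<le> N\<^sup>2" by (intro power_mono) auto
        then have N4: "1 / 4 \<le> N\<^sup>2" by (simp add: power2_eq_square)
        then have wq: "w3 \<le> Q powr b" unfolding w3_def using Qh QN by (intro powr_between) auto
        have "(q - 1) / 4 \<le> (q - 1) * N\<^sup>2" using N4 q mult_left_mono[of "1/4" "N\<^sup>2" "q - 1"] by simp
        then have "(q - 1) / 4 \<le> op_lower q \<epsilon> x" using nn by (simp add: L)
        then have *: "w3 * ((q - 1) / 4) \<le> Q powr b * op_lower q \<epsilon> x" using wq w q by (intro mult_mono) auto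
        have "c3 * s powr (- \<gamma>) \<le> c3 * a powr (- \<gamma>)" using c far 3 a by (intro mult_left_mono) auto
        also have "\<dots> = w3 * ((q - 1) / 4)" using ap by (simp add: c3_def)
        finally show ?thesis using * by linarith
      qed
    qed
    then show ?thesis by (simp add: W s_def)
  qed
  show ?thesis using c main by (intro exI[of _ "min c1 (min c2 c3)"]) auto
qed

lemma op_lower_nonneg: "1 < r \<Longrightarrow> 0 \<le> op_lower r \<epsilon> x"
  unfolding op_lower_def using \<alpha> \<gamma> k_nonneg by (intro add_nonneg_nonneg mult_nonneg_nonneg) auto

definition flux :: "real \<Rightarrow> 'a \<Rightarrow> 'a" where "flux r x = reg_flux r 0 (v 0 x) (X 0 x)"

lemma X_v_tendsto:
  assumes "\<epsilon> \<longlonglongrightarrow> 0" "\<And>n. 0 \<le> \<epsilon> n"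
  shows "(\<lambda>n. X (\<epsilon> n) x) \<longlonglongrightarrow> X 0 x" "(\<lambda>n. v (\<epsilon> n) x) \<longlonglongrightarrow> v 0 x"
  unfolding X_def v_def by (intro tendsto_intros k_tendsto K_tendsto assms)+

text \<open>Applied with c = 0 for p and c > 0 for q. The integrands are dominated by a constant
  times the norm of \<open>H\<close>, because the bounds on \<open>X\<close> and \<open>v\<close>
  are uniform in \<epsilon>.\<close>

lemma flux_weak_lower:
  assumes r: "1 < r" and j_large: "threshold r \<le> min 1 (r - 1) * (j / (3 * a))"
    and c: "0 \<le> c" "\<And>\<epsilon> x. 0 < \<epsilon> \<Longrightarrow> \<epsilon> \<le> 1 \<Longrightarrow> x \<in> \<Omega> \<Longrightarrow> c * \<delta> x powr (- \<gamma>) \<le> exp (- (r - 1) * v \<epsilon> x) * (weight r \<epsilon> x * op_lower r \<epsilon> x)"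
    and q: "1 < q" and adm: "admissible_test q \<Omega> xi H"
  shows "integrable (lebesgue_on \<Omega>) (\<lambda>x. flux r x \<bullet> H x)"
    "integrable (lebesgue_on \<Omega>) (\<lambda>x. \<delta> x powr (- \<gamma>) * xi x)"
    "c * (\<integral>x. \<delta> x powr (- \<gamma>) * xi x \<partial>lebesgue_on \<Omega>) \<le> (\<integral>x. flux r x \<bullet> H x \<partial>lebesgue_on \<Omega>)"
proof -
  obtain S phi Dphi where S: "compact S" "S \<subseteq> \<Omega>" and xi0: "\<And>x. 0 \<le> xi x"
    and xi: "\<And>x. x \<notin> S \<Longrightarrow> xi x = 0" "\<And>x. x \<notin> S \<Longrightarrow> H x = 0"
    "integrable (lebesgue_on \<Omega>) xi" "integrable (lebesgue_on \<Omega>) H"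
    by (rule admissible_testE[OF adm q open_\<Omega>]) (rule that)
  have cd: "continuous_on \<Omega> (\<lambda>x. \<delta> x powr (- \<gamma>))"
    using \<delta>_pos by (intro continuous_intros \<delta>_continuous) (auto simp: less_imp_neq[symmetric])
  obtain B where B: "\<And>x. x \<in> S \<Longrightarrow> norm (\<delta> x powr (- \<gamma>)) \<le> B"
    using compact_imp_bounded[OF compact_continuous_image[OF continuous_on_subset[OF cd S(2)] S(1)]]
    unfolding bounded_iff by auto
  show id: "integrable (lebesgue_on \<Omega>) (\<lambda>x. \<delta> x powr (- \<gamma>) * xi x)"
    using integrable_inner_compact_support(1)[OF xi(3,1) continuous_on_measurable_lebesgue_on[OF cd open_\<Omega>] B] by simp
  obtain Vm where Vm: "\<And>\<epsilon> x. 0 \<le> \<epsilon> \<Longrightarrow> x \<in> \<Omega> \<Longrightarrow> 0 \<le> v \<epsilon> x \<and> v \<epsilon> x \<le> Vm" by (rule v_bounded) (rule that)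
  define \<epsilon> where "\<epsilon> n = inverse (real (Suc n))" for n
  have e: "0 < \<epsilon> n" "\<epsilon> n \<le> 1" for n by (auto simp: \<epsilon>_def divide_simps)
  have e0: "\<epsilon> \<longlonglongrightarrow> 0" unfolding \<epsilon>_def by (rule LIMSEQ_inverse_real_of_nat)
  define \<eta> where "\<eta> n = \<epsilon> n powr (2 * \<alpha>)" for n
  have eta: "0 < \<eta> n" "\<eta> n \<le> 1" for n
    using e[of n] \<alpha> powr_mono2[of "2 * \<alpha>" "\<epsilon> n" 1] by (auto simp: \<eta>_def)
  have eta0: "\<eta> \<longlonglongrightarrow> 0"
  proof -
    have "(\<lambda>n. \<epsilon> n powr (2 * \<alpha>)) \<longlonglongrightarrow> 0 powr (2 * \<alpha>)"
      using \<alpha> e by (intro tendsto_powr2 e0 tendsto_const) (auto intro!: always_eventually less_imp_le)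
    then show ?thesis by (simp add: \<eta>_def[abs_def])
  qed
  define V where "V n x = reg_flux r (\<eta> n) (v (\<epsilon> n) x) (X (\<epsilon> n) x)" for n x
  have step: "integrable (lebesgue_on \<Omega>) (\<lambda>x. V n x \<bullet> H x) \<and> continuous_on \<Omega> (V n) \<and>
      c * (\<integral>x. \<delta> x powr (- \<gamma>) * xi x \<partial>lebesgue_on \<Omega>) \<le> (\<integral>x. V n x \<bullet> H x \<partial>lebesgue_on \<Omega>)" for n
  proof -
    obtain V' where reg: "C1_on \<Omega> (\<lambda>x. reg_flux r (\<eta> n) (v (\<epsilon> n) x) (X (\<epsilon> n) x)) V'" and
      div: "\<And>x. x \<in> \<Omega> \<Longrightarrow> divergence (V' x) = exp (- (r - 1) * v (\<epsilon> n) x) * (\<eta> n + X (\<epsilon> n) x \<bullet> X (\<epsilon> n) x) powr ((r - 2) / 2) *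
        (divergence (X' (\<epsilon> n) x) + (r - 2) * (X (\<epsilon> n) x \<bullet> X' (\<epsilon> n) x (X (\<epsilon> n) x)) / (\<eta> n + X (\<epsilon> n) x \<bullet> X (\<epsilon> n) x) -
          (r - 1) * (X (\<epsilon> n) x \<bullet> X (\<epsilon> n) x))"
      by (rule divergence_reg_flux[OF C1_X[OF e(1)] C1_v[OF less_imp_le[OF e(1)]] eta(1)]) (rule that)
    from reg have V': "C1_on \<Omega> (V n) V'" by (simp add: V_def[abs_def])
    have low: "c * \<delta> x powr (- \<gamma>) \<le> - divergence (V' x)" if x: "x \<in> \<Omega>" for x
    proof -
      let ?E = "exp (- (r - 1) * v (\<epsilon> n) x)"
      let ?Q = "divergence (X' (\<epsilon> n) x) + (r - 2) * (X (\<epsilon> n) x \<bullet> X' (\<epsilon> n) x (X (\<epsilon> n) x)) / (\<eta> n + X (\<epsilon> n) x \<bullet> X (\<epsilon> n) x) -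
          (r - 1) * (X (\<epsilon> n) x \<bullet> X (\<epsilon> n) x)"
      have "op_lower r (\<epsilon> n) x \<le> - ?Q"
        using elliptic_X'[OF r j_large x e(1)[of n] eta(1)[of n]] by (simp add: op_lower_def)
      then have "?E * (weight r (\<epsilon> n) x * op_lower r (\<epsilon> n) x) \<le> ?E * (weight r (\<epsilon> n) x * - ?Q)"
        by (intro mult_left_mono) (auto simp: weight_def)
      also have "\<dots> = - divergence (V' x)" unfolding div[OF x] weight_def \<eta>_def by (simp only: mult.assoc mult_minus_right)
      finally show ?thesis using c(2)[OF e[of n] x] by linarith
    qed
    note ibp = admissible_integration_by_parts[OF open_\<Omega> V' adm q]
    have "c * (\<integral>x. \<delta> x powr (- \<gamma>) * xi x \<partial>lebesgue_on \<Omega>) = (\<integral>x. c * (\<delta> x powr (- \<gamma>) * xi x) \<partial>lebesgue_on \<Omega>)" by simp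
    also have "\<dots> \<le> (\<integral>x. - (divergence (V' x) * xi x) \<partial>lebesgue_on \<Omega>)"
    proof (rule integral_mono)
      fix x assume "x \<in> space (lebesgue_on \<Omega>)"
      then have "x \<in> \<Omega>" by simp
      from mult_right_mono[OF low[OF this] xi0[of x]]
      show "c * (\<delta> x powr (- \<gamma>) * xi x) \<le> - (divergence (V' x) * xi x)" by (simp add: mult.assoc)
    qed (use id ibp in auto)
    also have "\<dots> = (\<integral>x. V n x \<bullet> H x \<partial>lebesgue_on \<Omega>)" using ibp(3) by simp
    finally show ?thesis using ibp(1) C1_on_continuous[OF V'] by simp
  qed
  have lim: "(\<lambda>n. V n x) \<longlonglongrightarrow> flux r x" for x
    unfolding V_def flux_def
    by (rule reg_flux_tendsto[OF r less_imp_le[OF eta(1)] eta0 X_v_tendsto(2,1)[OF e0 less_imp_le[OF e(1)]]])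
  have bound: "norm (V n x) \<le> (1 + X_max\<^sup>2) powr ((r - 1) / 2)" if x: "x \<in> \<Omega>" for n x
  proof -
    have "norm (V n x) \<le> exp (- (r - 1) * v (\<epsilon> n) x) * (\<eta> n + X (\<epsilon> n) x \<bullet> X (\<epsilon> n) x) powr ((r - 1) / 2)"
      unfolding V_def by (rule norm_reg_flux_le[OF less_imp_le[OF eta(1)]])
    also have "\<dots> \<le> 1 * (1 + X_max\<^sup>2) powr ((r - 1) / 2)"
    proof (rule mult_mono)
      have "0 \<le> v (\<epsilon> n) x" using Vm[OF less_imp_le[OF e(1)] x] by simp
      then show "exp (- (r - 1) * v (\<epsilon> n) x) \<le> 1" using r by (simp add: mult_nonpos_nonneg)
      have "(norm (X (\<epsilon> n) x))\<^sup>2 \<le> X_max\<^sup>2" using X_norm(1)[OF x] by (intro power_mono) auto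
      then show "(\<eta> n + X (\<epsilon> n) x \<bullet> X (\<epsilon> n) x) powr ((r - 1) / 2) \<le> (1 + X_max\<^sup>2) powr ((r - 1) / 2)"
        using r eta[of n] by (intro powr_mono2) (auto simp: dot_square_norm)
    qed auto
    finally show ?thesis by simp
  qed
  have mH: "H \<in> borel_measurable (lebesgue_on \<Omega>)" using xi(4) by auto
  have mV: "V n \<in> borel_measurable (lebesgue_on \<Omega>)" for n
    using step[of n] open_\<Omega> by (auto intro: continuous_on_measurable_lebesgue_on)
  have mf: "flux r \<in> borel_measurable (lebesgue_on \<Omega>)"
    by (rule borel_measurable_LIMSEQ_metric[of V]) (use mV lim in auto)
  have iH: "integrable (lebesgue_on \<Omega>) (\<lambda>x. (1 + X_max\<^sup>2) powr ((r - 1) / 2) * norm (H x))" using xi(4) by auto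
  have AElim: "AE x in lebesgue_on \<Omega>. (\<lambda>n. V n x \<bullet> H x) \<longlonglongrightarrow> flux r x \<bullet> H x"
    by (intro AE_I2 tendsto_inner lim tendsto_const)
  have AEb: "AE x in lebesgue_on \<Omega>. norm (V n x \<bullet> H x) \<le> (1 + X_max\<^sup>2) powr ((r - 1) / 2) * norm (H x)" for n
  proof (rule AE_I2)
    fix x assume "x \<in> space (lebesgue_on \<Omega>)"
    then have "norm (V n x) * norm (H x) \<le> (1 + X_max\<^sup>2) powr ((r - 1) / 2) * norm (H x)"
      using bound by (intro mult_right_mono) auto
    then show "norm (V n x \<bullet> H x) \<le> (1 + X_max\<^sup>2) powr ((r - 1) / 2) * norm (H x)"
      using Cauchy_Schwarz_ineq2[of "V n x" "H x"] by simp
  qed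
  have mfH: "(\<lambda>x. flux r x \<bullet> H x) \<in> borel_measurable (lebesgue_on \<Omega>)" using mf mH by (rule borel_measurable_inner)
  have mVH: "(\<lambda>x. V n x \<bullet> H x) \<in> borel_measurable (lebesgue_on \<Omega>)" for n using mV mH by (rule borel_measurable_inner)
  show "integrable (lebesgue_on \<Omega>) (\<lambda>x. flux r x \<bullet> H x)"
    by (rule integrable_dominated_convergence[OF mfH mVH iH AElim AEb])
  have "(\<lambda>n. \<integral>x. V n x \<bullet> H x \<partial>lebesgue_on \<Omega>) \<longlonglongrightarrow> (\<integral>x. flux r x \<bullet> H x \<partial>lebesgue_on \<Omega>)"
    by (rule integral_dominated_convergence[OF mfH mVH iH AElim AEb])
  then show "c * (\<integral>x. \<delta> x powr (- \<gamma>) * xi x \<partial>lebesgue_on \<Omega>) \<le> (\<integral>x. flux r x \<bullet> H x \<partial>lebesgue_on \<Omega>)"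
    by (rule Lim_bounded2[where N=0]) (use step in auto)
qed

end

section \<open>Hoelder continuity of the gradients\<close>

text \<open>Sup bound and seminorm share one constant, so that products and compositions stay in the
  class.\<close>

definition hoelder :: "'a::metric_space set \<Rightarrow> real \<Rightarrow> ('a \<Rightarrow> 'b::real_normed_vector) \<Rightarrow> bool" where
  "hoelder S l f \<longleftrightarrow> (\<exists>B\<ge>0. \<forall>x\<in>S. norm (f x) \<le> B \<and> (\<forall>y\<in>S. norm (f x - f y) \<le> B * dist x y powr l))"

lemma hoelderI:
  assumes "\<And>x. x \<in> S \<Longrightarrow> norm (f x) \<le> B" "\<And>x y. x \<in> S \<Longrightarrow> y \<in> S \<Longrightarrow> norm (f x - f y) \<le> L * dist x y powr l"
  shows "hoelder S l f"
  unfolding hoelder_def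
proof (intro exI conjI ballI)
  let ?M = "max 0 (max B L)"
  show "0 \<le> ?M" by simp
  fix x assume x: "x \<in> S"
  show "norm (f x) \<le> ?M" using assms(1)[OF x] by simp
  fix y assume y: "y \<in> S"
  have "L * dist x y powr l \<le> ?M * dist x y powr l" by (intro mult_right_mono) auto
  then show "norm (f x - f y) \<le> ?M * dist x y powr l" using assms(2)[OF x y] by linarith
qed

lemma hoelderE:
  assumes "hoelder S l f"
  obtains B where "0 \<le> B" "\<And>x. x \<in> S \<Longrightarrow> norm (f x) \<le> B"
    "\<And>x y. x \<in> S \<Longrightarrow> y \<in> S \<Longrightarrow> norm (f x - f y) \<le> B * dist x y powr l"
  using assms unfolding hoelder_def by blast

lemma powr_le_bounded:
  fixes d :: real
  assumes "0 \<le> d" "d \<le> D" "0 < l" "l \<le> b"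
  shows "d powr b \<le> D powr (b - l) * d powr l"
proof (cases "d = 0")
  case False
  then have "d powr b = d powr (b - l) * d powr l" by (simp add: powr_add[symmetric])
  also have "\<dots> \<le> D powr (b - l) * d powr l" using assms by (intro mult_right_mono powr_mono2) auto
  finally show ?thesis .
qed (use assms in simp)

lemma hoelder_weaken:
  assumes S: "bounded S" and l: "0 < l" "l \<le> b"
    and f: "\<And>x. x \<in> S \<Longrightarrow> norm (f x) \<le> B" "\<And>x y. x \<in> S \<Longrightarrow> y \<in> S \<Longrightarrow> norm (f x - f y) \<le> L * dist x y powr b"
  shows "hoelder S l f"
proof -
  obtain D where D: "\<And>x y. x \<in> S \<Longrightarrow> y \<in> S \<Longrightarrow> dist x y \<le> D"
    using S bounded_two_points by metis
  show ?thesis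
  proof (rule hoelderI[OF f(1)])
    fix x y assume xy: "x \<in> S" "y \<in> S"
    have "norm (f x - f y) \<le> max 0 L * dist x y powr b"
      using f(2)[OF xy] mult_right_mono[of L "max 0 L" "dist x y powr b"] by simp
    also have "\<dots> \<le> max 0 L * (D powr (b - l) * dist x y powr l)"
      using D[OF xy] l by (intro mult_left_mono powr_le_bounded) auto
    finally show "norm (f x - f y) \<le> (max 0 L * D powr (b - l)) * dist x y powr l" by (simp add: mult.assoc)
  qed
qed

lemma hoelder_Lipschitz:
  assumes S: "bounded S" and l: "0 < l" "l \<le> 1"
    and f: "\<And>x. x \<in> S \<Longrightarrow> norm (f x) \<le> B" "\<And>x y. x \<in> S \<Longrightarrow> y \<in> S \<Longrightarrow> norm (f x - f y) \<le> L * dist x y"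
  shows "hoelder S l f"
  by (rule hoelder_weaken[OF S l f(1)]) (use f in auto)

lemma hoelder_const: "hoelder S l (\<lambda>x. c)"
  by (rule hoelderI[where B="norm c" and L=0]) auto

lemma hoelder_add:
  assumes "hoelder S l f" "hoelder S l g"
  shows "hoelder S l (\<lambda>x. f x + g x)"
proof -
  obtain A where A: "\<And>x. x \<in> S \<Longrightarrow> norm (f x) \<le> A" "\<And>x y. x \<in> S \<Longrightarrow> y \<in> S \<Longrightarrow> norm (f x - f y) \<le> A * dist x y powr l"
    using assms(1) by (rule hoelderE) (rule that)
  obtain B where B: "\<And>x. x \<in> S \<Longrightarrow> norm (g x) \<le> B" "\<And>x y. x \<in> S \<Longrightarrow> y \<in> S \<Longrightarrow> norm (g x - g y) \<le> B * dist x y powr l"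
    using assms(2) by (rule hoelderE) (rule that)
  show ?thesis
  proof (rule hoelderI[where B="A + B" and L="A + B"])
    show "norm (f x + g x) \<le> A + B" if "x \<in> S" for x
      using norm_triangle_ineq[of "f x" "g x"] A(1)[OF that] B(1)[OF that] by linarith
    show "norm (f x + g x - (f y + g y)) \<le> (A + B) * dist x y powr l" if "x \<in> S" "y \<in> S" for x y
      using norm_triangle_ineq[of "f x - f y" "g x - g y"] A(2)[OF that] B(2)[OF that]
      by (simp add: algebra_simps)
  qed
qed

lemma hoelder_scaleR:
  fixes f :: "'a::metric_space \<Rightarrow> real"
  assumes "hoelder S l f" "hoelder S l g"
  shows "hoelder S l (\<lambda>x. f x *\<^sub>R g x)"
proof -
  obtain A where A: "0 \<le> A" "\<And>x. x \<in> S \<Longrightarrow> norm (f x) \<le> A" "\<And>x y. x \<in> S \<Longrightarrow> y \<in> S \<Longrightarrow> norm (f x - f y) \<le> A * dist x y powr l"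
    using assms(1) by (rule hoelderE) (rule that)
  obtain B where B: "0 \<le> B" "\<And>x. x \<in> S \<Longrightarrow> norm (g x) \<le> B" "\<And>x y. x \<in> S \<Longrightarrow> y \<in> S \<Longrightarrow> norm (g x - g y) \<le> B * dist x y powr l"
    using assms(2) by (rule hoelderE) (rule that)
  show ?thesis
  proof (rule hoelderI[where B="A * B" and L="2 * (A * B)"])
    show "norm (f x *\<^sub>R g x) \<le> A * B" if "x \<in> S" for x
      using A(1) A(2)[OF that] B(2)[OF that] by (simp add: mult_mono)
    fix x y assume xy: "x \<in> S" "y \<in> S"
    have "f x *\<^sub>R g x - f y *\<^sub>R g y = f x *\<^sub>R (g x - g y) + (f x - f y) *\<^sub>R g y" by (simp add: algebra_simps)
    then have "norm (f x *\<^sub>R g x - f y *\<^sub>R g y) \<le> \<bar>f x\<bar> * norm (g x - g y) + \<bar>f x - f y\<bar> * norm (g y)"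
      using norm_triangle_ineq[of "f x *\<^sub>R (g x - g y)" "(f x - f y) *\<^sub>R g y"] by simp
    also have "\<dots> \<le> A * (B * dist x y powr l) + (A * dist x y powr l) * B"
      using A B xy A(2,3)[OF xy(1)] by (intro add_mono mult_mono) auto
    finally show "norm (f x *\<^sub>R g x - f y *\<^sub>R g y) \<le> 2 * (A * B) * dist x y powr l" by (simp add: algebra_simps)
  qed
qed

lemma hoelder_compose_Lipschitz_left:
  fixes \<phi> :: "real \<Rightarrow> real"
  assumes "hoelder S l f" and "\<And>B. 0 \<le> B \<Longrightarrow> \<exists>L\<ge>0. \<forall>s t. \<bar>s\<bar> \<le> B \<and> \<bar>t\<bar> \<le> B \<longrightarrow> \<bar>\<phi> s - \<phi> t\<bar> \<le> L * \<bar>s - t\<bar>"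
  shows "hoelder S l (\<lambda>x. \<phi> (f x))"
proof -
  obtain B where B: "0 \<le> B" "\<And>x. x \<in> S \<Longrightarrow> norm (f x) \<le> B" "\<And>x y. x \<in> S \<Longrightarrow> y \<in> S \<Longrightarrow> norm (f x - f y) \<le> B * dist x y powr l"
    using assms(1) by (rule hoelderE) (rule that)
  obtain L where L: "0 \<le> L" "\<And>s t. \<bar>s\<bar> \<le> B \<Longrightarrow> \<bar>t\<bar> \<le> B \<Longrightarrow> \<bar>\<phi> s - \<phi> t\<bar> \<le> L * \<bar>s - t\<bar>"
    using assms(2)[OF B(1)] by blast
  show ?thesis
  proof (rule hoelderI)
    fix x assume x: "x \<in> S"
    have fx: "\<bar>f x\<bar> \<le> B" using B(2)[OF x] by simp
    have "\<bar>\<phi> (f x) - \<phi> 0\<bar> \<le> L * \<bar>f x - 0\<bar>" using fx B(1) by (intro L) auto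
    also have "\<dots> \<le> L * B" using fx L(1) by (intro mult_left_mono) auto
    finally show "norm (\<phi> (f x)) \<le> \<bar>\<phi> 0\<bar> + L * B" unfolding real_norm_def by linarith
    fix y assume y: "y \<in> S"
    have "\<bar>\<phi> (f x) - \<phi> (f y)\<bar> \<le> L * \<bar>f x - f y\<bar>" using B(2)[OF x] B(2)[OF y] by (intro L(2)) auto
    also have "\<dots> \<le> L * (B * dist x y powr l)" using B(3)[OF x y] L(1) by (intro mult_left_mono) auto
    finally show "norm (\<phi> (f x) - \<phi> (f y)) \<le> (L * B) * dist x y powr l" by (simp add: mult.assoc)
  qed
qed

lemma hoelder_exp:
  fixes f :: "'a::metric_space \<Rightarrow> real"
  assumes "hoelder S l f"
  shows "hoelder S l (\<lambda>x. exp (- f x))"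
proof (rule hoelder_compose_Lipschitz_left[OF assms])
  fix B :: real assume B: "0 \<le> B"
  have "\<bar>exp (- s) - exp (- t)\<bar> \<le> exp B * \<bar>s - t\<bar>" if "\<bar>s\<bar> \<le> B" "\<bar>t\<bar> \<le> B" for s t
  proof -
    have "norm (exp (- s) - exp (- t)) \<le> exp B * norm (s - t)"
    proof (rule field_differentiable_bound[of "{-B..B}" "\<lambda>s. exp (- s)" "\<lambda>s. - exp (- s)"])
      show "((\<lambda>s. exp (- s)) has_field_derivative - exp (- z)) (at z within {- B..B})" for z :: real
        by (auto intro!: derivative_eq_intros)
    qed (use that in auto)
    then show ?thesis by simp
  qed
  then show "\<exists>L\<ge>0. \<forall>s t. \<bar>s\<bar> \<le> B \<and> \<bar>t\<bar> \<le> B \<longrightarrow> \<bar>exp (- s) - exp (- t)\<bar> \<le> L * \<bar>s - t\<bar>"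
    by (intro exI[of _ "exp B"]) auto
qed

lemma hoelder_compose_nonexpansive:
  assumes "hoelder T l \<phi>" "0 < l" "f ` S \<subseteq> T" "\<And>x y. x \<in> S \<Longrightarrow> y \<in> S \<Longrightarrow> dist (f x) (f y) \<le> dist x y"
  shows "hoelder S l (\<lambda>x. \<phi> (f x))"
proof -
  obtain B where B: "0 \<le> B" "\<And>x. x \<in> T \<Longrightarrow> norm (\<phi> x) \<le> B" "\<And>x y. x \<in> T \<Longrightarrow> y \<in> T \<Longrightarrow> norm (\<phi> x - \<phi> y) \<le> B * dist x y powr l"
    using assms(1) by (rule hoelderE) (rule that)
  show ?thesis
  proof (rule hoelderI)
    fix x assume x: "x \<in> S"
    then show "norm (\<phi> (f x)) \<le> B" using B(2) assms(3) by blast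
    fix y assume y: "y \<in> S"
    have "norm (\<phi> (f x) - \<phi> (f y)) \<le> B * dist (f x) (f y) powr l" using x y assms(3) by (intro B(3)) auto
    also have "\<dots> \<le> B * dist x y powr l" using B(1) assms(2) assms(4)[OF x y] by (intro mult_left_mono powr_mono2) auto
    finally show "norm (\<phi> (f x) - \<phi> (f y)) \<le> B * dist x y powr l" .
  qed
qed

lemma hoelder_bounded_derivative:
  fixes \<phi> :: "real \<Rightarrow> real"
  assumes l: "0 < l" "l \<le> 1" and d: "\<And>s. 0 < s \<Longrightarrow> s \<le> D \<Longrightarrow> (\<phi> has_real_derivative \<phi>' s) (at s)"
    and b: "\<And>s. 0 < s \<Longrightarrow> s \<le> D \<Longrightarrow> \<bar>\<phi>' s\<bar> \<le> L" and B: "\<And>s. 0 < s \<Longrightarrow> s \<le> D \<Longrightarrow> \<bar>\<phi> s\<bar> \<le> B"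
  shows "hoelder {0<..D} l \<phi>"
proof (rule hoelder_Lipschitz[OF _ l])
  show "norm (\<phi> x - \<phi> y) \<le> L * dist x y" if "x \<in> {0<..D}" "y \<in> {0<..D}" for x y
    unfolding dist_norm
    by (rule field_differentiable_bound[of "{0<..D}" \<phi> \<phi>'])
      (use that d b in \<open>auto intro: has_field_derivative_at_within\<close>)
qed (use B in auto)

text \<open>\<open>C1l_closure\<close> asks for the Hoelder estimate up to the boundary. A Hoelder
  gradient is uniformly continuous, so it extends to the closure, and the estimate survives limits
  of interior points.\<close>

lemma C1l_closureI:
  fixes u :: "'a::euclidean_space \<Rightarrow> real"
  assumes "0 < l" and cu: "continuous_on (closure S) u"
    and u: "\<And>x. x \<in> S \<Longrightarrow> (u has_derivative (\<lambda>h. G x \<bullet> h)) (at x)" and G: "hoelder S l G"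
  shows "C1l_closure S l u"
proof -
  obtain B where B: "0 \<le> B" "\<And>x y. x \<in> S \<Longrightarrow> y \<in> S \<Longrightarrow> norm (G x - G y) \<le> B * dist x y powr l"
    using G by (rule hoelderE) (rule that)
  have "uniformly_continuous_on S G"
    unfolding uniformly_continuous_on_def
  proof (intro allI impI)
    fix e :: real assume e: "0 < e"
    \<comment> \<open>Solves (B + 1) d^l = e; the 1 covers the case B = 0.\<close>
    define d where "d = (e / (B + 1)) powr (1 / l)"
    have d: "0 < d" using e B by (simp add: d_def)
    have "dist (G y) (G x) < e" if "x \<in> S" "y \<in> S" "dist y x < d" for x y
    proof -
      have "dist y x powr l < d powr l" using that assms(1) by (intro powr_less_mono2) auto
      also have "\<dots> = e / (B + 1)" using assms(1) e B by (simp add: d_def powr_powr)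
      finally have "(B + 1) * dist y x powr l < e" using B(1) by (simp add: field_simps)
      moreover have "B * dist y x powr l \<le> (B + 1) * dist y x powr l" by (intro mult_right_mono) auto
      ultimately show ?thesis using B(2)[OF that(2,1)] by (simp add: dist_norm)
    qed
    with d show "\<exists>d>0. \<forall>x\<in>S. \<forall>x'\<in>S. dist x' x < d \<longrightarrow> dist (G x') (G x) < e" by blast
  qed
  then obtain g where g: "uniformly_continuous_on (closure S) g" "\<And>x. x \<in> S \<Longrightarrow> G x = g x"
    by (rule uniformly_continuous_on_extension_on_closure) (rule that)
  have cg: "continuous_on (closure S) g" using g(1) by (rule uniformly_continuous_imp_continuous)
  have "norm (g x - g y) \<le> B * dist x y powr l" if xy: "x \<in> closure S" "y \<in> closure S" for x y
  proof -
    obtain X where X: "\<And>n::nat. X n \<in> S" "X \<longlonglongrightarrow> x" using xy(1) closure_sequential by metis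
    obtain Y where Y: "\<And>n::nat. Y n \<in> S" "Y \<longlonglongrightarrow> y" using xy(2) closure_sequential by metis
    have cl: "X n \<in> closure S" "Y n \<in> closure S" for n using X(1) Y(1) closure_subset by blast+
    have "(\<lambda>n. g (X n)) \<longlonglongrightarrow> g x" "(\<lambda>n. g (Y n)) \<longlonglongrightarrow> g y"
      using continuous_on_tendsto_compose[OF cg X(2) xy(1)] continuous_on_tendsto_compose[OF cg Y(2) xy(2)] cl
      by (auto intro!: always_eventually)
    then have "(\<lambda>n. norm (g (X n) - g (Y n))) \<longlonglongrightarrow> norm (g x - g y)" by (intro tendsto_intros)
    moreover have "(\<lambda>n. B * dist (X n) (Y n) powr l) \<longlonglongrightarrow> B * dist x y powr l"
      using assms(1) by (intro tendsto_mult tendsto_const tendsto_powr2 tendsto_dist X Y) auto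
    moreover have "norm (g (X n) - g (Y n)) \<le> B * dist (X n) (Y n) powr l" for n
      using B(2)[OF X(1)[of n] Y(1)[of n]] g(2) X(1) Y(1) by simp
    ultimately show ?thesis by (intro LIMSEQ_le[of _ _ "\<lambda>n. B * dist (X n) (Y n) powr l"]) auto
  qed
  moreover have "(u has_derivative (\<lambda>h. g x \<bullet> h)) (at x)" if "x \<in> S" for x
    using u[OF that] g(2)[OF that] by simp
  ultimately show ?thesis unfolding C1l_closure_def using cu by blast
qed

section \<open>The subsolution\<close>

text \<open>The two homogeneities drive both constructions: T \<le> 1 keeps both parts bounded for
  the subsolution, a large T lets the q-part win for the supersolution.\<close>

lemma pq_flux_scaleR:
  assumes "0 < T"
  shows "pq_flux p q (T *\<^sub>R W) H =
    T powr (p - 1) * ((norm W powr (p - 2) *\<^sub>R W) \<bullet> H) + T powr (q - 1) * ((norm W powr (q - 2) *\<^sub>R W) \<bullet> H)"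
proof -
  have t: "T powr (b - 2) * T = T powr (b - 1)" for b
    using powr_add[of T "b - 2" 1] assms by simp
  have "pq_flux p q (T *\<^sub>R W) H =
      (T powr (p - 2) * T) * (norm W powr (p - 2) * (W \<bullet> H)) + (T powr (q - 2) * T) * (norm W powr (q - 2) * (W \<bullet> H))"
    using assms by (simp add: pq_flux_def powr_mult algebra_simps)
  then show ?thesis unfolding t by simp
qed

lemma admissible_reaction_integrable:
  assumes \<Omega>: "open \<Omega>" and adm: "admissible_test q \<Omega> xi H" and q: "1 < q"
    and g: "continuous_on \<Omega> g"
  shows "integrable (lebesgue_on \<Omega>) (\<lambda>x. g x * xi x)"
proof -
  obtain S phi Dphi where S: "compact S" "S \<subseteq> \<Omega>" and xi0: "\<And>x. 0 \<le> xi x"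
    and xi: "\<And>x. x \<notin> S \<Longrightarrow> xi x = 0" "\<And>x. x \<notin> S \<Longrightarrow> H x = 0"
    "integrable (lebesgue_on \<Omega>) xi" "integrable (lebesgue_on \<Omega>) H"
    by (rule admissible_testE[OF adm q \<Omega>]) (rule that)
  obtain B where "\<And>x. x \<in> S \<Longrightarrow> norm (g x) \<le> B"
    using compact_imp_bounded[OF compact_continuous_image[OF continuous_on_subset[OF g S(2)] S(1)]]
    unfolding bounded_iff by auto
  from integrable_inner_compact_support(1)[OF xi(3,1) continuous_on_measurable_lebesgue_on[OF g \<Omega>] this]
  show ?thesis by simp
qed

lemma admissible_test_integrable:
  assumes "open \<Omega>" "admissible_test q \<Omega> xi H" "1 < q"
  shows "integrable (lebesgue_on \<Omega>) xi"
  using admissible_reaction_integrable[OF assms, of "\<lambda>_. 1"] by simp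

lemma admissible_test_nonneg: "admissible_test q \<Omega> xi H \<Longrightarrow> 0 \<le> xi x"
  by (simp add: admissible_test_def)

lemma weak_subsol_mono:
  assumes "weak_subsol \<Omega> p q \<gamma> f lam c u" "0 \<le> c"
  shows "weak_subsol \<Omega> p q \<gamma> f lam 0 u"
proof -
  have "0 \<le> c * (\<integral>x. xi x \<partial>lebesgue_on \<Omega>)" if "admissible_test q \<Omega> xi H" for xi and H :: "'a \<Rightarrow> 'a"
    using assms(2) admissible_test_nonneg[OF that] by (intro mult_nonneg_nonneg Bochner_Integration.integral_nonneg) auto
  with assms(1) show ?thesis unfolding weak_subsol_def by fastforce
qed

lemma weak_supersol_mono:
  assumes "weak_supersol \<Omega> p q \<gamma> f lam c u" "0 \<le> c"
  shows "weak_supersol \<Omega> p q \<gamma> f lam 0 u"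
proof -
  have "0 \<le> c * (\<integral>x. xi x \<partial>lebesgue_on \<Omega>)" if "admissible_test q \<Omega> xi H" for xi and H :: "'a \<Rightarrow> 'a"
    using assms(2) admissible_test_nonneg[OF that] by (intro mult_nonneg_nonneg Bochner_Integration.integral_nonneg) auto
  with assms(1) show ?thesis unfolding weak_supersol_def by fastforce
qed

context collar
begin

text \<open>The field is zero beyond 3a, while \<nu> is controlled up to 4a. A point beyond 4a and a
  point where the field is nonzero are thus at distance at least a, and for such a pair boundedness
  suffices.\<close>

lemma hoelder_normal_field:
  assumes l: "0 < l" "l \<le> 1" and A: "hoelder \<Omega> l A" and z: "\<And>x. x \<in> \<Omega> \<Longrightarrow> 3 * a \<le> \<delta> x \<Longrightarrow> A x = 0"
  shows "hoelder \<Omega> l (\<lambda>x. A x *\<^sub>R \<nu> x)"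
proof -
  obtain B where B: "0 \<le> B" "\<And>x. x \<in> \<Omega> \<Longrightarrow> norm (A x) \<le> B" "\<And>x y. x \<in> \<Omega> \<Longrightarrow> y \<in> \<Omega> \<Longrightarrow> norm (A x - A y) \<le> B * dist x y powr l"
    using A by (rule hoelderE) (rule that)
  have nu: "hoelder {x \<in> \<Omega>. \<delta> x < 4 * a} l \<nu>"
  proof (rule hoelder_Lipschitz[OF _ l])
    show "bounded {x \<in> \<Omega>. \<delta> x < 4 * a}" using bounded_\<Omega> by (rule bounded_subset) auto
    show "norm (\<nu> x) \<le> 1" if "x \<in> {x \<in> \<Omega>. \<delta> x < 4 * a}" for x using that norm_\<nu>[of x] by (simp add: \<delta>_def)
    show "norm (\<nu> x - \<nu> y) \<le> C * dist x y" if "x \<in> {x \<in> \<Omega>. \<delta> x < 4 * a}" "y \<in> {x \<in> \<Omega>. \<delta> x < 4 * a}" for x y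
      using that \<nu>_Lipschitz[of x y] by (simp add: \<delta>_def)
  qed
  have "hoelder {x \<in> \<Omega>. \<delta> x < 4 * a} l A" by (rule hoelderI[of _ _ B B]) (use B in auto)
  from hoelder_scaleR[OF this nu]
  obtain B' where B': "0 \<le> B'" "\<And>x y. x \<in> {x \<in> \<Omega>. \<delta> x < 4 * a} \<Longrightarrow> y \<in> {x \<in> \<Omega>. \<delta> x < 4 * a} \<Longrightarrow>
      norm (A x *\<^sub>R \<nu> x - A y *\<^sub>R \<nu> y) \<le> B' * dist x y powr l"
    by (rule hoelderE) (rule that)
  have bd: "norm (A x *\<^sub>R \<nu> x) \<le> B" if "x \<in> \<Omega>" for x
  proof (cases "\<delta> x < 4 * a")
    case True
    then show ?thesis using B(2)[OF that] norm_\<nu>[OF that] by (simp add: \<delta>_def)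
  qed (use z[OF that] a_pos B(1) in simp)
  define L where "L = max B' (B * (1 / a) powr l)"
  have far: "norm (A x *\<^sub>R \<nu> x - A y *\<^sub>R \<nu> y) \<le> L * dist x y powr l" if xy: "x \<in> \<Omega>" "y \<in> \<Omega>" "4 * a \<le> \<delta> y" for x y
  proof -
    have Ay: "A y = 0" using z[OF xy(2)] xy(3) a_pos by simp
    show ?thesis
    proof (cases "3 * a \<le> \<delta> x")
      case True
      then show ?thesis using z[OF xy(1)] Ay B'(1) by (simp add: L_def le_max_iff_disj)
    next
      case False
      then have "a \<le> dist x y" using \<delta>_Lipschitz[of x y] xy(3) by linarith
      then have "1 \<le> (1 / a * dist x y) powr l" using a_pos l by (intro ge_one_powr_ge_zero) (auto simp: field_simps)
      then have "B * 1 \<le> B * (1 / a * dist x y) powr l" using B(1) by (rule mult_left_mono)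
      also have "\<dots> = (B * (1 / a) powr l) * dist x y powr l" by (simp only: powr_mult mult.assoc)
      also have "\<dots> \<le> L * dist x y powr l" unfolding L_def by (intro mult_right_mono) auto
      finally show ?thesis using bd[OF xy(1)] Ay by simp
    qed
  qed
  show ?thesis
  proof (rule hoelderI[OF bd])
    fix x y assume xy: "x \<in> \<Omega>" "y \<in> \<Omega>"
    consider "\<delta> x < 4 * a" "\<delta> y < 4 * a" | "4 * a \<le> \<delta> y" | "4 * a \<le> \<delta> x" by linarith
    then show "norm (A x *\<^sub>R \<nu> x - A y *\<^sub>R \<nu> y) \<le> L * dist x y powr l"
    proof cases
      case 1
      then have "norm (A x *\<^sub>R \<nu> x - A y *\<^sub>R \<nu> y) \<le> B' * dist x y powr l" using xy by (intro B'(2)) auto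
      also have "\<dots> \<le> L * dist x y powr l" unfolding L_def by (intro mult_right_mono) auto
      finally show ?thesis .
    next
      case 2
      then show ?thesis by (rule far[OF xy])
    next
      case 3
      then show ?thesis using far[OF xy(2,1)] by (simp add: norm_minus_commute dist_commute)
    qed
  qed
qed

lemma hoelder_function_of_\<delta>:
  assumes "hoelder {0<..D} l \<phi>" "0 < l" "\<And>x. x \<in> closure \<Omega> \<Longrightarrow> \<delta> x \<le> D"
  shows "hoelder \<Omega> l (\<lambda>x. \<phi> (\<delta> x))"
proof (rule hoelder_compose_nonexpansive[OF assms(1,2)])
  show "\<delta> ` \<Omega> \<subseteq> {0<..D}" using \<delta>_pos assms(3) subsetD[OF closure_subset[of \<Omega>]] by auto
  show "dist (\<delta> x) (\<delta> y) \<le> dist x y" for x y using \<delta>_Lipschitz[of x y] by (simp add: dist_real_def)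
qed

end

text \<open>Turns a lower bound that saturates at b into a linear one on [0, D], as
  \<open>C_delta_plus\<close> demands.\<close>

lemma min_ge_linear:
  fixes s :: real
  assumes "0 < b" "0 < D" "0 \<le> s" "s \<le> D"
  shows "min 1 (b / D) * s \<le> min s b"
proof (rule min.boundedI)
  show "min 1 (b / D) * s \<le> s" using assms by (intro mult_left_le_one_le) auto
  have "min 1 (b / D) * s \<le> b / D * D" using assms by (intro mult_mono) auto
  then show "min 1 (b / D) * s \<le> b" using assms by simp
qed

lemma C_delta_plusI:
  assumes \<Omega>: "open \<Omega>" and "continuous_on (closure \<Omega>) u" "\<And>x. x \<in> frontier \<Omega> \<Longrightarrow> u x = 0"
    and c: "0 < c1" "\<And>x. x \<in> \<Omega> \<Longrightarrow> c1 * infdist x (frontier \<Omega>) \<le> u x" "\<And>x. x \<in> \<Omega> \<Longrightarrow> u x \<le> c2 * infdist x (frontier \<Omega>)"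
  shows "C_delta_plus \<Omega> u"
proof -
  have "c1 * infdist x (frontier \<Omega>) \<le> u x \<and> u x \<le> max c1 c2 * infdist x (frontier \<Omega>)" if "x \<in> closure \<Omega>" for x
  proof (cases "x \<in> \<Omega>")
    case True
    have "c2 * infdist x (frontier \<Omega>) \<le> max c1 c2 * infdist x (frontier \<Omega>)"
      by (intro mult_right_mono infdist_nonneg) auto
    then show ?thesis using c(2,3)[OF True] by linarith
  next
    case False
    then have "x \<in> frontier \<Omega>" using that \<Omega> by (simp add: frontier_def interior_open)
    then show ?thesis using assms(3) by simp
  qed
  then show ?thesis unfolding C_delta_plus_def using assms(2,3) c(1)
    by (intro conjI exI[of _ c1] exI[of _ "max c1 c2"]) auto
qed

section \<open>Powers of a linear ramp in the distance\<close>

context collar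
begin

definition ramp :: "real \<Rightarrow> real \<Rightarrow> real" where "ramp b s = max 0 (3 * a - s) powr b"

lemma ramp_deriv: "1 < b \<Longrightarrow> (ramp b has_real_derivative - (b * ramp (b - 1) s)) (at s)"
  unfolding ramp_def[abs_def]
  by (rule DERIV_cong[OF DERIV_chain2[OF has_real_derivative_pos_part_powr]]) (auto intro!: derivative_eq_intros)

lemma ramp_range: "0 \<le> b \<Longrightarrow> 0 \<le> s \<Longrightarrow> 0 \<le> ramp b s \<and> ramp b s \<le> (3 * a) powr b"
  unfolding ramp_def using a_pos by (auto intro!: powr_mono2)

lemma ramp_eq_0: "0 < b \<Longrightarrow> 3 * a \<le> s \<Longrightarrow> ramp b s = 0"
  by (simp add: ramp_def)

lemma ramp_continuous: "0 < b \<Longrightarrow> continuous_on S (ramp b)"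
  unfolding ramp_def[abs_def] by (intro continuous_on_powr' continuous_intros) auto

lemma C1_ramp_field:
  assumes "2 \<le> b"
  shows "C1_on \<Omega> (\<lambda>x. ramp b (\<delta> x) *\<^sub>R \<nu> x) (\<lambda>x h. ramp b (\<delta> x) *\<^sub>R \<nu>' x h + (- (b * ramp (b - 1) (\<delta> x)) * (\<nu> x \<bullet> h)) *\<^sub>R \<nu> x)"
  by (rule C1_on_normal_field[OF ramp_deriv]) (use assms in \<open>auto intro!: continuous_intros ramp_continuous simp: ramp_eq_0\<close>)

text \<open>An exponent of at least 2 makes the field C1 with bounded divergence; the bound combines
  the slope of the ramp with the curvature bound \<open>C\<close>. It is uniform over all test
  functions.\<close>

lemma ramp_field_weak_upper:
  assumes b: "2 \<le> b"
  obtains B where "0 \<le> B" "\<And>q xi H. 1 < q \<Longrightarrow> admissible_test q \<Omega> xi H \<Longrightarrow>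
    integrable (lebesgue_on \<Omega>) (\<lambda>x. (ramp b (\<delta> x) *\<^sub>R \<nu> x) \<bullet> H x) \<and>
    (\<integral>x. (ramp b (\<delta> x) *\<^sub>R \<nu> x) \<bullet> H x \<partial>lebesgue_on \<Omega>) \<le> B * (\<integral>x. xi x \<partial>lebesgue_on \<Omega>)"
proof -
  define B where "B = (3 * a) powr b * (DIM('a) * C) + b * (3 * a) powr (b - 1)"
  have B: "0 \<le> B" using C_nonneg b by (simp add: B_def)
  define V' where "V' x h = ramp b (\<delta> x) *\<^sub>R \<nu>' x h + (- (b * ramp (b - 1) (\<delta> x)) * (\<nu> x \<bullet> h)) *\<^sub>R \<nu> x" for x h
  have V': "C1_on \<Omega> (\<lambda>x. ramp b (\<delta> x) *\<^sub>R \<nu> x) V'" unfolding V'_def[abs_def] by (rule C1_ramp_field[OF b])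
  have div: "- divergence (V' x) \<le> B" if x: "x \<in> \<Omega>" for x
  proof (cases "\<delta> x < 3 * a")
    case True
    then have x4: "infdist x (frontier \<Omega>) < 4 * a" using a_pos by (simp add: \<delta>_def)
    have l: "linear (\<lambda>h. - (b * ramp (b - 1) (\<delta> x)) * (\<nu> x \<bullet> h))"
      by (rule linearI) (simp_all add: algebra_simps inner_add_right)
    have "divergence (V' x) = ramp b (\<delta> x) * divergence (\<nu>' x) - b * ramp (b - 1) (\<delta> x)"
      unfolding V'_def[abs_def] divergence_add divergence_scaleR divergence_rank_one[OF l]
      using norm_\<nu>[OF x x4] by (simp add: dot_square_norm)
    moreover have "- (ramp b (\<delta> x) * divergence (\<nu>' x)) \<le> (3 * a) powr b * (DIM('a) * C)"
    proof -
      have "\<bar>ramp b (\<delta> x) * divergence (\<nu>' x)\<bar> \<le> (3 * a) powr b * (DIM('a) * C)"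
        unfolding abs_mult using ramp_range[of b "\<delta> x"] divergence_bound[OF \<nu>'_bound[OF x x4]] \<delta>_nonneg[of x] b
        by (intro mult_mono) auto
      then show ?thesis by linarith
    qed
    moreover have "b * ramp (b - 1) (\<delta> x) \<le> b * (3 * a) powr (b - 1)"
      using ramp_range[of "b - 1" "\<delta> x"] \<delta>_nonneg[of x] b by (intro mult_left_mono) auto
    ultimately show ?thesis by (simp add: B_def)
  next
    case False
    then have "V' x = (\<lambda>h. 0)" using b by (auto simp: V'_def ramp_eq_0)
    then show ?thesis using B by (simp add: divergence_def)
  qed
  have "integrable (lebesgue_on \<Omega>) (\<lambda>x. (ramp b (\<delta> x) *\<^sub>R \<nu> x) \<bullet> H x) \<and>
    (\<integral>x. (ramp b (\<delta> x) *\<^sub>R \<nu> x) \<bullet> H x \<partial>lebesgue_on \<Omega>) \<le> B * (\<integral>x. xi x \<partial>lebesgue_on \<Omega>)"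
    if q: "1 < q" and adm: "admissible_test q \<Omega> xi H" for q xi H
  proof -
    note ibp = admissible_integration_by_parts[OF open_\<Omega> V' adm q]
    have "(\<integral>x. - (divergence (V' x) * xi x) \<partial>lebesgue_on \<Omega>) \<le> (\<integral>x. B * xi x \<partial>lebesgue_on \<Omega>)"
    proof (rule integral_mono)
      fix x assume "x \<in> space (lebesgue_on \<Omega>)"
      then have "x \<in> \<Omega>" by simp
      from mult_right_mono[OF div[OF this] admissible_test_nonneg[OF adm, of x]]
      show "- (divergence (V' x) * xi x) \<le> B * xi x" by simp
    qed (use ibp admissible_test_integrable[OF open_\<Omega> adm q] in auto)
    then show ?thesis using ibp by simp
  qed
  with B show thesis by (rule that)
qed

text \<open>The r-flux of a ramp field along \<nu> is again such a field, with exponent J (r - 1),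
  so differentiating the flux reduces to differentiating a ramp.\<close>

lemma norm_ramp_field_powr:
  assumes x: "x \<in> \<Omega>" and J: "0 < J" "1 < r"
  shows "norm (ramp J (\<delta> x) *\<^sub>R \<nu> x) powr (r - 2) *\<^sub>R (ramp J (\<delta> x) *\<^sub>R \<nu> x) = ramp (J * (r - 1)) (\<delta> x) *\<^sub>R \<nu> x"
proof (cases "\<delta> x < 3 * a")
  case True
  then have "norm (\<nu> x) = 1" using a_pos norm_\<nu>[OF x] by (simp add: \<delta>_def)
  moreover have p: "0 < ramp J (\<delta> x)" using True by (simp add: ramp_def)
  moreover have "ramp J (\<delta> x) powr (r - 2) * ramp J (\<delta> x) = ramp J (\<delta> x) powr (r - 1)"
    using powr_add[of "ramp J (\<delta> x)" "r - 2" 1] p by simp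
  moreover have "ramp J (\<delta> x) powr (r - 1) = ramp (J * (r - 1)) (\<delta> x)"
    by (simp add: ramp_def powr_powr)
  ultimately show ?thesis by simp
next
  case False
  then show ?thesis using J by (simp add: ramp_eq_0)
qed

lemma strict_subsolution:
  assumes p: "1 < p" "p < q" and \<gamma>: "0 < \<gamma>" and l: "0 < l" "l \<le> 1" and lam: "0 < lam"
    and f: "continuous_on {0..} f" "0 < f 0" "mono_on {0..} f"
  shows "\<exists>u chi. 0 < chi \<and> weak_subsol \<Omega> p q \<gamma> f lam chi u \<and> C1l_closure \<Omega> l u \<and> C_delta_plus \<Omega> u"
proof -
  \<comment> \<open>Makes J, J (p - 1) and J (q - 1) all at least 2, so that the fields of both
    fluxes are C1.\<close>
  define J where "J = 2 / (p - 1) + 2"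
  have J: "2 \<le> J" "2 \<le> J * (p - 1)" "2 \<le> J * (q - 1)"
  proof -
    show "2 \<le> J" using p by (simp add: J_def)
    have "J * (p - 1) = 2 + 2 * (p - 1)" using p by (simp add: J_def field_simps)
    then show Jp: "2 \<le> J * (p - 1)" using p by simp
    have "J * (p - 1) \<le> J * (q - 1)" using p \<open>2 \<le> J\<close> by (intro mult_left_mono) auto
    then show "2 \<le> J * (q - 1)" using Jp by linarith
  qed
  obtain D where D: "0 < D" "\<And>x. x \<in> closure \<Omega> \<Longrightarrow> \<delta> x \<le> D" by (rule \<delta>_bounded) (rule that)
  have D\<Omega>: "\<delta> x \<le> D" if "x \<in> \<Omega>" for x using D(2) that closure_subset by blast
  define G where "G s = ((3 * a) powr (J + 1) - ramp (J + 1) s) / (J + 1)" for s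
  have Gd: "(G has_real_derivative ramp J s) (at s)" for s
  proof -
    have "((\<lambda>s. ((3 * a) powr (J + 1) - ramp (J + 1) s) / (J + 1)) has_real_derivative (0 - (- ((J + 1) * ramp (J + 1 - 1) s))) / (J + 1)) (at s)"
      by (intro DERIV_cdivide DERIV_diff DERIV_const ramp_deriv) (use J in simp)
    then show ?thesis using J by (simp add: G_def[abs_def])
  qed
  have G0: "G 0 = 0" using a_pos by (simp add: G_def ramp_def)
  have Gcont: "continuous_on S G" for S
    by (rule continuous_at_imp_continuous_on) (use Gd DERIV_isCont in blast)
  \<comment> \<open>The value of the ramp at a, which is its minimum on [0, a].\<close>
  define c where "c = (2 * a) powr J"
  have c: "0 < c" using a_pos by (simp add: c_def)
  have Gmvt: "\<exists>z. s < z \<and> z < t \<and> G t - G s = (t - s) * ramp J z" if "s < t" for s t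
    using MVT2[OF that, of G "ramp J"] Gd by blast
  have Gup: "G s \<le> (3 * a) powr J * s" if s0: "0 \<le> s" for s
  proof (cases "s = 0")
    case False
    then obtain z where z: "0 < z" "G s = s * ramp J z" using Gmvt[of 0 s] s0 G0 by auto
    show ?thesis unfolding z(2) using ramp_range[of J z] z J s0 by (simp add: mult.commute mult_left_mono)
  qed (simp add: G0)
  have Glow: "c * min s a \<le> G s" if "0 \<le> s" for s
  proof -
    have near: "c * t \<le> G t" if t: "0 \<le> t" "t \<le> a" for t
    proof (cases "t = 0")
      case False
      then obtain z where z: "0 < z" "z < t" "G t = t * ramp J z" using Gmvt[of 0 t] t G0 by auto
      have cz: "c \<le> ramp J z" unfolding c_def ramp_def using z t a_pos J by (intro powr_mono2) auto
      then show ?thesis unfolding z(3) using mult_left_mono[OF cz t(1)] by (simp add: mult.commute)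
    qed (simp add: G0)
    show ?thesis
    proof (cases "s \<le> a")
      case False
      then obtain z where z: "a < z" "G s - G a = (s - a) * ramp J z" using Gmvt[of a s] by auto
      moreover have "0 \<le> (s - a) * ramp J z"
        using False z(1) ramp_range[of J z] J a_pos by (intro mult_nonneg_nonneg) auto
      ultimately have "G a \<le> G s" by linarith
      then show ?thesis using near[of a] False a_pos by simp
    qed (use near[of s] that in simp)
  qed
  define W where "W x = ramp J (\<delta> x) *\<^sub>R \<nu> x" for x
  have GW: "((\<lambda>x. G (\<delta> x)) has_derivative (\<lambda>h. W x \<bullet> h)) (at x)" if "x \<in> \<Omega>" for x
  proof -
    have "C1_on \<Omega> (\<lambda>x. G (\<delta> x)) (\<lambda>x h. ramp J (\<delta> x) * (\<nu> x \<bullet> h))"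
      by (rule C1_on_function_of_\<delta>[OF Gd ramp_continuous]) (use J in \<open>auto simp: ramp_eq_0\<close>)
    from C1_on_derivative[OF this that] show ?thesis by (simp add: W_def)
  qed
  have Wc: "continuous_on \<Omega> W" unfolding W_def[abs_def] by (rule C1_on_continuous[OF C1_ramp_field[OF J(1)]])
  have "hoelder {0<..D} l (ramp J)"
    by (rule hoelder_bounded_derivative[OF l ramp_deriv, where L="J * (3 * a) powr (J - 1)" and B="(3 * a) powr J"])
      (use J ramp_range[of J] ramp_range[of "J - 1"] in \<open>auto simp: abs_mult intro!: mult_left_mono\<close>)
  then have "hoelder \<Omega> l (\<lambda>x. ramp J (\<delta> x))" using l(1) D(2) by (rule hoelder_function_of_\<delta>)
  then have Wh: "hoelder \<Omega> l W"
    unfolding W_def[abs_def] by (rule hoelder_normal_field[OF l]) (use J in \<open>simp add: ramp_eq_0\<close>)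
  then obtain WB where WB: "\<And>x. x \<in> \<Omega> \<Longrightarrow> norm (W x) \<le> WB" by (rule hoelderE) (rule that)
  obtain Bp where Bp: "0 \<le> Bp" "\<And>q xi H. 1 < q \<Longrightarrow> admissible_test q \<Omega> xi H \<Longrightarrow>
      integrable (lebesgue_on \<Omega>) (\<lambda>x. (ramp (J * (p - 1)) (\<delta> x) *\<^sub>R \<nu> x) \<bullet> H x) \<and>
      (\<integral>x. (ramp (J * (p - 1)) (\<delta> x) *\<^sub>R \<nu> x) \<bullet> H x \<partial>lebesgue_on \<Omega>) \<le> Bp * (\<integral>x. xi x \<partial>lebesgue_on \<Omega>)"
    by (rule ramp_field_weak_upper[OF J(2)]) (rule that)
  obtain Bq where Bq: "0 \<le> Bq" "\<And>q' xi H. 1 < q' \<Longrightarrow> admissible_test q' \<Omega> xi H \<Longrightarrow>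
      integrable (lebesgue_on \<Omega>) (\<lambda>x. (ramp (J * (q - 1)) (\<delta> x) *\<^sub>R \<nu> x) \<bullet> H x) \<and>
      (\<integral>x. (ramp (J * (q - 1)) (\<delta> x) *\<^sub>R \<nu> x) \<bullet> H x \<partial>lebesgue_on \<Omega>) \<le> Bq * (\<integral>x. xi x \<partial>lebesgue_on \<Omega>)"
    by (rule ramp_field_weak_upper[OF J(3)]) (rule that)
  define M where "M = (3 * a) powr J * D"
  have M: "0 < M" using a_pos D by (simp add: M_def)
  \<comment> \<open>The solution of lam f(0) z^(-\<gamma>) = Bp + Bq + 1: as long as u \<le> z, the
    reaction exceeds both flux bounds by at least 1, and this 1 becomes the strictness
    constant.\<close>
  define z where "z = (lam * f 0 / (Bp + Bq + 1)) powr (1 / \<gamma>)"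
  have z: "0 < z" using lam f(2) Bp(1) Bq(1) by (simp add: z_def)
  \<comment> \<open>T \<le> 1 bounds T^(p-1) and T^(q-1) by 1, and T M \<le> z keeps u below
    z.\<close>
  define T where "T = min 1 (z / M)"
  have T: "0 < T" "T \<le> 1" "T * M \<le> z" using z M by (auto simp: T_def min_def field_simps)
  define u where "u x = T * G (\<delta> x)" for x
  have Gpos: "0 < G (\<delta> x)" if "x \<in> \<Omega>" for x
  proof -
    have "0 < c * min (\<delta> x) a" using c \<delta>_pos[OF that] a_pos by simp
    then show ?thesis using Glow[of "\<delta> x"] \<delta>_nonneg[of x] by linarith
  qed
  have upos: "0 < u x" if "x \<in> \<Omega>" for x using Gpos[OF that] T by (simp add: u_def)
  have uz: "u x \<le> z" if "x \<in> \<Omega>" for x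
  proof -
    have "(3 * a) powr J * \<delta> x \<le> M" unfolding M_def using D\<Omega>[OF that] by (intro mult_left_mono) auto
    then have "G (\<delta> x) \<le> M" using Gup[of "\<delta> x"] \<delta>_nonneg[of x] by linarith
    then have "u x \<le> T * M" unfolding u_def using T by (intro mult_left_mono) auto
    then show ?thesis using T by linarith
  qed
  have ud: "(u has_derivative (\<lambda>h. (T *\<^sub>R W x) \<bullet> h)) (at x)" if "x \<in> \<Omega>" for x
    unfolding u_def[abs_def] using has_derivative_mult_right[OF GW[OF that], of T] by simp
  have uc: "continuous_on S u" for S
    unfolding u_def[abs_def] by (intro continuous_intros continuous_on_compose2[OF Gcont[of UNIV] \<delta>_continuous]) auto
  have u0: "u x = 0" if "x \<in> frontier \<Omega>" for x using \<delta>_frontier[OF that] G0 by (simp add: u_def)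
  have sol: "sol_class q \<Omega> f u (\<lambda>x. T *\<^sub>R W x)"
  proof (rule sol_classI[OF open_\<Omega> bounded_\<Omega> _ ud _ _ uc u0 upos f(1), where M=WB])
    show "continuous_on \<Omega> (\<lambda>x. T *\<^sub>R W x)" by (intro continuous_intros Wc)
    show "norm (T *\<^sub>R W x) \<le> WB" if "x \<in> \<Omega>" for x
    proof -
      have "\<bar>T\<bar> * norm (W x) \<le> 1 * norm (W x)" using T by (intro mult_right_mono) auto
      then show ?thesis using WB[OF that] by simp
    qed
  qed (use p in auto)
  have react: "Bp + Bq + 1 \<le> lam * (f (u x) * u x powr (- \<gamma>))" if x: "x \<in> \<Omega>" for x
  proof -
    have "f 0 \<le> f (u x)" using upos[OF x] f(3) by (simp add: mono_on_def)
    moreover have "z powr (- \<gamma>) \<le> u x powr (- \<gamma>)" using upos[OF x] uz[OF x] \<gamma> by (intro powr_mono2') auto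
    ultimately have "f 0 * z powr (- \<gamma>) \<le> f (u x) * u x powr (- \<gamma>)" using f(2) by (intro mult_mono) auto
    then have "lam * (f 0 * z powr (- \<gamma>)) \<le> lam * (f (u x) * u x powr (- \<gamma>))" using lam by (intro mult_left_mono) auto
    moreover have "z powr (- \<gamma>) = (Bp + Bq + 1) / (lam * f 0)"
    proof -
      have "z powr (- \<gamma>) = (lam * f 0 / (Bp + Bq + 1)) powr (- 1)" unfolding z_def powr_powr using \<gamma> by simp
      also have "\<dots> = (Bp + Bq + 1) / (lam * f 0)" using lam f(2) Bp(1) Bq(1) by (simp add: powr_minus)
      finally show ?thesis .
    qed
    ultimately show ?thesis using lam f(2) by simp
  qed
  have rc: "continuous_on \<Omega> (\<lambda>x. f (u x) * u x powr (- \<gamma>))"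
    using upos by (intro continuous_intros uc continuous_on_compose2[OF f(1) uc]) (auto simp: less_imp_le less_imp_neq[symmetric])
  have "weak_subsol \<Omega> p q \<gamma> f lam 1 u"
    unfolding weak_subsol_def
  proof (intro exI[of _ "\<lambda>x. T *\<^sub>R W x"] conjI allI impI)
    show "sol_class q \<Omega> f u (\<lambda>x. T *\<^sub>R W x)" by (rule sol)
  next
    fix xi H assume adm: "admissible_test q \<Omega> xi H"
    have q: "1 < q" using p by simp
    let ?I = "\<lambda>g. \<integral>x. g x \<partial>lebesgue_on \<Omega>"
    have ix: "integrable (lebesgue_on \<Omega>) xi" by (rule admissible_test_integrable[OF open_\<Omega> adm q])
    have ix0: "0 \<le> ?I xi" using admissible_test_nonneg[OF adm] by (intro Bochner_Integration.integral_nonneg) auto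
    let ?Vp = "\<lambda>x. (ramp (J * (p - 1)) (\<delta> x) *\<^sub>R \<nu> x) \<bullet> H x" and ?Vq = "\<lambda>x. (ramp (J * (q - 1)) (\<delta> x) *\<^sub>R \<nu> x) \<bullet> H x"
    have "pq_flux p q (T *\<^sub>R W x) (H x) = T powr (p - 1) * ?Vp x + T powr (q - 1) * ?Vq x" if "x \<in> \<Omega>" for x
    proof -
      have "0 < J" using J by simp
      note n = norm_ramp_field_powr[OF that this]
      show ?thesis by (simp only: pq_flux_scaleR[OF T(1)] W_def n[OF p(1)] n[OF q])
    qed
    then have "?I (\<lambda>x. pq_flux p q (T *\<^sub>R W x) (H x)) = ?I (\<lambda>x. T powr (p - 1) * ?Vp x + T powr (q - 1) * ?Vq x)"
      by (intro Bochner_Integration.integral_cong) auto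
    also have "\<dots> = T powr (p - 1) * ?I ?Vp + T powr (q - 1) * ?I ?Vq"
      using Bp(2)[OF q adm] Bq(2)[OF q adm] by simp
    also have "\<dots> \<le> Bp * ?I xi + Bq * ?I xi"
    proof -
      have le: "T powr b * v \<le> B * ?I xi" if "0 \<le> b" "v \<le> B * ?I xi" "0 \<le> B" for b v B
      proof -
        have "T powr b * v \<le> T powr b * (B * ?I xi)" using that by (intro mult_left_mono) auto
        also have "\<dots> \<le> 1 * (B * ?I xi)" using that T ix0 powr_mono2[of b T 1] by (intro mult_right_mono) auto
        finally show ?thesis by simp
      qed
      show ?thesis using Bp Bq p conjunct2[OF Bp(2)[OF q adm]] conjunct2[OF Bq(2)[OF q adm]] by (intro add_mono le) auto
    qed
    finally have upper: "?I (\<lambda>x. pq_flux p q (T *\<^sub>R W x) (H x)) \<le> (Bp + Bq + 1) * ?I xi - 1 * ?I xi"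
      by (simp add: algebra_simps)
    have "?I (\<lambda>x. (Bp + Bq + 1) * xi x) \<le> ?I (\<lambda>x. lam * (f (u x) * u x powr (- \<gamma>) * xi x))"
    proof (rule integral_mono)
      fix x assume "x \<in> space (lebesgue_on \<Omega>)"
      then have "x \<in> \<Omega>" by simp
      from mult_right_mono[OF react[OF this] admissible_test_nonneg[OF adm, of x]]
      show "(Bp + Bq + 1) * xi x \<le> lam * (f (u x) * u x powr (- \<gamma>) * xi x)" by (simp add: mult.assoc)
    qed (use ix admissible_reaction_integrable[OF open_\<Omega> adm q rc] in auto)
    then have "(Bp + Bq + 1) * ?I xi \<le> lam * ?I (\<lambda>x. f (u x) * u x powr (- \<gamma>) * xi x)" by simp
    with upper show "?I (\<lambda>x. pq_flux p q (T *\<^sub>R W x) (H x)) \<le> lam * ?I (\<lambda>x. f (u x) * u x powr (- \<gamma>) * xi x) - 1 * ?I xi"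
      by linarith
  qed
  moreover have "C1l_closure \<Omega> l u"
    by (rule C1l_closureI[OF l(1) uc ud hoelder_scaleR[OF hoelder_const Wh]])
  moreover have "C_delta_plus \<Omega> u"
  proof (rule C_delta_plusI[OF open_\<Omega> uc u0])
    let ?m = "min 1 (a / D)"
    show "0 < T * (c * ?m)" using T c a_pos D by simp
    show "T * (c * ?m) * infdist x (frontier \<Omega>) \<le> u x" if "x \<in> \<Omega>" for x
    proof -
      have "?m * \<delta> x \<le> min (\<delta> x) a" using a_pos D(1) \<delta>_nonneg D\<Omega>[OF that] by (rule min_ge_linear)
      then have "c * (?m * \<delta> x) \<le> c * min (\<delta> x) a" using c by (intro mult_left_mono) auto
      also have "\<dots> \<le> G (\<delta> x)" by (rule Glow[OF \<delta>_nonneg])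
      finally have "T * (c * (?m * \<delta> x)) \<le> u x" unfolding u_def using T by (intro mult_left_mono) auto
      then show ?thesis by (simp add: \<delta>_def mult.assoc)
    qed
    show "u x \<le> T * (3 * a) powr J * infdist x (frontier \<Omega>)" if "x \<in> \<Omega>" for x
      unfolding u_def using mult_left_mono[OF Gup[OF \<delta>_nonneg[of x]], of T] T by (simp add: \<delta>_def mult.assoc)
  qed
  ultimately show ?thesis using zero_less_one by blast
qed

end

section \<open>The supersolution\<close>

context barrier
begin

lemma K_continuous: "continuous_on {0..D} (K 0)"
  unfolding K_def[abs_def] by (rule indefinite_integral_continuous_1[OF k_integrable]) simp

lemma hoelder_k:
  assumes l: "0 < l" "l \<le> \<alpha>" "l \<le> 1 - \<gamma>"
  shows "hoelder {0<..D} l (k 0)"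
proof -
  have l1: "l \<le> 1" using l \<alpha> by simp
  have bd: "bounded {0<..D}" by simp
  have cd: "((\<lambda>s. cut s powr j) has_real_derivative j * cut s powr (j - 1) * (- (1 / a))) (at s)" for s
    unfolding cut_def[abs_def]
    by (rule DERIV_chain2[OF has_real_derivative_pos_part_powr])
      (use j a in \<open>auto intro!: derivative_eq_intros\<close>)
  have h1: "hoelder {0<..D} l (\<lambda>s. cut s powr j)"
  proof (rule hoelder_bounded_derivative[OF l(1) l1 cd, where L="j * 3 powr (j - 1) / a" and B="3 powr j"])
    fix s :: real assume s: "0 < s"
    then have c: "0 \<le> cut s" "cut s \<le> 3" using cut_range[of s] by auto
    show "\<bar>cut s powr j\<bar> \<le> 3 powr j" using c j by (simp add: powr_mono2)
    have "j * cut s powr (j - 1) \<le> j * 3 powr (j - 1)" using c j by (intro mult_left_mono powr_mono2) auto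
    then show "\<bar>j * cut s powr (j - 1) * (- (1 / a))\<bar> \<le> j * 3 powr (j - 1) / a"
      using a j by (simp add: abs_mult divide_right_mono)
  qed
  have h2: "hoelder {0<..D} l (\<lambda>s. root_profile \<alpha> 0 (s - 2 * a))"
  proof (rule hoelder_weaken[OF bd l(1,2), where L=2 and B="(D + 2 * a) powr \<alpha>"])
    fix x assume x: "x \<in> {0<..D}"
    have "\<bar>root_profile \<alpha> 0 (x - 2 * a)\<bar> \<le> \<bar>x - 2 * a\<bar> powr \<alpha>" using \<alpha> by (intro abs_root_profile_le) auto
    also have "\<dots> \<le> (D + 2 * a) powr \<alpha>" using x a \<alpha> by (intro powr_mono2) auto
    finally show "norm (root_profile \<alpha> 0 (x - 2 * a)) \<le> (D + 2 * a) powr \<alpha>" by simp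
    fix y
    show "norm (root_profile \<alpha> 0 (x - 2 * a) - root_profile \<alpha> 0 (y - 2 * a)) \<le> 2 * dist x y powr \<alpha>"
      using root_profile_Hoelder[OF \<alpha>(1), of "x - 2 * a" "y - 2 * a"] \<alpha> by (simp add: dist_real_def)
  qed
  have h3: "hoelder {0<..D} l (\<lambda>s. s powr (1 - \<gamma>))"
  proof (rule hoelder_weaken[OF bd l(1,3), where L=1 and B="D powr (1 - \<gamma>)"])
    show "norm (x powr (1 - \<gamma>)) \<le> D powr (1 - \<gamma>)" if "x \<in> {0<..D}" for x
      using that \<gamma> by (simp add: powr_mono2)
    show "norm (x powr (1 - \<gamma>) - y powr (1 - \<gamma>)) \<le> 1 * dist x y powr (1 - \<gamma>)" if "x \<in> {0<..D}" "y \<in> {0<..D}" for x y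
      using that \<gamma> powr_Hoelder[of x y "1 - \<gamma>"] by (simp add: dist_real_def)
  qed
  have "hoelder {0<..D} l (\<lambda>s. (root_profile \<alpha> 0 (s - 2 * a) + s powr (1 - \<gamma>)) + (- ((2 * a) powr (1 - \<gamma>))))"
    by (rule hoelder_add[OF hoelder_add[OF h2 h3] hoelder_const])
  then have "hoelder {0<..D} l (sing 0)" by (simp add: sing_def[abs_def])
  from hoelder_scaleR[OF h1 hoelder_exp[OF this]] show ?thesis by (simp add: k_def[abs_def])
qed

lemma hoelder_chi:
  assumes l: "0 < l" "l \<le> 1"
  shows "hoelder {0<..D} l chi" "hoelder {0<..D} l chi'"
proof -
  show "hoelder {0<..D} l chi"
    by (rule hoelder_bounded_derivative[OF l chi_deriv(1), where L="3 / a" and B=1])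
      (use chi_range in \<open>auto simp: less_imp_le\<close>)
  show "hoelder {0<..D} l chi'"
  proof (rule hoelder_bounded_derivative[OF l chi_deriv(2), where L="6 / a\<^sup>2" and B="3 / a"])
    fix s :: real assume s: "0 < s"
    show "\<bar>chi' s\<bar> \<le> 3 / a" using chi_range[of s] s by simp
    have "max 0 (1 - s / a) \<le> 1" using s a by simp
    then have "6 / a\<^sup>2 * max 0 (1 - s / a) \<le> 6 / a\<^sup>2 * 1" by (intro mult_left_mono) auto
    then show "\<bar>chi'' s\<bar> \<le> 6 / a\<^sup>2" unfolding chi''_def abs_mult by simp
  qed
qed

lemma hoelder_y:
  assumes l: "0 < l" "l \<le> 1"
  shows "hoelder \<Omega> l y"
proof (rule hoelder_Lipschitz[OF bounded_\<Omega> l, where B=Y and L=1])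
  show "norm (y x) \<le> Y" if "x \<in> \<Omega>" for x using y_bounds[OF that] by simp
  show "norm (y x - y z) \<le> 1 * dist x z" for x z
    using Cauchy_Schwarz_ineq2[of e "x - z"] norm_e by (simp add: y_def inner_diff_right dist_norm)
qed

lemma hoelder_gradient:
  assumes l: "0 < l" "l \<le> \<alpha>" "l \<le> 1 - \<gamma>"
  shows "hoelder \<Omega> l (\<lambda>x. exp (- v 0 x) *\<^sub>R X 0 x)"
proof -
  have l1: "l \<le> 1" using l \<alpha> by simp
  obtain D where D: "0 < D" "\<And>x. x \<in> closure \<Omega> \<Longrightarrow> \<delta> x \<le> D" by (rule \<delta>_bounded) (rule that)
  note fd = hoelder_function_of_\<delta>[OF _ l(1) D(2)]
  have hK: "hoelder \<Omega> l (\<lambda>x. K 0 (\<delta> x))"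
  proof (rule fd, rule hoelder_bounded_derivative[OF l(1) l1 K_deriv, where L="3 powr j * exp 2" and B="3 powr j * exp 2 * D"])
    fix s assume s: "0 < s" "s \<le> D"
    show "\<bar>k 0 s\<bar> \<le> 3 powr j * exp 2" using k_nonneg k_le[of s] s by simp
    have "3 powr j * exp 2 * s \<le> 3 powr j * exp 2 * D" using s by (intro mult_left_mono) auto
    moreover have "0 \<le> K 0 s" "K 0 s \<le> 3 powr j * exp 2 * s" using K_bounds[of 0 s] s by auto
    ultimately show "\<bar>K 0 s\<bar> \<le> 3 powr j * exp 2 * D" by linarith
  qed auto
  note hc = fd[OF hoelder_chi(1)[OF l(1) l1]] and hc' = fd[OF hoelder_chi(2)[OF l(1) l1]] and hk = fd[OF hoelder_k[OF l]]
  have hv: "hoelder \<Omega> l (v 0)"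
    using hoelder_add[OF hK hoelder_scaleR[OF hoelder_y[OF l(1) l1] hc]] by (simp add: v_def[abs_def])
  have hA: "hoelder \<Omega> l (\<lambda>x. k 0 (\<delta> x) + y x * chi' (\<delta> x))"
    using hoelder_add[OF hk hoelder_scaleR[OF hoelder_y[OF l(1) l1] hc']] by simp
  have "hoelder \<Omega> l (\<lambda>x. (k 0 (\<delta> x) + y x * chi' (\<delta> x)) *\<^sub>R \<nu> x)"
    by (rule hoelder_normal_field[OF l(1) l1 hA]) (simp add: k_eq_0 chi_collar)
  from hoelder_add[OF this hoelder_scaleR[OF hc hoelder_const]]
  have "hoelder \<Omega> l (X 0)" by (simp add: X_def[abs_def])
  from hoelder_scaleR[OF hoelder_exp[OF hv] this] show ?thesis .
qed

lemma strict_supersolution: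
  assumes p: "1 < p" "p < q" and \<alpha>q: "\<alpha> * (q - 1) \<le> 1"
    and jp: "threshold p \<le> min 1 (p - 1) * (j / (3 * a))" and jq: "threshold q \<le> min 1 (q - 1) * (j / (3 * a))"
    and l: "0 < l" "l \<le> \<alpha>" "l \<le> 1 - \<gamma>" and lam: "0 < lam"
    and f: "continuous_on {0..} f" "0 < f 0" "mono_on {0..} f"
    and growth: "((\<lambda>t. f t / t powr (q - 1 + \<gamma>)) \<longlongrightarrow> 0) at_top"
  shows "\<exists>u chi. 0 < chi \<and> weak_supersol \<Omega> p q \<gamma> f lam chi u \<and> C1l_closure \<Omega> l u \<and> C_delta_plus \<Omega> u"
proof -
  have q: "1 < q" using p by simp
  obtain D where D: "0 < D" "\<And>x. x \<in> closure \<Omega> \<Longrightarrow> \<delta> x \<le> D" by (rule \<delta>_bounded) (rule that)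
  have D\<Omega>: "\<delta> x \<le> D" if "x \<in> \<Omega>" for x using D(2) that closure_subset by blast
  obtain Vm where Vm: "\<And>\<epsilon> x. 0 \<le> \<epsilon> \<Longrightarrow> x \<in> \<Omega> \<Longrightarrow> 0 \<le> v \<epsilon> x \<and> v \<epsilon> x \<le> Vm" by (rule v_bounded) (rule that)
  obtain c0 where c0: "0 < c0" "\<And>\<epsilon> x. 0 < \<epsilon> \<Longrightarrow> \<epsilon> \<le> 1 \<Longrightarrow> x \<in> \<Omega> \<Longrightarrow> c0 * \<delta> x powr (- \<gamma>) \<le> weight q \<epsilon> x * op_lower q \<epsilon> x"
    using weighted_op_lower[OF q \<alpha>q] by blast
  \<comment> \<open>\<open>Vm\<close> bounds v uniformly in \<epsilon>, so the exponential factor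
    costs only a constant.\<close>
  define c where "c = exp (- (q - 1) * Vm) * c0"
  have c: "0 < c" using c0 by (simp add: c_def)
  have low: "c * \<delta> x powr (- \<gamma>) \<le> exp (- (q - 1) * v \<epsilon> x) * (weight q \<epsilon> x * op_lower q \<epsilon> x)"
    if \<epsilon>: "0 < \<epsilon>" "\<epsilon> \<le> 1" and x: "x \<in> \<Omega>" for \<epsilon> x
  proof -
    have "v \<epsilon> x \<le> Vm" using Vm[of \<epsilon> x] \<epsilon> x by simp
    then have "(q - 1) * v \<epsilon> x \<le> (q - 1) * Vm" using q by (intro mult_left_mono) auto
    then have "exp (- (q - 1) * Vm) \<le> exp (- (q - 1) * v \<epsilon> x)"
      by (simp only: exp_le_cancel_iff mult_minus_left neg_le_iff_le)
    then have "exp (- (q - 1) * Vm) * (c0 * \<delta> x powr (- \<gamma>)) \<le> exp (- (q - 1) * v \<epsilon> x) * (weight q \<epsilon> x * op_lower q \<epsilon> x)"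
      by (rule mult_mono[OF _ c0(2)[OF \<epsilon> x]]) (use c0(1) in auto)
    then show ?thesis by (simp add: c_def mult.assoc)
  qed
  define w where "w x = 1 - exp (- v 0 x)" for x
  define W where "W x = exp (- v 0 x) *\<^sub>R X 0 x" for x
  have wd: "(w has_derivative (\<lambda>h. W x \<bullet> h)) (at x)" if x: "x \<in> \<Omega>" for x
  proof -
    note [derivative_intros] = C1_on_derivative[OF C1_v[OF order_refl] x]
    show ?thesis unfolding w_def[abs_def] W_def by (auto intro!: derivative_eq_intros)
  qed
  have Wh: "hoelder \<Omega> l W" unfolding W_def[abs_def] by (rule hoelder_gradient[OF l])
  then obtain WB where WB: "0 \<le> WB" "\<And>x. x \<in> \<Omega> \<Longrightarrow> norm (W x) \<le> WB"
    "\<And>x y. x \<in> \<Omega> \<Longrightarrow> y \<in> \<Omega> \<Longrightarrow> norm (W x - W y) \<le> WB * dist x y powr l" by (rule hoelderE) (rule that)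
  have Wc: "continuous_on \<Omega> W"
  proof -
    have vc: "continuous_on \<Omega> (v 0)" by (rule C1_on_continuous[OF C1_v]) simp
    \<comment> \<open>Continuity of \<open>X 0\<close> comes from that of the derivative of
      \<open>v 0\<close> in each fixed direction.\<close>
    have "continuous_on \<Omega> (\<lambda>x. W x \<bullet> b)" for b
    proof -
      have "continuous_on \<Omega> (\<lambda>x. exp (- v 0 x) * (X 0 x \<bullet> b))"
        by (intro continuous_intros vc C1_on_continuous_derivative[OF C1_v[OF order_refl]])
      then show ?thesis by (simp add: W_def)
    qed
    then show ?thesis by (subst continuous_on_componentwise) blast
  qed
  have wc: "continuous_on (closure \<Omega>) w"
  proof -
    have "continuous_on (closure \<Omega>) (\<lambda>x. K 0 (\<delta> x))"
      by (rule continuous_on_compose2[OF K_continuous[of D] \<delta>_continuous]) (use D \<delta>_nonneg in auto)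
    moreover have "continuous_on (closure \<Omega>) (\<lambda>x. chi (\<delta> x))"
      unfolding chi_def using a by (auto intro!: continuous_intros \<delta>_continuous)
    ultimately show ?thesis
      unfolding w_def[abs_def] v_def y_def by (intro continuous_intros)
  qed
  have w0: "w x = 0" if "x \<in> frontier \<Omega>" for x
    using \<delta>_frontier[OF that] by (simp add: w_def v_def K_def chi_def)
  define m where "m = exp (- Vm) * min 1 (2 * a / D)"
  have m: "0 < m" using a D by (simp add: m_def)
  \<comment> \<open>w = exp(-v) (exp v - 1) \<ge> exp(-v) v, and v dominates
    \<open>K 0 (\<delta> x)\<close>, which is bounded below linearly.\<close>
  have wlow: "m * \<delta> x \<le> w x" if x: "x \<in> \<Omega>" for x
  proof -
    note v = Vm[OF order_refl x]
    have ev: "v 0 x \<le> exp (v 0 x) - 1" using exp_ge_add_one_self[of "v 0 x"] by linarith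
    have "min 1 (2 * a / D) * \<delta> x \<le> min (\<delta> x) (2 * a)"
      using a D(1) \<delta>_nonneg D\<Omega>[OF x] by (intro min_ge_linear) auto
    also have "\<dots> \<le> K 0 (\<delta> x)" by (rule K_ge[OF order_refl \<delta>_nonneg])
    also have "\<dots> \<le> v 0 x" unfolding v_def using y_bounds[OF x] chi_range[OF \<delta>_nonneg[of x]] by simp
    finally have "exp (- Vm) * (min 1 (2 * a / D) * \<delta> x) \<le> exp (- v 0 x) * v 0 x"
      using v a D \<delta>_nonneg[of x] by (intro mult_mono) auto
    also have "\<dots> \<le> exp (- v 0 x) * (exp (v 0 x) - 1)"
      by (rule mult_left_mono[OF ev]) simp
    also have "\<dots> = w x" by (simp add: w_def right_diff_distrib exp_minus)
    finally show ?thesis by (simp add: m_def mult.assoc)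
  qed
  have wup: "w x \<le> (3 powr j * exp 2 + Y * (3 / a)) * \<delta> x" if x: "x \<in> \<Omega>" for x
  proof -
    have "w x \<le> v 0 x" unfolding w_def using exp_ge_add_one_self[of "- v 0 x"] by linarith
    also have "\<dots> \<le> 3 powr j * exp 2 * \<delta> x + Y * (3 / a * \<delta> x)"
      unfolding v_def using K_bounds(2)[OF order_refl \<delta>_nonneg[of x]] y_bounds[OF x] chi_range[OF \<delta>_nonneg[of x]]
      by (intro add_mono mult_mono) auto
    finally show ?thesis by (simp add: algebra_simps)
  qed
  have w1: "w x \<le> 1" for x by (simp add: w_def)
  have wpos: "0 < w x" if x: "x \<in> \<Omega>" for x
    using wlow[OF x] m \<delta>_pos[OF x] mult_pos_pos[of m "\<delta> x"] by linarith
  \<comment> \<open>Makes lam \<kappa> m^(-\<gamma>) = c / 2: one half of the q-part is spent on the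
    reaction, the other on strictness.\<close>
  define \<kappa> where "\<kappa> = c / (2 * lam * m powr (- \<gamma>))"
  have \<kappa>: "0 < \<kappa>" using c lam m by (simp add: \<kappa>_def)
  have "eventually (\<lambda>t. f t / t powr (q - 1 + \<gamma>) < \<kappa>) at_top"
    using order_tendstoD(2)[OF growth \<kappa>] .
  then obtain t0 where t0: "\<And>t. t0 \<le> t \<Longrightarrow> f t / t powr (q - 1 + \<gamma>) < \<kappa>"
    by (auto simp: eventually_at_top_linorder)
  \<comment> \<open>The growth condition is used at the single value T: since w \<le> 1,
    monotonicity bounds f(u) by f(T) everywhere, however small u is.\<close>
  define T where "T = max 1 t0"
  have T: "1 \<le> T" "0 < T" by (auto simp: T_def)
  have fT: "f T \<le> \<kappa> * T powr (q - 1 + \<gamma>)"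
    using t0[of T] T by (simp add: T_def divide_less_eq)
  define u where "u x = T * w x" for x
  have upos: "0 < u x" if "x \<in> \<Omega>" for x using wpos[OF that] T by (simp add: u_def)
  have ud: "(u has_derivative (\<lambda>h. (T *\<^sub>R W x) \<bullet> h)) (at x)" if "x \<in> \<Omega>" for x
    unfolding u_def[abs_def] using has_derivative_mult_right[OF wd[OF that], of T] by simp
  have uc: "continuous_on (closure \<Omega>) u" unfolding u_def[abs_def] by (intro continuous_intros wc)
  have ucO: "continuous_on \<Omega> u" using uc closure_subset continuous_on_subset by blast
  have u0: "u x = 0" if "x \<in> frontier \<Omega>" for x using w0[OF that] by (simp add: u_def)
  have sol: "sol_class q \<Omega> f u (\<lambda>x. T *\<^sub>R W x)"
  proof (rule sol_classI[OF open_\<Omega> bounded_\<Omega> q ud _ _ uc u0 upos f(1), where M="T * WB"])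
    show "continuous_on \<Omega> (\<lambda>x. T *\<^sub>R W x)" by (intro continuous_intros Wc)
    show "norm (T *\<^sub>R W x) \<le> T * WB" if "x \<in> \<Omega>" for x using WB(2)[OF that] T by simp
  qed auto
  have react: "lam * (f (u x) * u x powr (- \<gamma>)) \<le> T powr (q - 1) * (c / 2) * \<delta> x powr (- \<gamma>)" if x: "x \<in> \<Omega>" for x
  proof -
    have "u x \<le> T" unfolding u_def using w1[of x] T mult_left_mono[of "w x" 1 T] by simp
    then have "f (u x) \<le> f T" using f(3) upos[OF x] T by (simp add: mono_on_def)
    then have fu: "f (u x) \<le> \<kappa> * T powr (q - 1 + \<gamma>)" using fT by linarith
    have "T * (m * \<delta> x) \<le> u x" unfolding u_def using wlow[OF x] T by (intro mult_left_mono) auto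
    then have "u x powr (- \<gamma>) \<le> (T * (m * \<delta> x)) powr (- \<gamma>)"
      using T m \<delta>_pos[OF x] \<gamma> by (intro powr_mono2') auto
    also have "\<dots> = T powr (- \<gamma>) * (m powr (- \<gamma>) * \<delta> x powr (- \<gamma>))" by (simp only: powr_mult)
    finally have "f (u x) * u x powr (- \<gamma>) \<le> (\<kappa> * T powr (q - 1 + \<gamma>)) * (T powr (- \<gamma>) * (m powr (- \<gamma>) * \<delta> x powr (- \<gamma>)))"
      using fu \<kappa> by (intro mult_mono) auto
    also have "\<dots> = (T powr (q - 1 + \<gamma>) * T powr (- \<gamma>)) * (\<kappa> * m powr (- \<gamma>)) * \<delta> x powr (- \<gamma>)" by (simp only: mult_ac)
    also have "T powr (q - 1 + \<gamma>) * T powr (- \<gamma>) = T powr (q - 1)" by (simp add: powr_add[symmetric])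
    finally have "lam * (f (u x) * u x powr (- \<gamma>)) \<le> lam * (T powr (q - 1) * (\<kappa> * m powr (- \<gamma>)) * \<delta> x powr (- \<gamma>))"
      using lam by (intro mult_left_mono) auto
    also have "\<dots> = T powr (q - 1) * (lam * \<kappa> * m powr (- \<gamma>)) * \<delta> x powr (- \<gamma>)" by (simp only: mult_ac)
    also have "lam * \<kappa> * m powr (- \<gamma>) = c / 2" using lam m by (simp add: \<kappa>_def)
    finally show ?thesis .
  qed
  \<comment> \<open>The unspent half of the q-part, bounded below through \<delta> \<le> D.\<close>
  define chi0 where "chi0 = T powr (q - 1) * (c / 2) * D powr (- \<gamma>)"
  have chi0: "0 < chi0" using T c D by (simp add: chi0_def)
  have chi_le: "chi0 \<le> T powr (q - 1) * (c / 2) * \<delta> x powr (- \<gamma>)" if x: "x \<in> \<Omega>" for x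
    unfolding chi0_def using D\<Omega>[OF x] \<delta>_pos[OF x] \<gamma> c by (intro mult_left_mono powr_mono2') auto
  have rc: "continuous_on \<Omega> (\<lambda>x. f (u x) * u x powr (- \<gamma>))"
    using upos by (intro continuous_intros ucO continuous_on_compose2[OF f(1) ucO]) (auto simp: less_imp_le less_imp_neq[symmetric])
  have "weak_supersol \<Omega> p q \<gamma> f lam chi0 u"
    unfolding weak_supersol_def
  proof (intro exI[of _ "\<lambda>x. T *\<^sub>R W x"] conjI allI impI)
    show "sol_class q \<Omega> f u (\<lambda>x. T *\<^sub>R W x)" by (rule sol)
  next
    fix xi H assume adm: "admissible_test q \<Omega> xi H"
    let ?I = "\<lambda>g. \<integral>x. g x \<partial>lebesgue_on \<Omega>"
    let ?d = "\<lambda>x. \<delta> x powr (- \<gamma>) * xi x"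
    have ix: "integrable (lebesgue_on \<Omega>) xi" by (rule admissible_test_integrable[OF open_\<Omega> adm q])
    have ir: "integrable (lebesgue_on \<Omega>) (\<lambda>x. f (u x) * u x powr (- \<gamma>) * xi x)"
      by (rule admissible_reaction_integrable[OF open_\<Omega> adm q rc])
    \<comment> \<open>For the p-part nonnegativity is enough, hence the constant 0.\<close>
    have op_p: "0 * \<delta> x powr (- \<gamma>) \<le> exp (- (p - 1) * v \<epsilon> x) * (weight p \<epsilon> x * op_lower p \<epsilon> x)" for \<epsilon> x
      using op_lower_nonneg[OF p(1), of \<epsilon> x] by (simp add: weight_def)
    note Fp = flux_weak_lower[OF p(1) jp order_refl op_p q adm]
    note Fq = flux_weak_lower[OF q jq less_imp_le[OF c] low q adm]
    have "?I (\<lambda>x. lam * (f (u x) * u x powr (- \<gamma>) * xi x) + chi0 * xi x) \<le> ?I (\<lambda>x. T powr (q - 1) * (c * ?d x))"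
    proof (rule integral_mono)
      fix x assume "x \<in> space (lebesgue_on \<Omega>)"
      then have x: "x \<in> \<Omega>" by simp
      have "lam * (f (u x) * u x powr (- \<gamma>)) + chi0 \<le> T powr (q - 1) * c * \<delta> x powr (- \<gamma>)"
        using react[OF x] chi_le[OF x] by (simp add: algebra_simps)
      from mult_right_mono[OF this admissible_test_nonneg[OF adm, of x]]
      show "lam * (f (u x) * u x powr (- \<gamma>) * xi x) + chi0 * xi x \<le> T powr (q - 1) * (c * ?d x)" by (simp add: algebra_simps)
    qed (use ix ir Fq(2) in auto)
    then have "lam * ?I (\<lambda>x. f (u x) * u x powr (- \<gamma>) * xi x) + chi0 * ?I xi \<le> T powr (q - 1) * (c * ?I ?d)"
      using ix ir by simp
    also have "\<dots> \<le> T powr (p - 1) * ?I (\<lambda>x. flux p x \<bullet> H x) + T powr (q - 1) * ?I (\<lambda>x. flux q x \<bullet> H x)"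
    proof -
      have "0 \<le> T powr (p - 1) * ?I (\<lambda>x. flux p x \<bullet> H x)" using Fp(3) by (intro mult_nonneg_nonneg) auto
      moreover have "T powr (q - 1) * (c * ?I ?d) \<le> T powr (q - 1) * ?I (\<lambda>x. flux q x \<bullet> H x)"
        using Fq(3) by (intro mult_left_mono) auto
      ultimately show ?thesis by linarith
    qed
    also have "\<dots> = ?I (\<lambda>x. T powr (p - 1) * (flux p x \<bullet> H x) + T powr (q - 1) * (flux q x \<bullet> H x))"
      using Fp(1) Fq(1) by simp
    also have "\<dots> = ?I (\<lambda>x. pq_flux p q (T *\<^sub>R W x) (H x))"
      unfolding pq_flux_scaleR[OF T(2)] flux_def reg_flux_0 W_def ..
    finally show "lam * ?I (\<lambda>x. f (u x) * u x powr (- \<gamma>) * xi x) + chi0 * ?I xi \<le> ?I (\<lambda>x. pq_flux p q (T *\<^sub>R W x) (H x))" .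
  qed
  moreover have "C1l_closure \<Omega> l u"
    by (rule C1l_closureI[OF l(1) uc ud hoelder_scaleR[OF hoelder_const Wh]])
  moreover have "C_delta_plus \<Omega> u"
  proof (rule C_delta_plusI[OF open_\<Omega> uc u0])
    show "0 < T * m" using T m by simp
    show "T * m * infdist x (frontier \<Omega>) \<le> u x" if "x \<in> \<Omega>" for x
      unfolding u_def using mult_left_mono[OF wlow[OF that], of T] T by (simp add: \<delta>_def mult.assoc)
    show "u x \<le> T * (3 powr j * exp 2 + Y * (3 / a)) * infdist x (frontier \<Omega>)" if "x \<in> \<Omega>" for x
      unfolding u_def using mult_left_mono[OF wup[OF that], of T] T by (simp add: \<delta>_def mult.assoc)
  qed
  ultimately show ?thesis using chi0 by blast
qed

end

theorem theorem2p2: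
  fixes \<Omega> :: "'a::euclidean_space set" and p q \<gamma> :: real and f :: "real \<Rightarrow> real"
  assumes "open \<Omega>" and "bounded \<Omega>" and "C2_boundary \<Omega>"
    and "1 < p" and "p < q" and "0 < \<gamma>" and "\<gamma> < 1"
    and f0: "\<exists>f'. continuous_on {0..} f' \<and> (\<forall>t\<ge>0. (f has_real_derivative f' t) (at t within {0..}))"
    and f0': "f 0 > 0"
    and f1: "mono_on {0..} f"
    and f2': "((\<lambda>t. f t / t powr (q - 1 + \<gamma>)) \<longlongrightarrow> 0) at_top"
  shows "\<forall>lam>0. \<exists>u0 U0 chi_sub chi_sup l.
     0 < l \<and> l < 1 \<and> 0 < chi_sub \<and> 0 < chi_sup \<and>
     weak_subsol \<Omega> p q \<gamma> f lam 0 u0 \<and> weak_subsol \<Omega> p q \<gamma> f lam chi_sub u0 \<and>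
     weak_supersol \<Omega> p q \<gamma> f lam 0 U0 \<and> weak_supersol \<Omega> p q \<gamma> f lam chi_sup U0 \<and>
     C1l_closure \<Omega> l u0 \<and> C_delta_plus \<Omega> u0 \<and>
     C1l_closure \<Omega> l U0 \<and> C_delta_plus \<Omega> U0"
proof (intro allI impI)
  fix lam :: real assume lam: "0 < lam"
  have q: "1 < q" using assms by simp
  have fc: "continuous_on {0..} f"
  proof -
    from f0 obtain f' where "\<forall>t\<ge>0. (f has_real_derivative f' t) (at t within {0..})" by blast
    then show ?thesis by (auto simp: continuous_on_eq_continuous_within intro: DERIV_continuous)
  qed
  obtain a0 C \<nu> \<nu>' where col: "0 < a0" "0 \<le> C" "C1_on {x \<in> \<Omega>. infdist x (frontier \<Omega>) < a0} \<nu> \<nu>'"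
    "\<And>x. x \<in> \<Omega> \<Longrightarrow> infdist x (frontier \<Omega>) < a0 \<Longrightarrow> norm (\<nu> x) = 1"
    "\<And>x. x \<in> \<Omega> \<Longrightarrow> infdist x (frontier \<Omega>) < a0 \<Longrightarrow> ((\<lambda>x. infdist x (frontier \<Omega>)) has_derivative (\<lambda>h. \<nu> x \<bullet> h)) (at x)"
    "\<And>x h. x \<in> \<Omega> \<Longrightarrow> infdist x (frontier \<Omega>) < a0 \<Longrightarrow> norm (\<nu>' x h) \<le> C * norm h"
    "\<And>x y. x \<in> \<Omega> \<Longrightarrow> infdist x (frontier \<Omega>) < a0 \<Longrightarrow> y \<in> \<Omega> \<Longrightarrow> infdist y (frontier \<Omega>) < a0 \<Longrightarrow> norm (\<nu> x - \<nu> y) \<le> C * dist x y"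
    by (rule distance_C2_collar[OF assms(1-3)]) (rule that)
  \<comment> \<open>Yields both 4a \<le> a0, which fits the construction into the collar, and 3a
    \<le> 1.\<close>
  define a where "a = min 1 a0 / 4"
  have a: "0 < a" "3 * a \<le> 1" "4 * a \<le> a0" using col(1) by (auto simp: a_def)
  have sub: "{x \<in> \<Omega>. infdist x (frontier \<Omega>) < 4 * a} \<subseteq> {x \<in> \<Omega>. infdist x (frontier \<Omega>) < a0}" using a by auto
  have collar: "collar \<Omega> a C \<nu> \<nu>'"
    by unfold_locales (use assms(1,2) a col C1_on_subset[OF col(3) sub] in auto)
  obtain e :: 'a where e: "norm e = 1" by (rule vector_choose_size[of 1]) auto
  obtain B where B: "\<And>x. x \<in> \<Omega> \<Longrightarrow> norm x \<le> B" using assms(2) by (auto simp: bounded_iff)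
  \<comment> \<open>By Cauchy-Schwarz, adding a bound B for the norm on \<Omega> makes the affine
    function nonnegative.\<close>
  have y: "0 \<le> e \<bullet> x + B" "e \<bullet> x + B \<le> 2 * B" if "x \<in> \<Omega>" for x
    using Cauchy_Schwarz_ineq2[of e x] e B[OF that] by auto
  define \<alpha> where "\<alpha> = 1 / q"
  \<comment> \<open>The later \<open>threshold\<close>, spelled out before the locale is
    interpreted. It does not involve j, so j can be chosen from it for both exponents at
    once.\<close>
  define th where "th r = 6 / a * (1 + \<bar>r - 2\<bar>) + C * (real DIM('a) + \<bar>r - 2\<bar>) * (1 + 3 * (2 * B) / a)" for r
  define j where "j = Max {2, th p * (3 * a) / min 1 (p - 1), th q * (3 * a) / min 1 (q - 1)}"
  have j_ge: "2 \<le> j" "th p * (3 * a) / min 1 (p - 1) \<le> j" "th q * (3 * a) / min 1 (q - 1) \<le> j"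
    unfolding j_def by (rule Max_ge; simp)+
  have alpha: "0 < \<alpha>" "\<alpha> < 1" "\<alpha> * (q - 1) \<le> 1" using q by (auto simp: \<alpha>_def field_simps)
  interpret barrier \<Omega> a C \<nu> \<nu>' \<alpha> \<gamma> j e B "2 * B"
    by (intro barrier.intro barrier_axioms.intro collar profile.intro)
      (use a alpha assms(6,7) j_ge e y in auto)
  have thr: "threshold r \<le> min 1 (r - 1) * (j / (3 * a))" if "1 < r" "th r * (3 * a) / min 1 (r - 1) \<le> j" for r
  proof -
    have "0 < min 1 (r - 1)" using that by simp
    then have "th r * (3 * a) \<le> j * min 1 (r - 1)" using that by (simp only: pos_divide_le_eq)
    moreover have "threshold r = th r" by (simp only: threshold_def th_def)
    ultimately show ?thesis using a by (simp add: field_simps)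
  qed
  define l where "l = min \<alpha> (1 - \<gamma>)"
  have l: "0 < l" "l \<le> \<alpha>" "l \<le> 1 - \<gamma>" "l < 1" using alpha assms(6,7) by (auto simp: l_def)
  obtain u0 chi_sub where u0: "0 < chi_sub" "weak_subsol \<Omega> p q \<gamma> f lam chi_sub u0" "C1l_closure \<Omega> l u0" "C_delta_plus \<Omega> u0"
    using strict_subsolution[OF assms(4-6) l(1) less_imp_le[OF l(4)] lam fc f0' f1] by blast
  obtain U0 chi_sup where U0: "0 < chi_sup" "weak_supersol \<Omega> p q \<gamma> f lam chi_sup U0" "C1l_closure \<Omega> l U0" "C_delta_plus \<Omega> U0"
    using strict_supersolution[OF assms(4,5) alpha(3) thr[OF assms(4) j_ge(2)] thr[OF q j_ge(3)] l(1-3) lam fc f0' f1 f2'] by blast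
  show "\<exists>u0 U0 chi_sub chi_sup l.
     0 < l \<and> l < 1 \<and> 0 < chi_sub \<and> 0 < chi_sup \<and>
     weak_subsol \<Omega> p q \<gamma> f lam 0 u0 \<and> weak_subsol \<Omega> p q \<gamma> f lam chi_sub u0 \<and>
     weak_supersol \<Omega> p q \<gamma> f lam 0 U0 \<and> weak_supersol \<Omega> p q \<gamma> f lam chi_sup U0 \<and>
     C1l_closure \<Omega> l u0 \<and> C_delta_plus \<Omega> u0 \<and>
     C1l_closure \<Omega> l U0 \<and> C_delta_plus \<Omega> U0"
    using u0 U0 l weak_subsol_mono[OF u0(2)] weak_supersol_mono[OF U0(2)] by (meson less_imp_le)
qed

end
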